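(* Let $l>0$ and let $f_0\in H^2(\mathbb{T})$ be odd, with $\|f_0\|_{L^\infty}<l$, satisfying the stability condition $\frac{1}{1+(\partial_x f_0(x))^2}>\frac{1}{1+l^2-(f_0(x))^2}$ for all $x$. Then there exists $\delta>0$ such that if $\|f_0\|_{H^2(\mathbb{T})}\leq\delta$, there exists at least one global in time solution of $\partial_t f=\left(-\frac{1}{1+(\partial_x f)^2}+\frac{1}{1+l^2-f^2}\right)\Lambda f$, $f(\cdot,0)=f_0$, and it satisfies $$\|f(t)\|_{H^1(\mathbb{T})}\leq\frac{l}{4}e^{-\mathcal{C}_l t},\qquad \|f(t)\|_{C^1(\mathbb{T})}\leq\|f_0\|_{C^1(\mathbb{T})},\qquad \mathcal{C}_l=\frac{l^2}{1+l^2}.$$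
   Context: $\Lambda=\sqrt{-\partial_x^2}$ is the operator with Fourier symbol $|\xi|$. *)

theory Defs
  imports "HOL-Analysis.Analysis"
begin

text \<open>The torus T is identified with 2*pi-periodic functions on the real line;
  integrals are over one period [0, 2*pi].\<close>

definition periodic2pi :: "(real \<Rightarrow> 'a) \<Rightarrow> bool" where
  "periodic2pi f \<longleftrightarrow> (\<forall>x. f (x + 2*pi) = f x)"

definition in_L2 :: "(real \<Rightarrow> real) \<Rightarrow> bool" where
  "in_L2 f \<longleftrightarrow> f measurable_on {0..2*pi} \<and> (\<lambda>x. (f x)^2) integrable_on {0..2*pi}"

definition fcoeff :: "(real \<Rightarrow> real) \<Rightarrow> int \<Rightarrow> complex" where
  "fcoeff f k = integral {0..2*pi} (\<lambda>x. complex_of_real (f x) * cis (- (real_of_int k * x))) / (2*pi)"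

text \<open>Sobolev space H^s(T), with norm
  ||f||_{H^s}^2 = ||f||_{L^2}^2 + ||Lambda^s f||_{L^2}^2 = 2 pi sum_k (1+|k|^(2s)) |f_k|^2.\<close>
definition in_Hs :: "nat \<Rightarrow> (real \<Rightarrow> real) \<Rightarrow> bool" where
  "in_Hs s f \<longleftrightarrow> periodic2pi f \<and> in_L2 f \<and>
     (\<lambda>k::int. (1 + (\<bar>real_of_int k\<bar>) ^ (2 * s)) * (cmod (fcoeff f k))^2) summable_on UNIV"

definition Hs_norm :: "nat \<Rightarrow> (real \<Rightarrow> real) \<Rightarrow> real" where
  "Hs_norm s f = sqrt (2*pi * infsum (\<lambda>k::int. (1 + (\<bar>real_of_int k\<bar>) ^ (2 * s)) * (cmod (fcoeff f k))^2) UNIV)"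

definition is_Lambda :: "(real \<Rightarrow> real) \<Rightarrow> (real \<Rightarrow> real) \<Rightarrow> bool" where
  "is_Lambda f g \<longleftrightarrow> periodic2pi g \<and> in_L2 g \<and>
     (\<forall>k. fcoeff g k = complex_of_real \<bar>real_of_int k\<bar> * fcoeff f k)"

definition periodic_C1 :: "(real \<Rightarrow> real) \<Rightarrow> bool" where
  "periodic_C1 f \<longleftrightarrow> periodic2pi f \<and> (\<forall>x. f differentiable (at x)) \<and> continuous_on UNIV (deriv f)"

definition sup_norm :: "(real \<Rightarrow> real) \<Rightarrow> real" where
  "sup_norm f = (SUP x. \<bar>f x\<bar>)"

definition C1_norm :: "(real \<Rightarrow> real) \<Rightarrow> real" where
  "C1_norm f = sup_norm f + sup_norm (deriv f)"

definition test_fun :: "(real \<Rightarrow> real \<Rightarrow> real) \<Rightarrow> (real \<Rightarrow> real \<Rightarrow> real) \<Rightarrow> bool" where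
  "test_fun \<phi> \<phi>t \<longleftrightarrow>
     (\<forall>t. periodic2pi (\<phi> t)) \<and>
     (\<exists>T. \<forall>t\<ge>T. \<forall>x. \<phi> t x = 0) \<and>
     (\<forall>t x. ((\<lambda>s. \<phi> s x) has_real_derivative \<phi>t t x) (at t)) \<and>
     continuous_on UNIV (\<lambda>p. \<phi> (fst p) (snd p)) \<and>
     continuous_on UNIV (\<lambda>p. \<phi>t (fst p) (snd p))"

definition coef :: "real \<Rightarrow> (real \<Rightarrow> real) \<Rightarrow> real \<Rightarrow> real" where
  "coef l h x = - 1 / (1 + (deriv h x)^2) + 1 / (1 + l^2 - (h x)^2)"

definition global_solution :: "real \<Rightarrow> (real \<Rightarrow> real) \<Rightarrow> (real \<Rightarrow> real \<Rightarrow> real) \<Rightarrow> bool" where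
  "global_solution l f0 f \<longleftrightarrow>
     f 0 = f0 \<and>
     (\<forall>t\<ge>0. periodic_C1 (f t) \<and> in_Hs 1 (f t)) \<and>
     (\<exists>g. (\<forall>t\<ge>0. is_Lambda (f t) (g t)) \<and>
        (\<forall>\<phi> \<phi>t. test_fun \<phi> \<phi>t \<longrightarrow>
           (\<lambda>p. f (fst p) (snd p) * \<phi>t (fst p) (snd p)) integrable_on ({0..} \<times> {0..2*pi}) \<and>
           (\<lambda>p. coef l (f (fst p)) (snd p) * g (fst p) (snd p) * \<phi> (fst p) (snd p))
              integrable_on ({0..} \<times> {0..2*pi}) \<and>
           integral ({0..} \<times> {0..2*pi}) (\<lambda>p. f (fst p) (snd p) * \<phi>t (fst p) (snd p))
           + integral {0..2*pi} (\<lambda>x. f0 x * \<phi> 0 x)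
           + integral ({0..} \<times> {0..2*pi})
               (\<lambda>p. coef l (f (fst p)) (snd p) * g (fst p) (snd p) * \<phi> (fst p) (snd p)) = 0))"

end

theory Submission
  imports Defs
begin

text \<open>
  Write \<open>m = 1 + l\<^sup>2\<close> and \<open>C = l\<^sup>2 / m\<close>. The equation is \<open>f\<^sub>t + C \<Lambda>f = (p + q) \<Lambda>f\<close> with the quadratically small
  functions \<open>p = f\<^sub>x\<^sup>2 / (1 + f\<^sub>x\<^sup>2)\<close> and \<open>q = 1 / (m - f\<^sup>2) - 1 / m\<close>. The norm
  \<open>\<Sum>\<^sub>k sup\<^sub>t e\<^bsup>C t\<^esup> |u\<^sub>k(t)|\<close> on Fourier coefficients is submultiplicative, and in it the Duhamel
  operator gains a full derivative mode by mode, because \<open>|k| \<integral>\<^sub>0\<^sup>t e\<^bsup>-C|k|(t-s)\<^esup> ds \<le> 1/C\<close>. So for small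
  data the system for \<open>(\<Lambda>f, p, q)\<close>, which is polynomial because \<open>p = f\<^sub>x\<^sup>2 (1 - p)\<close> and
  \<open>m\<^sup>2 q = f\<^sup>2 (1 + m q)\<close>, is solved by contraction; the solution is classical and decays like \<open>e\<^bsup>-C t\<^esup>\<close>.

  The bound on the \<open>C\<^sup>1\<close> norm is a maximum principle. If a function \<open>w\<close> of mean zero attains its maximum at
  \<open>x\<close>, then comparison with the Poisson kernel gives \<open>\<Lambda>w(x) \<ge> w(x) / 2\<close>. This is applied to \<open>f\<close> and, instead
  of \<open>f\<^sub>x\<close>, to the differences \<open>f(x + h) - f(x)\<close>: at a maximum of the difference \<open>f\<^sub>x(x + h) = f\<^sub>x(x)\<close>, so the
  coefficients at \<open>x + h\<close> and \<open>x\<close> differ only through \<open>f\<^sup>2\<close>, and no bound on \<open>f\<^sub>x\<^sub>x\<close> is needed.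
\<close>

section \<open>Infinite sums of functions\<close>

text \<open>The rates in the weights shape the estimates. Rates add under products, so the nonlinear
  term decays like e^(-2Ct); a source decaying only like e^(-Ct) would resonate with the modes k = 1
  and k = -1 and cost a factor t. Taking p and q as separate unknowns replaces composition with
  1/(1+y^2) and 1/(m-y^2) by products, the one nonlinear operation that convolution supplies.
  Afterwards p and q are recovered at each point from linear equations. Oddness serves twice: it
  removes the mode k = 0, where Lambda neither damps nor has an inverse, and it lets all arrays be
  real. The data enter through the sum of |k| |phi_k|, which the H^2 norm controls by Cauchy-Schwarz
  against the sum of 1/k^2. The l1 bound on u = Lambda f yields the H^1 bound, because an l2 norm is
  at most the l1 norm. The 1/2 in the bound at a maximum is the limit, as r tends to 1, of the
  minimum (1-r)/(1+r) of the Poisson kernel divided by 1-r.\<close>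

lemma l1_conv:
  fixes a b :: "int \<Rightarrow> 'a::{real_normed_field,banach}"
  assumes a: "(\<lambda>k. norm (a k)) summable_on UNIV" and b: "(\<lambda>k. norm (b k)) summable_on UNIV"
  shows l1_conv_summable: "(\<lambda>j. norm (a j * b (k - j))) summable_on UNIV"
    and l1_conv_abs: "(\<lambda>k. norm (\<Sum>\<^sub>\<infinity>j. a j * b (k - j))) summable_on UNIV"
    and l1_conv_infsum: "(\<Sum>\<^sub>\<infinity>k. \<Sum>\<^sub>\<infinity>j. a j * b (k - j)) = infsum a UNIV * infsum b UNIV"
proof -
  \<comment> \<open>The shear (k, j) -> (j, k - j) permutes Z x Z, so every claim reduces to
    absolute summability of the product family a_i b_j.\<close>
  have bij: "bij_betw (\<lambda>(k::int, j::int). (j, k - j)) (UNIV \<times> UNIV) (UNIV \<times> UNIV)"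
    by (rule bij_betw_byWitness[where f' = "\<lambda>(i, j). (i + j, i)"]) auto
  have prod: "(\<lambda>p. norm (case p of (i, j) \<Rightarrow> a i * b j)) summable_on UNIV \<times> UNIV"
    unfolding Infinite_Sum.abs_summable_on_Sigma_iff using a b
    by (auto simp: norm_mult infsum_cmult_right' abs_mult infsum_nonneg intro!: summable_on_cmult_left summable_on_cmult_right)
  have sm: "(\<lambda>p. norm (case p of (k, j) \<Rightarrow> a j * b (k - j))) summable_on UNIV \<times> UNIV"
    using summable_on_reindex_bij_betw[OF bij, of "\<lambda>(i, j). norm (a i * b j)"] prod
    by (simp add: case_prod_unfold)
  have S: "(\<lambda>j. norm (a j * b (k - j))) summable_on UNIV"
      "(\<lambda>k. norm (\<Sum>\<^sub>\<infinity>j. norm (a j * b (k - j)))) summable_on UNIV" for k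
    using sm unfolding Infinite_Sum.abs_summable_on_Sigma_iff by auto
  show "(\<lambda>j. norm (a j * b (k - j))) summable_on UNIV"
    by (rule S)
  show "(\<lambda>k. norm (\<Sum>\<^sub>\<infinity>j. a j * b (k - j))) summable_on UNIV"
  proof (rule Infinite_Sum.abs_summable_on_comparison_test[OF S(2)])
    show "norm (\<Sum>\<^sub>\<infinity>j. a j * b (k - j)) \<le> norm (\<Sum>\<^sub>\<infinity>j. norm (a j * b (k - j)))" for k
      using norm_infsum_bound[OF S(1)[of k]] by simp
  qed
  have "(\<Sum>\<^sub>\<infinity>k. \<Sum>\<^sub>\<infinity>j. a j * b (k - j)) = infsum (\<lambda>(k, j). a j * b (k - j)) (UNIV \<times> UNIV)"
    by (rule infsum_Sigma'_banach) (rule abs_summable_summable[OF sm])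
  also have "\<dots> = infsum (\<lambda>(i, j). a i * b j) (UNIV \<times> UNIV)"
    using infsum_reindex_bij_betw[OF bij, of "\<lambda>(i, j). a i * b j"]
    by (simp add: case_prod_unfold)
  also have "\<dots> = (\<Sum>\<^sub>\<infinity>i. \<Sum>\<^sub>\<infinity>j. a i * b j)"
    by (rule infsum_Sigma'_banach[symmetric]) (rule abs_summable_summable[OF prod])
  also have "\<dots> = infsum a UNIV * infsum b UNIV"
    by (simp add: infsum_cmult_left' infsum_cmult_right')
  finally show "(\<Sum>\<^sub>\<infinity>k. \<Sum>\<^sub>\<infinity>j. a j * b (k - j)) = infsum a UNIV * infsum b UNIV" .
qed

lemma continuous_on_infsum:
  fixes f :: "'a \<Rightarrow> 'b::topological_space \<Rightarrow> 'c::banach"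
  assumes "\<And>k x. x \<in> S \<Longrightarrow> norm (f k x) \<le> a k" "a summable_on UNIV" "\<And>k. continuous_on S (f k)"
  shows "continuous_on S (\<lambda>x. \<Sum>\<^sub>\<infinity>k. f k x)"
proof (rule uniform_limit_theorem[where F = "finite_subsets_at_top UNIV"])
  show "uniform_limit S (\<lambda>X x. \<Sum>k\<in>X. f k x) (\<lambda>x. \<Sum>\<^sub>\<infinity>k. f k x) (finite_subsets_at_top UNIV)"
    using assms by (intro Weierstrass_m_test_general[where M = a]) auto
  show "\<forall>\<^sub>F X in finite_subsets_at_top UNIV. continuous_on S (\<lambda>x. \<Sum>k\<in>X. f k x)"
    by (intro always_eventually allI continuous_on_sum assms)
qed simp

lemma abs_summable_of_bound:
  fixes f :: "'a \<Rightarrow> 'c::real_normed_vector"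
  assumes "a summable_on UNIV" "\<And>k. norm (f k) \<le> a k"
  shows "(\<lambda>k. norm (f k)) summable_on UNIV"
  by (rule summable_on_comparison_test[OF assms(1)]) (use assms(2) in auto)

lemma integral_infsum:
  fixes f :: "'a \<Rightarrow> real \<Rightarrow> 'c::banach"
  assumes "\<And>k x. x \<in> {c..d} \<Longrightarrow> norm (f k x) \<le> a k" "a summable_on UNIV"
    and "\<And>k. continuous_on {c..d} (f k)"
  shows "integral {c..d} (\<lambda>x. \<Sum>\<^sub>\<infinity>k. f k x) = (\<Sum>\<^sub>\<infinity>k. integral {c..d} (f k))"
proof -
  have ul: "uniform_limit {c..d} (\<lambda>X x. \<Sum>k\<in>X. f k x) (\<lambda>x. \<Sum>\<^sub>\<infinity>k. f k x) (finite_subsets_at_top UNIV)"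
    using assms by (intro Weierstrass_m_test_general[where M = a]) auto
  obtain I J where I: "\<And>X. ((\<lambda>x. \<Sum>k\<in>X. f k x) has_integral I X) {c..d}"
      and J: "((\<lambda>x. \<Sum>\<^sub>\<infinity>k. f k x) has_integral J) {c..d}" and IJ: "(I \<longlongrightarrow> J) (finite_subsets_at_top UNIV)"
    by (rule uniform_limit_integral[OF ul]) (auto intro!: continuous_on_sum assms)
  have "I X = (\<Sum>k\<in>X. integral {c..d} (f k))" if "finite X" for X
    using that integral_unique[OF I[of X]]
    by (subst (asm) integral_sum) (auto intro: integrable_continuous_interval assms)
  with IJ have "((\<lambda>X. \<Sum>k\<in>X. integral {c..d} (f k)) \<longlongrightarrow> J)
      (finite_subsets_at_top UNIV)"
    by (elim Lim_transform_eventually) (auto intro!: eventually_finite_subsets_at_top_weakI)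
  then show ?thesis
    using integral_unique[OF J] by (simp add: has_sum_def[symmetric] infsumI)
qed

text \<open>Termwise differentiation of a sequence of functions, transported to integer indices by
  the enumeration \<open>int_decode\<close>. The derivative is taken within S because it is used on
  the whole line in space and on {0..} in time, where t = 0 admits only a one-sided
  derivative.\<close>

lemma has_real_derivative_infsum:
  fixes f :: "int \<Rightarrow> real \<Rightarrow> real"
  assumes S: "convex S" and d: "\<And>k x. x \<in> S \<Longrightarrow> (f k has_real_derivative f' k x) (at x within S)"
    and a: "\<And>k x. x \<in> S \<Longrightarrow> \<bar>f' k x\<bar> \<le> a k" "a summable_on UNIV"
    and s: "\<And>x. x \<in> S \<Longrightarrow> (\<lambda>k. f k x) summable_on UNIV" and x: "x \<in> S"
  shows "((\<lambda>x. \<Sum>\<^sub>\<infinity>k. f k x) has_real_derivative (\<Sum>\<^sub>\<infinity>k. f' k x)) (at x within S)"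
proof -
  let ?e = "int_decode"
  have bij: "bij_betw ?e UNIV UNIV" by (rule bij_int_decode)
  have conv: "(\<lambda>n. g (?e n)) sums (\<Sum>\<^sub>\<infinity>k. g k)" if "g summable_on UNIV" for g :: "int \<Rightarrow> real"
    using that summable_on_reindex_bij_betw[OF bij, of g] infsum_reindex_bij_betw[OF bij, of g]
    by (metis has_sum_imp_sums has_sum_infsum)
  have sm': "(\<lambda>k. f' k y) summable_on UNIV" if "y \<in> S" for y
    using abs_summable_of_bound[OF a(2), of "\<lambda>k. f' k y"] a(1)[OF that] abs_summable_summable by fastforce
  have "uniform_limit S (\<lambda>n x. \<Sum>i<n. f' (?e i) x) (\<lambda>x. \<Sum>i. f' (?e i) x) sequentially"
  proof (rule Weierstrass_m_test[where M = "\<lambda>i. a (?e i)"])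
    show "summable (\<lambda>i. a (?e i))" using conv[OF a(2)] sums_summable by blast
  qed (use a in auto)
  moreover have "summable (\<lambda>n. f (?e n) x)"
    using conv[OF s[OF x]] sums_summable by blast
  ultimately have "\<exists>g. \<forall>x\<in>S. (\<lambda>n. f (?e n) x) sums g x \<and>
      (g has_field_derivative (\<Sum>i. f' (?e i) x)) (at x within S)"
    using S d x by (intro has_field_derivative_series[where f = "\<lambda>n. f (?e n)" and f' = "\<lambda>n. f' (?e n)"]) auto
  then obtain g where g: "\<And>x. x \<in> S \<Longrightarrow> (\<lambda>n. f (?e n) x) sums g x"
      "\<And>x. x \<in> S \<Longrightarrow> (g has_field_derivative (\<Sum>i. f' (?e i) x)) (at x within S)"
    by auto
  have "g y = (\<Sum>\<^sub>\<infinity>k. f k y)" if "y \<in> S" for y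
    using g(1)[OF that] conv[OF s[OF that]] sums_unique2 by blast
  moreover have "(\<Sum>i. f' (?e i) x) = (\<Sum>\<^sub>\<infinity>k. f' k x)"
    using conv[OF sm'[OF x]] sums_unique by metis
  ultimately have "(g has_real_derivative (\<Sum>\<^sub>\<infinity>k. f' k x)) (at x within S)"
    and eq: "\<And>y. y \<in> S \<Longrightarrow> g y = (\<Sum>\<^sub>\<infinity>k. f k y)"
    using g(2)[OF x] by auto
  then show ?thesis
    by (rule has_field_derivative_transform_within[OF _ zero_less_one x]) (use eq in auto)
qed

section \<open>Time-dependent Wiener algebra\<close>

text \<open>\<open>wiener_le c u M\<close> says \<open>\<Sum>\<^sub>k sup\<^sub>t\<^sub>\<ge>\<^sub>0 e\<^bsup>c t\<^esup> |u\<^sub>k(t)| \<le> M\<close>, phrased with a summable majorant.\<close>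

definition wiener_le :: "real \<Rightarrow> (int \<Rightarrow> real \<Rightarrow> real) \<Rightarrow> real \<Rightarrow> bool" where
  "wiener_le c u M \<longleftrightarrow> (\<forall>k. continuous_on {0..} (u k)) \<and>
     (\<exists>a. a summable_on UNIV \<and> infsum a UNIV \<le> M \<and> (\<forall>k. \<forall>t\<ge>0. \<bar>u k t\<bar> \<le> a k * exp (- (c * t))))"

definition conv :: "(int \<Rightarrow> real \<Rightarrow> real) \<Rightarrow> (int \<Rightarrow> real \<Rightarrow> real) \<Rightarrow> int \<Rightarrow> real \<Rightarrow> real" where
  "conv u v k t = (\<Sum>\<^sub>\<infinity>j. u j t * v (k - j) t)"

lemma wiener_leE:
  assumes "wiener_le c u M"
  obtains a where "a summable_on UNIV" "infsum a UNIV \<le> M" "\<And>k. a k \<ge> 0"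
    "\<And>k t. t \<ge> 0 \<Longrightarrow> \<bar>u k t\<bar> \<le> a k * exp (- (c * t))"
proof -
  from assms obtain a where a: "a summable_on UNIV" "infsum a UNIV \<le> M"
    "\<And>k t. t \<ge> 0 \<Longrightarrow> \<bar>u k t\<bar> \<le> a k * exp (- (c * t))"
    unfolding wiener_le_def by blast
  have "a k \<ge> 0" for k using a(3)[of 0 k] by simp
  with a that show ?thesis by blast
qed

lemma wiener_leI:
  assumes "\<And>k. continuous_on {0..} (u k)" "a summable_on UNIV" "infsum a UNIV \<le> M"
    "\<And>k t. t \<ge> 0 \<Longrightarrow> \<bar>u k t\<bar> \<le> a k * exp (- (c * t))"
  shows "wiener_le c u M"
  using assms unfolding wiener_le_def by blast

lemma wiener_le_continuous: "wiener_le c u M \<Longrightarrow> continuous_on {0..} (u k)"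
  unfolding wiener_le_def by blast

lemma wiener_le_nonneg: "wiener_le c u M \<Longrightarrow> M \<ge> 0"
  by (erule wiener_leE) (rule order_trans[OF infsum_nonneg], auto)

lemma wiener_le_summable:
  assumes "wiener_le c u M" "t \<ge> 0"
  shows "(\<lambda>k. \<bar>u k t\<bar>) summable_on UNIV" "(\<Sum>\<^sub>\<infinity>k. \<bar>u k t\<bar>) \<le> M * exp (- (c * t))"
proof -
  obtain a where a: "a summable_on UNIV" "infsum a UNIV \<le> M"
    "\<And>k t. t \<ge> 0 \<Longrightarrow> \<bar>u k t\<bar> \<le> a k * exp (- (c * t))"
    by (rule wiener_leE[OF assms(1)]) blast
  have s: "(\<lambda>k. a k * exp (- (c * t))) summable_on UNIV"
    using a(1) by (rule summable_on_cmult_left)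
  show 1: "(\<lambda>k. \<bar>u k t\<bar>) summable_on UNIV"
    by (rule summable_on_comparison_test[OF s]) (use a(3) assms(2) in auto)
  have "(\<Sum>\<^sub>\<infinity>k. \<bar>u k t\<bar>) \<le> (\<Sum>\<^sub>\<infinity>k. a k * exp (- (c * t)))"
    by (rule infsum_mono[OF 1 s]) (use a(3) assms(2) in auto)
  also have "\<dots> = infsum a UNIV * exp (- (c * t))"
    by (simp add: infsum_cmult_left')
  also have "\<dots> \<le> M * exp (- (c * t))"
    using a(2) by (simp add: mult_right_mono)
  finally show "(\<Sum>\<^sub>\<infinity>k. \<bar>u k t\<bar>) \<le> M * exp (- (c * t))" .
qed

lemma wiener_le_bound:
  assumes "wiener_le c u M" "t \<ge> 0"
  shows "\<bar>u k t\<bar> \<le> M * exp (- (c * t))"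
proof -
  have "(\<Sum>k\<in>{k}. \<bar>u k t\<bar>) \<le> (\<Sum>\<^sub>\<infinity>k. \<bar>u k t\<bar>)"
    by (rule finite_sum_le_infsum[OF wiener_le_summable(1)[OF assms]]) auto
  with wiener_le_summable(2)[OF assms] show ?thesis by simp
qed

lemma wiener_le_mono:
  assumes "wiener_le c u M" "c' \<le> c" "M \<le> M'"
  shows "wiener_le c' u M'"
proof -
  obtain a where a: "a summable_on UNIV" "infsum a UNIV \<le> M" "\<And>k. a k \<ge> 0"
    "\<And>k t. t \<ge> 0 \<Longrightarrow> \<bar>u k t\<bar> \<le> a k * exp (- (c * t))"
    by (rule wiener_leE[OF assms(1)]) blast
  show ?thesis
  proof (rule wiener_leI[OF wiener_le_continuous[OF assms(1)] a(1)])
    fix k and t :: real assume t: "t \<ge> 0"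
    have "a k * exp (- (c * t)) \<le> a k * exp (- (c' * t))"
      using a(3) t assms(2) by (intro mult_left_mono) (auto simp: mult_right_mono)
    with a(4)[OF t, of k] show "\<bar>u k t\<bar> \<le> a k * exp (- (c' * t))" by simp
  qed (use a(2) assms(3) in auto)
qed

text \<open>The identities between arrays hold for t >= 0 only; values at negative times are
  arbitrary.\<close>

lemma wiener_le_cong:
  assumes "wiener_le c u M" "\<And>k t. t \<ge> 0 \<Longrightarrow> u k t = v k t"
  shows "wiener_le c v M"
proof -
  have "continuous_on {0..} (v k) \<longleftrightarrow> continuous_on {0..} (u k)" for k
    by (rule continuous_on_cong) (use assms(2) in auto)
  with assms show ?thesis unfolding wiener_le_def by auto
qed

lemma wiener_le_lincomb:
  assumes u: "wiener_le c u M" and v: "wiener_le c v M'"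
  shows "wiener_le c (\<lambda>k t. r * u k t + s * v k t) (\<bar>r\<bar> * M + \<bar>s\<bar> * M')"
proof -
  obtain a where a: "a summable_on UNIV" "infsum a UNIV \<le> M"
    "\<And>k t. t \<ge> 0 \<Longrightarrow> \<bar>u k t\<bar> \<le> a k * exp (- (c * t))"
    by (rule wiener_leE[OF u]) blast
  obtain b where b: "b summable_on UNIV" "infsum b UNIV \<le> M'"
    "\<And>k t. t \<ge> 0 \<Longrightarrow> \<bar>v k t\<bar> \<le> b k * exp (- (c * t))"
    by (rule wiener_leE[OF v]) blast
  have s: "(\<lambda>k. \<bar>r\<bar> * a k) summable_on UNIV" "(\<lambda>k. \<bar>s\<bar> * b k) summable_on UNIV"
    by (intro summable_on_cmult_right a b)+
  show ?thesis
  proof (rule wiener_leI[where a = "\<lambda>k. \<bar>r\<bar> * a k + \<bar>s\<bar> * b k"])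
    show "(\<Sum>\<^sub>\<infinity>k. \<bar>r\<bar> * a k + \<bar>s\<bar> * b k) \<le> \<bar>r\<bar> * M + \<bar>s\<bar> * M'"
      using a(2) b(2) by (simp add: infsum_add[OF s] infsum_cmult_right' add_mono mult_left_mono)
    show "continuous_on {0..} (\<lambda>t. r * u k t + s * v k t)" for k
      by (intro continuous_intros wiener_le_continuous[OF u] wiener_le_continuous[OF v])
    fix k and t :: real assume t: "t \<ge> 0"
    have "\<bar>r * u k t + s * v k t\<bar> \<le> \<bar>r\<bar> * \<bar>u k t\<bar> + \<bar>s\<bar> * \<bar>v k t\<bar>"
      by (metis abs_mult abs_triangle_ineq)
    also have "\<dots> \<le> \<bar>r\<bar> * (a k * exp (- (c * t))) + \<bar>s\<bar> * (b k * exp (- (c * t)))"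
      by (intro add_mono mult_left_mono a(3) b(3) t) auto
    finally show "\<bar>r * u k t + s * v k t\<bar> \<le> (\<bar>r\<bar> * a k + \<bar>s\<bar> * b k) * exp (- (c * t))"
      by (simp add: algebra_simps)
  qed (intro summable_on_add s)
qed

lemma wiener_le_add:
  "wiener_le c u M \<Longrightarrow> wiener_le c v M' \<Longrightarrow> wiener_le c (\<lambda>k t. u k t + v k t) (M + M')"
  using wiener_le_lincomb[of c u M v M' 1 1] by simp

lemma wiener_le_diff:
  "wiener_le c u M \<Longrightarrow> wiener_le c v M' \<Longrightarrow> wiener_le c (\<lambda>k t. u k t - v k t) (M + M')"
  using wiener_le_lincomb[of c u M v M' 1 "-1"] by simp

lemma wiener_le_0: "wiener_le c (\<lambda>k t. 0) 0"
  by (rule wiener_leI[where a = "\<lambda>k. 0"]) auto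

lemma wiener_le_multiplier:
  assumes u: "wiener_le c u M" and r: "\<And>k. \<bar>r k\<bar> \<le> 1"
  shows "wiener_le c (\<lambda>k t. r k * u k t) M"
proof -
  obtain a where a: "a summable_on UNIV" "infsum a UNIV \<le> M"
    "\<And>k t. t \<ge> 0 \<Longrightarrow> \<bar>u k t\<bar> \<le> a k * exp (- (c * t))"
    by (rule wiener_leE[OF u]) blast
  show ?thesis
  proof (rule wiener_leI[OF _ a(1,2)])
    show "continuous_on {0..} (\<lambda>t. r k * u k t)" for k
      by (intro continuous_intros wiener_le_continuous[OF u])
    fix k and t :: real assume t: "t \<ge> 0"
    have "\<bar>r k * u k t\<bar> \<le> 1 * \<bar>u k t\<bar>"
      unfolding abs_mult by (intro mult_right_mono r) auto
    with a(3)[OF t, of k] show "\<bar>r k * u k t\<bar> \<le> a k * exp (- (c * t))" by simp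
  qed
qed

text \<open>The majorant is the convolution of the two majorants, and its sum factorizes. That the
  rates add is essential: it gives the nonlinear term the rate 2C that the Duhamel estimate
  consumes.\<close>

lemma wiener_le_conv:
  assumes u: "wiener_le c u M" and v: "wiener_le d v M'"
  shows "wiener_le (c + d) (conv u v) (M * M')"
proof -
  obtain a where a: "a summable_on UNIV" "infsum a UNIV \<le> M" "\<And>k. a k \<ge> 0"
    "\<And>k t. t \<ge> 0 \<Longrightarrow> \<bar>u k t\<bar> \<le> a k * exp (- (c * t))"
    by (rule wiener_leE[OF u]) blast
  obtain b where b: "b summable_on UNIV" "infsum b UNIV \<le> M'" "\<And>k. b k \<ge> 0"
    "\<And>k t. t \<ge> 0 \<Longrightarrow> \<bar>v k t\<bar> \<le> b k * exp (- (d * t))"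
    by (rule wiener_leE[OF v]) blast
  have an: "(\<lambda>k. norm (a k)) summable_on UNIV" "(\<lambda>k. norm (b k)) summable_on UNIV"
    using a b by auto
  have eqn: "norm (a j * b (k - j)) = a j * b (k - j)" for j k
    using a(3) b(3) by (simp add: abs_mult)
  have ab: "(\<lambda>j. a j * b (k - j)) summable_on UNIV" for k
    using l1_conv_summable[OF an, of k] by (simp only: eqn)
  have bd: "\<bar>u j t * v (k - j) t\<bar> \<le> a j * b (k - j) * exp (- ((c + d) * t))" if "t \<ge> 0" for j k t
  proof -
    have "\<bar>u j t * v (k - j) t\<bar> \<le> (a j * exp (- (c * t))) * (b (k - j) * exp (- (d * t)))"
      unfolding abs_mult using a b that by (intro mult_mono) auto
    also have "\<dots> = a j * b (k - j) * exp (- ((c + d) * t))"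
      by (simp add: distrib_right exp_diff exp_minus field_simps)
    finally show ?thesis .
  qed
  show ?thesis
  proof (rule wiener_leI[where a = "\<lambda>k. \<Sum>\<^sub>\<infinity>j. a j * b (k - j)"])
    show "(\<Sum>\<^sub>\<infinity>k. \<Sum>\<^sub>\<infinity>j. a j * b (k - j)) \<le> M * M'"
      unfolding l1_conv_infsum[OF an] using a b wiener_le_nonneg[OF u]
      by (intro mult_mono infsum_nonneg) auto
    have "norm (\<Sum>\<^sub>\<infinity>j. a j * b (k - j)) = (\<Sum>\<^sub>\<infinity>j. a j * b (k - j))" for k
      using a(3) b(3) by (simp add: infsum_nonneg)
    then show "(\<lambda>k. \<Sum>\<^sub>\<infinity>j. a j * b (k - j)) summable_on UNIV"
      using l1_conv_abs[OF an] by simp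
    show "\<bar>conv u v k t\<bar> \<le> (\<Sum>\<^sub>\<infinity>j. a j * b (k - j)) * exp (- ((c + d) * t))" if t: "t \<ge> 0" for k t
    proof -
      have s: "(\<lambda>j. a j * b (k - j) * exp (- ((c + d) * t))) summable_on UNIV"
        by (intro summable_on_cmult_left ab)
      then have s': "(\<lambda>j. norm (u j t * v (k - j) t)) summable_on UNIV"
        by (rule abs_summable_of_bound) (use bd[OF t] in auto)
      have "\<bar>conv u v k t\<bar> \<le> (\<Sum>\<^sub>\<infinity>j. norm (u j t * v (k - j) t))"
        unfolding conv_def using norm_infsum_bound[OF s'] by simp
      also have "\<dots> \<le> (\<Sum>\<^sub>\<infinity>j. a j * b (k - j) * exp (- ((c + d) * t)))"
        by (rule infsum_mono[OF s' s]) (use bd[OF t] in auto)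
      finally show ?thesis by (simp add: infsum_cmult_left')
    qed
    fix k
    \<comment> \<open>The factor exp((c + d) t) removes the decay, so that
      \<open>a j * b (k - j)\<close> dominates uniformly in t whatever the signs of c and d; it is
      divided out again below.\<close>
    have cont: "continuous_on {0..} (\<lambda>t. \<Sum>\<^sub>\<infinity>j. exp ((c + d) * t) * (u j t * v (k - j) t))"
    proof (rule continuous_on_infsum[OF _ ab[of k]])
      show "norm (exp ((c + d) * t) * (u j t * v (k - j) t)) \<le> a j * b (k - j)" if "t \<in> {0..}" for j t
      proof -
        have "exp ((c + d) * t) * \<bar>u j t * v (k - j) t\<bar> \<le> exp ((c + d) * t) * (a j * b (k - j) * exp (- ((c + d) * t)))"
          using bd[of t] that by (intro mult_left_mono) auto
        also have "\<dots> = a j * b (k - j)"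
          by (simp add: exp_minus)
        finally show ?thesis by (simp add: abs_mult)
      qed
      show "continuous_on {0..} (\<lambda>t. exp ((c + d) * t) * (u j t * v (k - j) t))" for j
        by (intro continuous_intros wiener_le_continuous[OF u] wiener_le_continuous[OF v])
    qed
    have "continuous_on {0..} (\<lambda>t. exp (- ((c + d) * t)) * (\<Sum>\<^sub>\<infinity>j. exp ((c + d) * t) * (u j t * v (k - j) t)))"
      by (intro continuous_intros cont)
    moreover have "exp (- ((c + d) * t)) * (\<Sum>\<^sub>\<infinity>j. exp ((c + d) * t) * (u j t * v (k - j) t)) = conv u v k t" for t
      unfolding infsum_cmult_right' conv_def by (simp add: exp_minus)
    ultimately show "continuous_on {0..} (conv u v k)" by simp
  qed
qed

lemma conv_summable:
  assumes "wiener_le c u M" "wiener_le d v M'" "t \<ge> 0"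
  shows "(\<lambda>j. u j t * v (k - j) t) summable_on UNIV"
  by (rule abs_summable_summable[OF l1_conv_summable[of "\<lambda>j. u j t" "\<lambda>j. v j t" k]])
    (use wiener_le_summable(1)[OF assms(1,3)] wiener_le_summable(1)[OF assms(2,3)] in simp_all)

lemma infsum_diff:
  fixes f g :: "'a \<Rightarrow> 'b::banach"
  assumes "f summable_on A" "g summable_on A"
  shows "(\<Sum>\<^sub>\<infinity>x\<in>A. f x - g x) = infsum f A - infsum g A"
  using infsum_add[of f A "\<lambda>x. - g x"] assms by (simp add: infsum_uminus summable_on_uminus)

lemma conv_diff:
  assumes u: "wiener_le c u M" and v: "wiener_le d v M'"
    and u': "wiener_le c u' M" and v': "wiener_le d v' M'" and t: "t \<ge> 0"
  shows "conv u v k t - conv u' v' k t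
      = conv (\<lambda>k t. u k t - u' k t) v k t + conv u' (\<lambda>k t. v k t - v' k t) k t"
proof -
  note s = conv_summable[OF u v t] conv_summable[OF u' v' t] conv_summable[OF u' v t]
  have "conv (\<lambda>k t. u k t - u' k t) v k t = conv u v k t - conv u' v k t"
    unfolding conv_def using infsum_diff[OF s(1,3)[of k]] by (simp add: algebra_simps)
  moreover have "conv u' (\<lambda>k t. v k t - v' k t) k t = conv u' v k t - conv u' v' k t"
    unfolding conv_def using infsum_diff[OF s(3,2)[of k]] by (simp add: algebra_simps)
  ultimately show ?thesis by simp
qed

lemma wiener_le_conv_diff:
  assumes "wiener_le c u M" "wiener_le d v M'" "wiener_le c u' M" "wiener_le d v' M'"
    and "wiener_le c (\<lambda>k t. u k t - u' k t) D" "wiener_le d (\<lambda>k t. v k t - v' k t) D'"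
  shows "wiener_le (c + d) (\<lambda>k t. conv u v k t - conv u' v' k t) (D * M' + M * D')"
  by (rule wiener_le_cong[OF wiener_le_add[OF wiener_le_conv[OF assms(5,2)] wiener_le_conv[OF assms(3,6)]]])
    (simp add: conv_diff[OF assms(1-4)])

text \<open>Completeness of the norm. The majorant of the limit is the sum over n of majorants of
  the increments; exchanging the sums over n and k bounds its total by the geometric series of D /
  2^n, which is 2 D.\<close>

lemma wiener_le_telescope:
  assumes c: "c \<ge> 0" and d: "\<And>n::nat. wiener_le c (\<lambda>k t. u (Suc n) k t - u n k t) (D / 2 ^ n)"
    and u0: "\<And>k. continuous_on {0..} (u 0 k)"
    and U: "\<And>k t. t \<ge> 0 \<Longrightarrow> (\<lambda>n. u n k t) \<longlonglongrightarrow> U k t"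
  shows "wiener_le c (\<lambda>k t. U k t - u 0 k t) (2 * D)"
proof -
  have "\<forall>n. \<exists>a. a summable_on UNIV \<and> infsum a UNIV \<le> D / 2 ^ n \<and> (\<forall>k. a k \<ge> 0) \<and>
      (\<forall>k t. t \<ge> 0 \<longrightarrow> \<bar>u (Suc n) k t - u n k t\<bar> \<le> a k * exp (- (c * t)))"
    by (intro allI) (rule wiener_leE[OF d], blast)
  then obtain a where a: "\<And>n. a n summable_on UNIV" "\<And>n. infsum (a n) UNIV \<le> D / 2 ^ n" "\<And>n k. a n k \<ge> 0"
      "\<And>n k t. t \<ge> 0 \<Longrightarrow> \<bar>u (Suc n) k t - u n k t\<bar> \<le> a n k * exp (- (c * t))"
    by metis
  have g: "(\<lambda>n. D / 2 ^ n) sums (2 * D)"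
    using sums_mult[OF geometric_sums[of "1/2::real"], of D] by (simp add: power_divide mult.commute)
  have D: "D \<ge> 0" using wiener_le_nonneg[OF d[of 0]] by simp
  have gs: "(\<lambda>n. D / 2 ^ n) summable_on UNIV" "infsum (\<lambda>n. D / 2 ^ n) UNIV = 2 * D"
    using sums_nonneg_imp_has_sum[OF g] D by (auto simp: has_sum_iff)
  have isum: "(\<lambda>n. infsum (a n) UNIV) summable_on UNIV"
    by (rule summable_on_comparison_test[OF gs(1)]) (use a in \<open>auto intro: infsum_nonneg\<close>)
  have sm: "(\<lambda>(n, k). a n k) summable_on UNIV \<times> UNIV"
    by (rule summable_on_SigmaI[where g = "\<lambda>n. infsum (a n) UNIV"]) (use a isum in auto)
  have sm': "(\<lambda>(k, n). a n k) summable_on UNIV \<times> UNIV"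
    by (subst summable_on_swap) (use sm in \<open>simp add: case_prod_unfold\<close>)
  define A where "A k = (\<Sum>\<^sub>\<infinity>n. a n k)" for k
  have A: "A summable_on UNIV"
    unfolding A_def by (rule summable_on_Sigma_banach[OF sm'])
  have ak: "(\<lambda>n. a n k) summable_on UNIV" for k
    using summable_on_SigmaD1[of "\<lambda>k n. a n k" UNIV "\<lambda>_. UNIV" k] sm' a(3) by auto
  have "infsum A UNIV = (\<Sum>\<^sub>\<infinity>n. infsum (a n) UNIV)"
    unfolding A_def by (rule infsum_swap_banach[OF sm'])
  also have "\<dots> \<le> 2 * D"
    using infsum_mono[OF isum gs(1)] a(2) gs(2) by auto
  finally have A2: "infsum A UNIV \<le> 2 * D" .
  have fin: "\<bar>u n k t - u 0 k t\<bar> \<le> (\<Sum>i<n. a i k) * exp (- (c * t))" if "t \<ge> 0" for n k t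
  proof -
    have "u n k t - u 0 k t = (\<Sum>i<n. u (Suc i) k t - u i k t)"
      by (simp add: sum_lessThan_telescope[of "\<lambda>n. u n k t" for t])
    also have "\<bar>\<dots>\<bar> \<le> (\<Sum>i<n. \<bar>u (Suc i) k t - u i k t\<bar>)" by (rule sum_abs)
    also have "\<dots> \<le> (\<Sum>i<n. a i k * exp (- (c * t)))" by (intro sum_mono a(4) that)
    finally show ?thesis by (simp add: sum_distrib_right)
  qed
  have fA: "(\<Sum>i\<in>X. a i k) \<le> A k" if "finite X" for X k
    unfolding A_def using finite_sum_le_infsum[OF ak that] a(3) by auto
  have sums: "(\<lambda>i. a i k) sums A k" for k
    unfolding A_def using ak[of k] by (simp add: has_sum_imp_sums)
  \<comment> \<open>As c >= 0, each increment is at most \<open>a i k\<close> uniformly in t, so the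
    M-test gives uniform convergence and hence continuity of the limit.\<close>
  have ul: "uniform_limit {0..} (\<lambda>n t. u n k t) (U k) sequentially" for k
  proof -
    have "uniform_limit {0..} (\<lambda>n t. \<Sum>i<n. u (Suc i) k t - u i k t) (\<lambda>t. \<Sum>i. u (Suc i) k t - u i k t) sequentially"
    proof (rule Weierstrass_m_test)
      show "summable (\<lambda>i. a i k)" using sums by (rule sums_summable)
      show "norm (u (Suc i) k t - u i k t) \<le> a i k" if "t \<in> {0..}" for i t
      proof -
        have "a i k * exp (- (c * t)) \<le> a i k * 1"
          using a(3) c that by (intro mult_left_mono) auto
        with a(4)[of t i k] that show ?thesis by auto
      qed
    qed
    then have ul1: "uniform_limit {0..} (\<lambda>n t. u n k t - u 0 k t) (\<lambda>t. \<Sum>i. u (Suc i) k t - u i k t) sequentially"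
      by (simp add: sum_lessThan_telescope[of "\<lambda>n. u n k t" for t])
    have "(\<Sum>i. u (Suc i) k t - u i k t) = U k t - u 0 k t" if "t \<in> {0..}" for t
    proof (rule LIMSEQ_unique)
      show "(\<lambda>n. u n k t - u 0 k t) \<longlonglongrightarrow> (\<Sum>i. u (Suc i) k t - u i k t)"
        by (rule tendsto_uniform_limitI[OF ul1 that])
      show "(\<lambda>n. u n k t - u 0 k t) \<longlonglongrightarrow> U k t - u 0 k t"
        using that by (intro tendsto_intros U) auto
    qed
    with ul1 have "uniform_limit {0..} (\<lambda>n t. u n k t - u 0 k t) (\<lambda>t. U k t - u 0 k t) sequentially"
      by (subst (asm) uniform_limit_cong') auto
    from uniform_limit_add[OF this uniform_limit_const[where c = "u 0 k"]]
    show ?thesis by simp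
  qed
  have un: "continuous_on {0..} (u n k)" for n k
  proof (induction n)
    case (Suc n)
    have "continuous_on {0..} (\<lambda>t. (u (Suc n) k t - u n k t) + u n k t)"
      by (intro continuous_on_add Suc wiener_le_continuous[OF d])
    then show ?case by (simp cong: continuous_on_cong)
  qed (rule u0)
  show ?thesis
  proof (rule wiener_leI[OF _ A A2])
    show "continuous_on {0..} (\<lambda>t. U k t - u 0 k t)" for k
      by (intro continuous_intros u0 uniform_limit_theorem[OF _ ul]) (auto simp: un)
    fix k and t :: real assume t: "t \<ge> 0"
    have "(\<lambda>n. \<bar>u n k t - u 0 k t\<bar>) \<longlonglongrightarrow> \<bar>U k t - u 0 k t\<bar>"
      by (intro tendsto_intros U t)
    then show "\<bar>U k t - u 0 k t\<bar> \<le> A k * exp (- (c * t))"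
    proof (rule LIMSEQ_le_const2, intro exI allI impI)
      fix n
      show "\<bar>u n k t - u 0 k t\<bar> \<le> A k * exp (- (c * t))"
        by (rule order_trans[OF fin[OF t] mult_right_mono[OF fA]]) auto
    qed
  qed
qed

lemma wiener_le_Cauchy_limit:
  assumes c: "c \<ge> 0" and d: "\<And>n::nat. wiener_le c (\<lambda>k t. u (Suc n) k t - u n k t) (D / 2 ^ n)"
    and u: "\<And>n k. continuous_on {0..} (u n k)"
  obtains U where "\<And>n. wiener_le c (\<lambda>k t. U k t - u n k t) (2 * D / 2 ^ n)"
    "\<And>k t. t \<ge> 0 \<Longrightarrow> (\<lambda>n. u n k t) \<longlonglongrightarrow> U k t"
proof -
  have "convergent (\<lambda>n. u n k t)" if t: "t \<ge> 0" for k t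
  proof -
    have "summable (\<lambda>n. u (Suc n) k t - u n k t)"
    proof (rule summable_comparison_test)
      show "summable (\<lambda>n. D * (1 / 2) ^ n)"
        by (intro summable_mult summable_geometric) auto
      have "\<bar>u (Suc n) k t - u n k t\<bar> \<le> D * (1 / 2) ^ n" for n
      proof -
        have "\<bar>u (Suc n) k t - u n k t\<bar> \<le> D / 2 ^ n * exp (- (c * t))"
          using wiener_le_bound[OF d t] .
        also have "\<dots> \<le> D / 2 ^ n * 1"
          using c t wiener_le_nonneg[OF d[of n]] by (intro mult_left_mono) auto
        finally show ?thesis by (simp add: power_divide)
      qed
      then show "\<exists>N. \<forall>n\<ge>N. norm (u (Suc n) k t - u n k t) \<le> D * (1 / 2) ^ n" by auto
    qed
    then have "convergent (\<lambda>n. u n k t - u 0 k t)"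
      by (simp add: summable_iff_convergent sum_lessThan_telescope[of "\<lambda>n. u n k t"])
    then have "convergent (\<lambda>n. u n k t - u 0 k t + u 0 k t)"
      by (intro convergent_add convergent_const)
    then show ?thesis by simp
  qed
  then have lim: "(\<lambda>n. u n k t) \<longlonglongrightarrow> lim (\<lambda>n. u n k t)" if "t \<ge> 0" for k t
    using that by (simp add: convergent_LIMSEQ_iff)
  have "wiener_le c (\<lambda>k t. lim (\<lambda>n. u n k t) - u n k t) (2 * D / 2 ^ n)" for n
  proof -
    \<comment> \<open>Starting the sequence at n replaces D by D / 2^n, so the estimate against the
      first term becomes a geometric rate of convergence.\<close>
    have "wiener_le c (\<lambda>k t. lim (\<lambda>n. u n k t) - u (0 + n) k t) (2 * (D / 2 ^ n))"
    proof (rule wiener_le_telescope[where u = "\<lambda>m. u (m + n)", OF c _ u])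
      show "wiener_le c (\<lambda>k t. u (Suc m + n) k t - u (m + n) k t) (D / 2 ^ n / 2 ^ m)" for m
        using d[of "m + n"] by (simp add: power_add mult.commute)
      show "(\<lambda>m. u (m + n) k t) \<longlonglongrightarrow> lim (\<lambda>n. u n k t)" if "t \<ge> 0" for k t
        by (rule LIMSEQ_ignore_initial_segment[OF lim[OF that]])
    qed
    then show ?thesis by simp
  qed
  then show ?thesis by (rule that[OF _ lim])
qed

section \<open>The Duhamel operator and the fixed point\<close>

lemma integral_has_real_derivative_atLeast:
  fixes g :: "real \<Rightarrow> real"
  assumes "continuous_on {0..} g" "t \<ge> 0"
  shows "((\<lambda>x. integral {0..x} g) has_real_derivative g t) (at t within {0..})"
proof -
  have "((\<lambda>x. integral {0..x} g) has_real_derivative g t) (at t within {0..t + 1})"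
    using assms by (intro integral_has_real_derivative continuous_on_subset[OF assms(1)]) auto
  moreover have "at t within {0..t + 1} = at t within {0..}"
    by (rule at_within_nhd[of t "{..<t + 1}"]) auto
  ultimately show ?thesis by simp
qed

text \<open>This is |k| times the integral of exp(-C |k| (t - s)) N_k(s) over s, that is, Lambda
  applied to the solution of the forced linear equation. The factor depending on t stands outside so
  that the fundamental theorem of calculus applies to the integral directly.\<close>

definition duhamel :: "real \<Rightarrow> (int \<Rightarrow> real \<Rightarrow> real) \<Rightarrow> int \<Rightarrow> real \<Rightarrow> real" where
  "duhamel C N k t = real_of_int \<bar>k\<bar> * exp (- (C * real_of_int \<bar>k\<bar> * t)) *
     integral {0..t} (\<lambda>s. exp (C * real_of_int \<bar>k\<bar> * s) * N k s)"

text \<open>Here n = |k|, and the exponent n - 2 combines the growth e^(Cns) with the decay e^(-2Cs)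
  of the source. For n >= 2 it is raised to n - 1, which is positive also at n = 2, and n / (n - 1)
  <= 2 produces the constant. For n = 1 the integrand decays and its integral is at most 1 /
  C.\<close>

lemma integral_exp_le:
  fixes C n t :: real
  assumes C: "C > 0" and n: "n = 1 \<or> n \<ge> 2" and t: "t \<ge> 0"
  shows "integral {0..t} (\<lambda>s. exp ((n - 2) * C * s)) \<le> 2 / (C * n) * exp ((n - 1) * C * t)"
  using n
proof
  assume n: "n = 1"
  have "((\<lambda>s. exp (- (C * s))) has_integral (- (exp (- (C * t)) / C) - - (exp (- (C * 0)) / C))) {0..t}"
    using C t by (intro fundamental_theorem_of_calculus[where f = "\<lambda>s. - (exp (- (C * s)) / C)"])
      (auto intro!: derivative_eq_intros simp flip: has_real_derivative_iff_has_vector_derivative)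
  then have "integral {0..t} (\<lambda>s. exp (- (C * s))) = (1 - exp (- (C * t))) / C"
    by (simp add: integral_unique diff_divide_distrib)
  also have "\<dots> \<le> 2 / C"
    using C by (intro divide_right_mono) (auto simp: algebra_simps intro: order_trans[of _ 0])
  finally show ?thesis using n by simp
next
  assume n: "n \<ge> 2"
  have "((\<lambda>s. exp ((n - 1) * C * s)) has_integral
      (exp ((n - 1) * C * t) / ((n - 1) * C) - exp ((n - 1) * C * 0) / ((n - 1) * C))) {0..t}"
    using C t n by (intro fundamental_theorem_of_calculus[where f = "\<lambda>s. exp ((n - 1) * C * s) / ((n - 1) * C)"])
      (auto intro!: derivative_eq_intros simp flip: has_real_derivative_iff_has_vector_derivative)
  then have i: "integral {0..t} (\<lambda>s. exp ((n - 1) * C * s)) = (exp ((n - 1) * C * t) - 1) / ((n - 1) * C)"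
    by (simp add: integral_unique diff_divide_distrib)
  have "integral {0..t} (\<lambda>s. exp ((n - 2) * C * s)) \<le> integral {0..t} (\<lambda>s. exp ((n - 1) * C * s))"
    using C n by (intro integral_le integrable_continuous_interval continuous_intros) (auto intro!: mult_right_mono)
  also have "\<dots> \<le> exp ((n - 1) * C * t) / ((n - 1) * C)"
    unfolding i using C n by (intro divide_right_mono) auto
  also have "\<dots> = 1 / ((n - 1) * C) * exp ((n - 1) * C * t)" by simp
  also have "\<dots> \<le> 2 / (C * n) * exp ((n - 1) * C * t)"
  proof (intro mult_right_mono)
    define a where "a = (n - 1) * C"
    have a: "a > 0" "C * n \<le> 2 * a"
      using C mult_right_mono[OF n, of C] n unfolding a_def by (auto simp: algebra_simps)
    have "1 / a = 2 / (2 * a)" by simp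
    also have "\<dots> \<le> 2 / (C * n)" using a C n by (intro divide_left_mono) auto
    finally show "1 / ((n - 1) * C) \<le> 2 / (C * n)" unfolding a_def .
  qed auto
  finally show ?thesis .
qed

text \<open>The gain of a full derivative: the 1/n of \<open>integral_exp_le\<close> cancels the
  factor |k| in \<open>duhamel\<close>, so the constant 2 / C is the same for all modes. The rate
  drops from 2C to C, the rate of the slowest modes k = 1 and k = -1.\<close>

lemma duhamel_bound:
  assumes C: "C > 0" and N: "continuous_on {0..} (N k)" "\<And>s. s \<ge> 0 \<Longrightarrow> \<bar>N k s\<bar> \<le> b * exp (- (2 * C * s))"
    and t: "t \<ge> 0"
  shows "\<bar>duhamel C N k t\<bar> \<le> 2 / C * b * exp (- (C * t))"
proof (cases "k = 0")
  case True
  have "b \<ge> 0" using N(2)[of 0] by simp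
  with True C show ?thesis by (simp add: duhamel_def)
next
  case False
  define n where "n = real_of_int \<bar>k\<bar>"
  have n: "n = 1 \<or> n \<ge> 2" "n > 0" using False unfolding n_def by (cases "\<bar>k\<bar> = 1"; force)+
  have b: "b \<ge> 0" using N(2)[of 0] by simp
  have c: "continuous_on {0..t} (N k)" by (rule continuous_on_subset[OF N(1)]) auto
  have "\<bar>integral {0..t} (\<lambda>s. exp (C * n * s) * N k s)\<bar> \<le> integral {0..t} (\<lambda>s. b * exp ((n - 2) * C * s))"
    unfolding real_norm_def[symmetric]
  proof (rule integral_norm_bound_integral)
    fix s assume s: "s \<in> {0..t}"
    have "norm (exp (C * n * s) * N k s) \<le> exp (C * n * s) * (b * exp (- (2 * C * s)))"
      using s N(2)[of s] by (simp add: abs_mult)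
    also have "\<dots> = b * (exp (C * n * s) * exp (- (2 * C * s)))" by simp
    also have "\<dots> = b * exp ((n - 2) * C * s)"
      unfolding exp_add[symmetric] by (simp add: algebra_simps)
    finally show "norm (exp (C * n * s) * N k s) \<le> b * exp ((n - 2) * C * s)" .
  qed (intro integrable_continuous_interval continuous_intros c)+
  also have "\<dots> \<le> b * (2 / (C * n) * exp ((n - 1) * C * t))"
    unfolding integral_mult_right by (rule mult_left_mono[OF integral_exp_le[OF C n(1) t] b])
  finally have i: "\<bar>integral {0..t} (\<lambda>s. exp (C * n * s) * N k s)\<bar> \<le> b * (2 / (C * n) * exp ((n - 1) * C * t))" .
  have "\<bar>duhamel C N k t\<bar> = n * exp (- (C * n * t)) * \<bar>integral {0..t} (\<lambda>s. exp (C * n * s) * N k s)\<bar>"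
    unfolding duhamel_def n_def by (simp add: abs_mult)
  also have "\<dots> \<le> n * exp (- (C * n * t)) * (b * (2 / (C * n) * exp ((n - 1) * C * t)))"
    using n by (intro mult_left_mono i) auto
  also have "\<dots> = 2 / C * b * (exp (- (C * n * t)) * exp ((n - 1) * C * t))"
    using n C by simp
  also have "\<dots> = 2 / C * b * exp (- (C * t))"
    unfolding exp_add[symmetric] by (simp add: algebra_simps)
  finally show ?thesis .
qed

lemma duhamel_continuous:
  assumes "continuous_on {0..} (N k)"
  shows "continuous_on {0..} (duhamel C N k)"
proof -
  have "continuous_on {0..} (\<lambda>t. integral {0..t} (\<lambda>s. exp (C * real_of_int \<bar>k\<bar> * s) * N k s))"
    by (rule DERIV_continuous_on, rule integral_has_real_derivative_atLeast)
      (auto intro!: continuous_intros assms)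
  then show ?thesis
    unfolding duhamel_def[abs_def] by (intro continuous_intros)
qed

lemma wiener_le_duhamel:
  assumes C: "C > 0" and N: "wiener_le (2 * C) N M"
  shows "wiener_le C (duhamel C N) (2 / C * M)"
proof -
  obtain a where a: "a summable_on UNIV" "infsum a UNIV \<le> M"
    "\<And>k t. t \<ge> 0 \<Longrightarrow> \<bar>N k t\<bar> \<le> a k * exp (- (2 * C * t))"
    by (rule wiener_leE[OF N]) blast
  show ?thesis
  proof (rule wiener_leI[where a = "\<lambda>k. 2 / C * a k"])
    show "(\<lambda>k. 2 / C * a k) summable_on UNIV" by (intro summable_on_cmult_right a)
    show "(\<Sum>\<^sub>\<infinity>k. 2 / C * a k) \<le> 2 / C * M"
      unfolding infsum_cmult_right' using C a(2) by (intro mult_left_mono) auto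
    show "continuous_on {0..} (duhamel C N k)" for k
      by (rule duhamel_continuous[where N = N, OF wiener_le_continuous[OF N]])
    show "\<bar>duhamel C N k t\<bar> \<le> 2 / C * a k * exp (- (C * t))" if "t \<ge> 0" for k t
      by (rule duhamel_bound[OF C wiener_le_continuous[OF N] a(3) that])
  qed
qed

lemma duhamel_diff:
  assumes "continuous_on {0..} (N k)" "continuous_on {0..} (N' k)" "t \<ge> 0"
  shows "duhamel C N k t - duhamel C N' k t = duhamel C (\<lambda>k t. N k t - N' k t) k t"
proof -
  have "continuous_on {0..t} (N k)" "continuous_on {0..t} (N' k)"
    by (rule continuous_on_subset[OF assms(1)] continuous_on_subset[OF assms(2)]; simp)+
  then have "integral {0..t} (\<lambda>s. exp (C * real_of_int \<bar>k\<bar> * s) * N k s - exp (C * real_of_int \<bar>k\<bar> * s) * N' k s)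
    = integral {0..t} (\<lambda>s. exp (C * real_of_int \<bar>k\<bar> * s) * N k s) - integral {0..t} (\<lambda>s. exp (C * real_of_int \<bar>k\<bar> * s) * N' k s)"
    by (intro integral_diff integrable_continuous_interval continuous_intros)
  then show ?thesis
    unfolding duhamel_def by (simp add: right_diff_distrib)
qed

text \<open>
  The odd unknown is expanded as \<open>f = \<Sum>\<^sub>k \<phi>\<^sub>k sin (k x)\<close> over all integers \<open>k\<close>, so its Fourier coefficients are
  \<open>-i \<phi>\<^sub>k\<close> with \<open>\<phi>\<close> real and odd. With \<open>u\<^sub>k = |k| \<phi>\<^sub>k\<close> for \<open>\<Lambda>f\<close>, the array \<open>inv_Lambda u\<close> is \<open>\<phi>\<close> (the value at
  \<open>k = 0\<close> is \<open>0\<close>, since \<open>inverse 0 = 0\<close>) and \<open>hilbert u\<close> consists of the cosine coefficients of \<open>f\<^sub>x\<close>.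
\<close>

definition hilbert :: "(int \<Rightarrow> real \<Rightarrow> real) \<Rightarrow> int \<Rightarrow> real \<Rightarrow> real" where
  "hilbert u k t = real_of_int (sgn k) * u k t"

definition inv_Lambda :: "(int \<Rightarrow> real \<Rightarrow> real) \<Rightarrow> int \<Rightarrow> real \<Rightarrow> real" where
  "inv_Lambda u k t = inverse (real_of_int \<bar>k\<bar>) * u k t"

lemma wiener_le_hilbert: "wiener_le c u M \<Longrightarrow> wiener_le c (hilbert u) M"
  unfolding hilbert_def[abs_def] by (rule wiener_le_multiplier) (auto simp: sgn_if)

lemma wiener_le_inv_Lambda: "wiener_le c u M \<Longrightarrow> wiener_le c (inv_Lambda u) M"
  unfolding inv_Lambda_def[abs_def]
proof (rule wiener_le_multiplier)
  fix k :: int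
  show "\<bar>inverse (real_of_int \<bar>k\<bar>)\<bar> \<le> 1"
  proof (cases "k = 0")
    case False
    then have "1 \<le> real_of_int \<bar>k\<bar>" by linarith
    then show ?thesis by (simp add: inverse_le_1_iff)
  qed simp
qed

lemma wiener_le_hilbert_diff:
  "wiener_le c (\<lambda>k t. u k t - v k t) D \<Longrightarrow> wiener_le c (\<lambda>k t. hilbert u k t - hilbert v k t) D"
  using wiener_le_hilbert[of c "\<lambda>k t. u k t - v k t" D] by (simp add: hilbert_def[abs_def] right_diff_distrib)

lemma wiener_le_inv_Lambda_diff:
  "wiener_le c (\<lambda>k t. u k t - v k t) D \<Longrightarrow> wiener_le c (\<lambda>k t. inv_Lambda u k t - inv_Lambda v k t) D"
  using wiener_le_inv_Lambda[of c "\<lambda>k t. u k t - v k t" D] by (simp add: inv_Lambda_def[abs_def] right_diff_distrib)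

text \<open>The factors r and s are the parities, 1 or -1, so this is the rule for the parity of a
  product of sine and cosine series.\<close>

lemma conv_uminus:
  assumes "\<And>j. u (- j) t = r * u j t" "\<And>j. v (- j) t = s * v j t"
  shows "conv u v (- k) t = r * s * conv u v k t"
proof -
  have "conv u v (- k) t = (\<Sum>\<^sub>\<infinity>j. u (- j) t * v (- (k - j)) t)"
    unfolding conv_def
    using infsum_reindex_bij_betw[of uminus UNIV UNIV "\<lambda>j. u j t * v (- k - j) t"]
    by (simp add: bij_uminus)
  also have "\<dots> = (\<Sum>\<^sub>\<infinity>j. r * s * (u j t * v (k - j) t))"
    unfolding assms by (intro infsum_cong) (simp add: mult_ac)
  finally show ?thesis unfolding conv_def infsum_cmult_right' .
qed

text \<open>The coefficients of Lambda e^(-C t Lambda) applied to the initial datum.\<close>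

definition lin_part :: "real \<Rightarrow> (int \<Rightarrow> real) \<Rightarrow> int \<Rightarrow> real \<Rightarrow> real" where
  "lin_part C \<phi> k t = real_of_int \<bar>k\<bar> * exp (- (C * real_of_int \<bar>k\<bar> * t)) * \<phi> k"

text \<open>The sign in \<open>mapQ\<close> comes from \<open>(-i)\<^sup>2\<close> in the coefficients of \<open>f\<^sup>2\<close>.\<close>

definition mapU where
  "mapU C \<phi> u p q k t = lin_part C \<phi> k t + duhamel C (conv (\<lambda>k t. p k t + q k t) u) k t"

definition mapP where
  "mapP u p k t = conv (hilbert u) (hilbert u) k t - conv (conv (hilbert u) (hilbert u)) p k t"

definition mapQ where
  "mapQ m u q k t = - (1 / m\<^sup>2) * conv (inv_Lambda u) (inv_Lambda u) k t + - (1 / m) * conv (conv (inv_Lambda u) (inv_Lambda u)) q k t"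

text \<open>The constant 16 comes from \<open>mapU\<close>: p + q has size 2R and its increment size
  2D, so the product changes by 4RD, and the Duhamel factor 2/C makes this 8RD/C <= D/2. The
  quadratic and cubic terms of \<open>mapP\<close> and \<open>mapQ\<close> change by at most 2RD +
  3R^2 D, which R <= 1/16 keeps below D/2. The linear part cancels in the difference.\<close>

lemma map_lipschitz:
  assumes C: "C > 0" "C \<le> 1" and m: "m \<ge> 1" and R: "R \<le> C / 16"
    and u: "wiener_le C u R" "wiener_le C u' R" "wiener_le C (\<lambda>k t. u k t - u' k t) D"
    and p: "wiener_le C p R" "wiener_le C p' R" "wiener_le C (\<lambda>k t. p k t - p' k t) D"
    and q: "wiener_le C q R" "wiener_le C q' R" "wiener_le C (\<lambda>k t. q k t - q' k t) D"
  shows "wiener_le C (\<lambda>k t. mapU C \<phi> u p q k t - mapU C \<phi> u' p' q' k t) (D / 2)"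
    and "wiener_le C (\<lambda>k t. mapP u p k t - mapP u' p' k t) (D / 2)"
    and "wiener_le C (\<lambda>k t. mapQ m u q k t - mapQ m u' q' k t) (D / 2)"
proof -
  have D: "D \<ge> 0" using wiener_le_nonneg[OF u(3)] .
  have R0: "R \<ge> 0" using wiener_le_nonneg[OF u(1)] .
  have R1: "R \<le> 1 / 16" using R C by simp
  have RR: "R * R \<le> R * (1 / 16)" using R0 R1 by (intro mult_left_mono) auto
  have main: "2 * R * D + 3 * (R * R) * D \<le> D / 2"
  proof -
    have "2 * R + 3 * (R * R) \<le> 1 / 2" using RR R1 by linarith
    from mult_right_mono[OF this D] show ?thesis by (simp add: algebra_simps)
  qed
  let ?s = "\<lambda>k t. p k t + q k t" and ?s' = "\<lambda>k t. p' k t + q' k t"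
  note s = wiener_le_add[OF p(1) q(1)] and s' = wiener_le_add[OF p(2) q(2)]
  have sd: "wiener_le C (\<lambda>k t. ?s k t - ?s' k t) (D + D)"
    by (rule wiener_le_cong[OF wiener_le_add[OF p(3) q(3)]]) simp
  have N: "wiener_le (2 * C) (\<lambda>k t. conv ?s u k t - conv ?s' u' k t) (4 * (R * D))"
    using wiener_le_conv_diff[OF s u(1) s' u(2) sd u(3)] by (simp add: algebra_simps)
  have "wiener_le C (\<lambda>k t. mapU C \<phi> u p q k t - mapU C \<phi> u' p' q' k t) (2 / C * (4 * (R * D)))"
  proof (rule wiener_le_cong[OF wiener_le_duhamel[OF C(1) N]])
    fix k and t :: real assume t: "t \<ge> 0"
    show "duhamel C (\<lambda>k t. conv ?s u k t - conv ?s' u' k t) k t = mapU C \<phi> u p q k t - mapU C \<phi> u' p' q' k t"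
      unfolding mapU_def
      using duhamel_diff[of "conv ?s u" k "conv ?s' u'" t C] t
        wiener_le_continuous[OF wiener_le_conv[OF s u(1)]] wiener_le_continuous[OF wiener_le_conv[OF s' u(2)]]
      by simp
  qed
  moreover have "2 / C * (4 * (R * D)) \<le> D / 2"
  proof -
    have "8 * R / C \<le> 1 / 2" using R C by (simp add: field_simps)
    from mult_right_mono[OF this D] show ?thesis by (simp add: algebra_simps)
  qed
  ultimately show "wiener_le C (\<lambda>k t. mapU C \<phi> u p q k t - mapU C \<phi> u' p' q' k t) (D / 2)"
    by (rule wiener_le_mono[OF _ order_refl])
  \<comment> \<open>Stated for general h because both \<open>hilbert u\<close> and
    \<open>inv_Lambda u\<close> are images of u under multipliers bounded by 1. The rates 2C and 3C
    of the products are weakened to C.\<close>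
  have quad: "wiener_le C (\<lambda>k t. conv h h k t - conv h' h' k t) (2 * R * D)"
      "wiener_le C (\<lambda>k t. conv (conv h h) w k t - conv (conv h' h') w' k t) (3 * (R * R) * D)"
    if h: "wiener_le C h R" "wiener_le C h' R" "wiener_le C (\<lambda>k t. h k t - h' k t) D"
      and w: "wiener_le C w R" "wiener_le C w' R" "wiener_le C (\<lambda>k t. w k t - w' k t) D" for h h' w w'
  proof -
    note hh = wiener_le_conv_diff[OF h(1) h(1) h(2) h(2) h(3) h(3)]
    show "wiener_le C (\<lambda>k t. conv h h k t - conv h' h' k t) (2 * R * D)"
      by (rule wiener_le_mono[OF hh]) (use C in \<open>auto simp: algebra_simps\<close>)
    show "wiener_le C (\<lambda>k t. conv (conv h h) w k t - conv (conv h' h') w' k t) (3 * (R * R) * D)"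
      by (rule wiener_le_mono[OF wiener_le_conv_diff[OF wiener_le_conv[OF h(1) h(1)] w(1)
          wiener_le_conv[OF h(2) h(2)] w(2) hh w(3)]]) (use C in \<open>auto simp: algebra_simps\<close>)
  qed
  have P: "wiener_le C (\<lambda>k t. mapP u p k t - mapP u' p' k t) (2 * R * D + 3 * (R * R) * D)"
    by (rule wiener_le_cong[OF wiener_le_diff[OF quad[OF wiener_le_hilbert[OF u(1)] wiener_le_hilbert[OF u(2)]
        wiener_le_hilbert_diff[OF u(3)] p]]]) (simp add: mapP_def)
  show "wiener_le C (\<lambda>k t. mapP u p k t - mapP u' p' k t) (D / 2)"
    by (rule wiener_le_mono[OF P]) (use main in auto)
  have Q: "wiener_le C (\<lambda>k t. mapQ m u q k t - mapQ m u' q' k t)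
      (\<bar>- (1 / m\<^sup>2)\<bar> * (2 * R * D) + \<bar>- (1 / m)\<bar> * (3 * (R * R) * D))"
    by (rule wiener_le_cong[OF wiener_le_lincomb[OF quad[OF wiener_le_inv_Lambda[OF u(1)] wiener_le_inv_Lambda[OF u(2)]
        wiener_le_inv_Lambda_diff[OF u(3)] q]]]) (simp add: mapQ_def algebra_simps diff_divide_distrib)
  have "\<bar>- (1 / m\<^sup>2)\<bar> * (2 * R * D) \<le> 1 * (2 * R * D)" "\<bar>- (1 / m)\<bar> * (3 * (R * R) * D) \<le> 1 * (3 * (R * R) * D)"
    using m R0 D by (intro mult_right_mono; simp add: one_le_power)+
  then have "\<bar>- (1 / m\<^sup>2)\<bar> * (2 * R * D) + \<bar>- (1 / m)\<bar> * (3 * (R * R) * D) \<le> D / 2"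
    using main by linarith
  then show "wiener_le C (\<lambda>k t. mapQ m u q k t - mapQ m u' q' k t) (D / 2)"
    by (rule wiener_le_mono[OF Q order_refl])
qed

primrec picard :: "real \<Rightarrow> real \<Rightarrow> (int \<Rightarrow> real) \<Rightarrow> nat \<Rightarrow>
    (int \<Rightarrow> real \<Rightarrow> real) \<times> (int \<Rightarrow> real \<Rightarrow> real) \<times> (int \<Rightarrow> real \<Rightarrow> real)" where
  "picard C m \<phi> 0 = ((\<lambda>k t. 0), (\<lambda>k t. 0), (\<lambda>k t. 0))"
| "picard C m \<phi> (Suc n) = (case picard C m \<phi> n of (u, p, q) \<Rightarrow> (mapU C \<phi> u p q, mapP u p, mapQ m u q))"

lemma conv_0: "conv (\<lambda>k t. 0) v k t = 0" "conv u (\<lambda>k t. 0) k t = 0"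
  by (simp_all add: conv_def)

text \<open>Invariance of the ball needs no separate estimate. The iteration starts at 0, its first
  increment is the linear part of size at most R/2, and the increments halve; the n-th iterate
  therefore has size at most R (1 - 1/2^n), which is carried through the induction together with the
  increments.\<close>

lemma wiener_fixed_point:
  assumes C: "C > 0" "C \<le> 1" and m: "m \<ge> 1" and R: "R \<le> C / 16"
    and e: "wiener_le C (lin_part C \<phi>) (R / 2)" and odd: "\<And>k. \<phi> (- k) = - \<phi> k"
  obtains u p q where
    "wiener_le C u R" "wiener_le C p R" "wiener_le C q R"
    "\<And>k t. t \<ge> 0 \<Longrightarrow> u k t = mapU C \<phi> u p q k t"
    "\<And>k t. t \<ge> 0 \<Longrightarrow> p k t = mapP u p k t"
    "\<And>k t. t \<ge> 0 \<Longrightarrow> q k t = mapQ m u q k t"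
    "\<And>k t. t \<ge> 0 \<Longrightarrow> u (- k) t = - u k t"
    "\<And>k t. t \<ge> 0 \<Longrightarrow> p (- k) t = p k t"
    "\<And>k t. t \<ge> 0 \<Longrightarrow> q (- k) t = q k t"
proof -
  define u where "u n = fst (picard C m \<phi> n)" for n
  define p where "p n = fst (snd (picard C m \<phi> n))" for n
  define q where "q n = snd (snd (picard C m \<phi> n))" for n
  have z0: "u 0 = (\<lambda>k t. 0)" "p 0 = (\<lambda>k t. 0)" "q 0 = (\<lambda>k t. 0)"
    by (simp_all add: u_def p_def q_def)
  have zS: "u (Suc n) = mapU C \<phi> (u n) (p n) (q n)" "p (Suc n) = mapP (u n) (p n)"
      "q (Suc n) = mapQ m (u n) (q n)" for n
    by (simp_all add: u_def p_def q_def split_beta)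
  have R0: "R \<ge> 0" using wiener_le_nonneg[OF e] by simp
  have z1: "u (Suc 0) = lin_part C \<phi>" "p (Suc 0) = (\<lambda>k t. 0)" "q (Suc 0) = (\<lambda>k t. 0)"
  proof -
    have "hilbert (\<lambda>k t. 0) = (\<lambda>k t. 0)" "inv_Lambda (\<lambda>k t. 0) = (\<lambda>k t. 0)"
      by (simp_all add: hilbert_def inv_Lambda_def fun_eq_iff)
    then show "u (Suc 0) = lin_part C \<phi>" "p (Suc 0) = (\<lambda>k t. 0)" "q (Suc 0) = (\<lambda>k t. 0)"
      unfolding zS z0 by (simp_all add: mapU_def[abs_def] mapP_def[abs_def] mapQ_def[abs_def] duhamel_def conv_0)
  qed
  have ball: "wiener_le C w R" if "wiener_le C w (R * (1 - 1 / 2 ^ n))" for w and n :: nat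
    by (rule wiener_le_mono[OF that order_refl]) (use R0 in \<open>simp add: right_diff_distrib\<close>)
  have ind: "wiener_le C (u n) (R * (1 - 1 / 2 ^ n)) \<and> wiener_le C (p n) (R * (1 - 1 / 2 ^ n)) \<and>
      wiener_le C (q n) (R * (1 - 1 / 2 ^ n)) \<and>
      wiener_le C (\<lambda>k t. u (Suc n) k t - u n k t) (R / 2 / 2 ^ n) \<and>
      wiener_le C (\<lambda>k t. p (Suc n) k t - p n k t) (R / 2 / 2 ^ n) \<and>
      wiener_le C (\<lambda>k t. q (Suc n) k t - q n k t) (R / 2 / 2 ^ n)" for n
  proof (induction n)
    case 0
    have "wiener_le C (\<lambda>k t. 0) (R / 2)"
      by (rule wiener_le_mono[OF wiener_le_0 order_refl]) (use R0 in simp)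
    then show ?case using e by (simp add: z0 z1 wiener_le_0)
  next
    case (Suc n)
    have eq: "R * (1 - 1 / 2 ^ n) + R / 2 / 2 ^ n = R * (1 - 1 / 2 ^ Suc n)" by (simp add: field_simps)
    have step: "wiener_le C (w (Suc n)) (R * (1 - 1 / 2 ^ Suc n))"
      if "wiener_le C (w n) (R * (1 - 1 / 2 ^ n))"
        "wiener_le C (\<lambda>k t. w (Suc n) k t - w n k t) (R / 2 / 2 ^ n)" for w :: "nat \<Rightarrow> int \<Rightarrow> real \<Rightarrow> real"
      unfolding eq[symmetric] by (rule wiener_le_cong[OF wiener_le_add[OF that]]) simp
    have u: "wiener_le C (u (Suc n)) (R * (1 - 1 / 2 ^ Suc n))" using Suc by (intro step) auto
    have p: "wiener_le C (p (Suc n)) (R * (1 - 1 / 2 ^ Suc n))" using Suc by (intro step) auto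
    have q: "wiener_le C (q (Suc n)) (R * (1 - 1 / 2 ^ Suc n))" using Suc by (intro step) auto
    have d: "R / 2 / 2 ^ Suc n = R / 2 / 2 ^ n / 2" by simp
    note L = map_lipschitz[OF C m R, where u = "u (Suc n)" and u' = "u n" and p = "p (Suc n)" and p' = "p n"
        and q = "q (Suc n)" and q' = "q n" and D = "R / 2 / 2 ^ n"]
    note L = L(1)[where \<phi> = \<phi>, folded zS d] L(2,3)[folded zS d]
    have IH: "wiener_le C (u n) R" "wiener_le C (p n) R" "wiener_le C (q n) R"
        "wiener_le C (u (Suc n)) R" "wiener_le C (p (Suc n)) R" "wiener_le C (q (Suc n)) R"
      using Suc.IH ball[OF u] ball[OF p] ball[OF q] by (auto intro: ball)
    show ?case
      using u p q L[OF IH(4,1) _ IH(5,2) _ IH(6,3)] Suc.IH by simp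
  qed
  note u = ind[THEN conjunct1]
    and p = ind[THEN conjunct2, THEN conjunct1]
    and q = ind[THEN conjunct2, THEN conjunct2, THEN conjunct1]
  have C0: "C \<ge> 0" using C by simp
  obtain U where U: "\<And>n. wiener_le C (\<lambda>k t. U k t - u n k t) (2 * (R / 2) / 2 ^ n)"
      "\<And>k t. t \<ge> 0 \<Longrightarrow> (\<lambda>n. u n k t) \<longlonglongrightarrow> U k t"
    by (rule wiener_le_Cauchy_limit[where u = u and D = "R / 2", OF C0]) (use ind wiener_le_continuous[OF u] in auto)
  obtain P where P: "\<And>n. wiener_le C (\<lambda>k t. P k t - p n k t) (2 * (R / 2) / 2 ^ n)"
      "\<And>k t. t \<ge> 0 \<Longrightarrow> (\<lambda>n. p n k t) \<longlonglongrightarrow> P k t"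
    by (rule wiener_le_Cauchy_limit[where u = p and D = "R / 2", OF C0]) (use ind wiener_le_continuous[OF p] in auto)
  obtain Q where Q: "\<And>n. wiener_le C (\<lambda>k t. Q k t - q n k t) (2 * (R / 2) / 2 ^ n)"
      "\<And>k t. t \<ge> 0 \<Longrightarrow> (\<lambda>n. q n k t) \<longlonglongrightarrow> Q k t"
    by (rule wiener_le_Cauchy_limit[where u = q and D = "R / 2", OF C0]) (use ind wiener_le_continuous[OF q] in auto)
  have UR: "wiener_le C U R" and PR: "wiener_le C P R" and QR: "wiener_le C Q R"
    using U(1)[of 0] P(1)[of 0] Q(1)[of 0] by (simp_all add: z0)
  have lip: "wiener_le C (\<lambda>k t. mapU C \<phi> U P Q k t - u (Suc n) k t) (2 * (R / 2) / 2 ^ n / 2)"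
      "wiener_le C (\<lambda>k t. mapP U P k t - p (Suc n) k t) (2 * (R / 2) / 2 ^ n / 2)"
      "wiener_le C (\<lambda>k t. mapQ m U Q k t - q (Suc n) k t) (2 * (R / 2) / 2 ^ n / 2)" for n
    unfolding zS by (rule map_lipschitz[OF C m R UR ball[OF u] U(1) PR ball[OF p] P(1) QR ball[OF q] Q(1)])+
  \<comment> \<open>By the Lipschitz bound the (n+1)-st iterate is close to the map applied to the
    limit, so the same sequence converges both to w and to F.\<close>
  have limit: "w k t = F k t"
    if d: "\<And>n. wiener_le C (\<lambda>k t. F k t - v (Suc n) k t) (2 * (R / 2) / 2 ^ n / 2)"
      and l: "(\<lambda>n. v n k t) \<longlonglongrightarrow> w k t" and t: "t \<ge> 0"
    for F w :: "int \<Rightarrow> real \<Rightarrow> real" and v k t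
  proof (rule LIMSEQ_unique)
    show "(\<lambda>n. v (Suc n) k t) \<longlonglongrightarrow> w k t" using l by (rule LIMSEQ_Suc)
    have "(\<lambda>n. F k t - v (Suc n) k t) \<longlonglongrightarrow> 0"
    proof (rule Lim_null_comparison)
      have "norm (F k t - v (Suc n) k t) \<le> R * (1 / 2) ^ n" for n
      proof -
        have "norm (F k t - v (Suc n) k t) \<le> (2 * (R / 2) / 2 ^ n / 2) * exp (- (C * t))"
          using wiener_le_bound[OF d t] by simp
        also have "\<dots> \<le> (2 * (R / 2) / 2 ^ n / 2) * 1"
          using R0 C t by (intro mult_left_mono) auto
        also have "\<dots> \<le> R * (1 / 2) ^ n"
          using R0 by (simp add: power_divide field_simps)
        finally show ?thesis .
      qed
      then show "\<forall>\<^sub>F n in sequentially. norm (F k t - v (Suc n) k t) \<le> R * (1 / 2) ^ n" by simp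
      show "(\<lambda>n. R * (1 / 2) ^ n) \<longlonglongrightarrow> 0"
        by (intro tendsto_mult_right_zero LIMSEQ_power_zero) simp
    qed
    from tendsto_diff[OF tendsto_const[of "F k t"] this]
    show "(\<lambda>n. v (Suc n) k t) \<longlonglongrightarrow> F k t" by simp
  qed
  \<comment> \<open>Parity survives each iteration, by the product rule of
    \<open>conv_uminus\<close> and the oddness of the data, and then passes to the limit.\<close>
  have par: "(\<forall>k t. u n (- k) t = - u n k t) \<and> (\<forall>k t. p n (- k) t = p n k t) \<and> (\<forall>k t. q n (- k) t = q n k t)" for n
  proof (induction n)
    case 0
    then show ?case by (simp add: z0)
  next
    case (Suc n)
    have s: "conv (\<lambda>k t. p n k t + q n k t) (u n) (- k) t = - conv (\<lambda>k t. p n k t + q n k t) (u n) k t" for k t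
      using conv_uminus[where u = "\<lambda>k t. p n k t + q n k t" and v = "u n" and r = 1 and s = "-1"] Suc by simp
    have h: "conv (hilbert (u n)) (hilbert (u n)) (- k) t = conv (hilbert (u n)) (hilbert (u n)) k t" for k t
      using conv_uminus[where u = "hilbert (u n)" and v = "hilbert (u n)" and r = 1 and s = 1] Suc
      by (simp add: hilbert_def sgn_minus)
    have j: "conv (inv_Lambda (u n)) (inv_Lambda (u n)) (- k) t = conv (inv_Lambda (u n)) (inv_Lambda (u n)) k t" for k t
      using conv_uminus[where u = "inv_Lambda (u n)" and v = "inv_Lambda (u n)" and r = "-1" and s = "-1"] Suc
      by (simp add: inv_Lambda_def)
    have h2: "conv (conv (hilbert (u n)) (hilbert (u n))) (p n) (- k) t = conv (conv (hilbert (u n)) (hilbert (u n))) (p n) k t" for k t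
      using conv_uminus[where u = "conv (hilbert (u n)) (hilbert (u n))" and v = "p n" and r = 1 and s = 1] Suc h by simp
    have j2: "conv (conv (inv_Lambda (u n)) (inv_Lambda (u n))) (q n) (- k) t = conv (conv (inv_Lambda (u n)) (inv_Lambda (u n))) (q n) k t" for k t
      using conv_uminus[where u = "conv (inv_Lambda (u n)) (inv_Lambda (u n))" and v = "q n" and r = 1 and s = 1] Suc j by simp
    show ?case
      unfolding zS by (simp add: mapU_def mapP_def mapQ_def duhamel_def lin_part_def s h j h2 j2 odd)
  qed
  show ?thesis
  proof (rule that[OF UR PR QR])
    fix k and t :: real assume t: "t \<ge> 0"
    show "U k t = mapU C \<phi> U P Q k t" by (rule limit[where v = u and w = U and F = "mapU C \<phi> U P Q", OF lip(1) U(2)[OF t] t])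
    show "P k t = mapP U P k t" by (rule limit[where v = p and w = P and F = "mapP U P", OF lip(2) P(2)[OF t] t])
    show "Q k t = mapQ m U Q k t" by (rule limit[where v = q and w = Q and F = "mapQ m U Q", OF lip(3) Q(2)[OF t] t])
    show "U (- k) t = - U k t"
      using LIMSEQ_unique[OF U(2)[OF t, of "- k"]] tendsto_minus[OF U(2)[OF t, of k]] par by simp
    show "P (- k) t = P k t"
      using LIMSEQ_unique[OF P(2)[OF t, of "- k"]] P(2)[OF t, of k] par by simp
    show "Q (- k) t = Q k t"
      using LIMSEQ_unique[OF Q(2)[OF t, of "- k"]] Q(2)[OF t, of k] par by simp
  qed
qed

section \<open>Trigonometric series and the Poisson kernel\<close>

definition fourier_series :: "(int \<Rightarrow> complex) \<Rightarrow> real \<Rightarrow> complex" where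
  "fourier_series a x = (\<Sum>\<^sub>\<infinity>k. a k * cis (real_of_int k * x))"

definition cos_series :: "(int \<Rightarrow> real) \<Rightarrow> real \<Rightarrow> real" where
  "cos_series a x = (\<Sum>\<^sub>\<infinity>k. a k * cos (real_of_int k * x))"

definition sin_series :: "(int \<Rightarrow> real) \<Rightarrow> real \<Rightarrow> real" where
  "sin_series a x = (\<Sum>\<^sub>\<infinity>k. a k * sin (real_of_int k * x))"

lemma fourier_series_summable:
  assumes "(\<lambda>k. norm (a k)) summable_on UNIV"
  shows "(\<lambda>k. norm (a k * cis (real_of_int k * x))) summable_on UNIV"
    "(\<lambda>k. a k * cis (real_of_int k * x)) summable_on UNIV"
proof -
  show "(\<lambda>k. norm (a k * cis (real_of_int k * x))) summable_on UNIV"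
    using assms by (simp add: norm_mult)
  then show "(\<lambda>k. a k * cis (real_of_int k * x)) summable_on UNIV"
    by (rule abs_summable_summable)
qed

lemma fourier_series_mult:
  assumes a: "(\<lambda>k. norm (a k)) summable_on UNIV" and b: "(\<lambda>k. norm (b k)) summable_on UNIV"
  shows "fourier_series (\<lambda>k. \<Sum>\<^sub>\<infinity>j. a j * b (k - j)) x = fourier_series a x * fourier_series b x"
proof -
  have "(\<Sum>\<^sub>\<infinity>j. a j * b (k - j)) * cis (real_of_int k * x)
      = (\<Sum>\<^sub>\<infinity>j. (a j * cis (real_of_int j * x)) * (b (k - j) * cis (real_of_int (k - j) * x)))" for k
  proof -
    have "(a j * cis (real_of_int j * x)) * (b (k - j) * cis (real_of_int (k - j) * x))
        = a j * b (k - j) * cis (real_of_int k * x)" for j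
      using cis_mult[of "real_of_int j * x" "real_of_int (k - j) * x"] by (simp add: algebra_simps)
    then show ?thesis by (simp only: infsum_cmult_left')
  qed
  then show ?thesis
    unfolding fourier_series_def by (simp only: l1_conv_infsum[OF fourier_series_summable(1)[OF a] fourier_series_summable(1)[OF b]])
qed

lemma fourier_series_of_real:
  fixes a :: "int \<Rightarrow> real"
  assumes "(\<lambda>k. \<bar>a k\<bar>) summable_on UNIV"
  shows "fourier_series (\<lambda>k. of_real (a k)) x = Complex (cos_series a x) (sin_series a x)"
proof -
  have s: "(\<lambda>k. of_real (a k) * cis (real_of_int k * x)) summable_on UNIV"
    by (rule fourier_series_summable) (use assms in simp)
  show ?thesis
    unfolding fourier_series_def cos_series_def sin_series_def
    by (rule complex_eqI) (use infsum_Re[OF s] infsum_Im[OF s] in auto)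
qed

lemma infsum_odd:
  fixes f :: "int \<Rightarrow> real"
  assumes "\<And>k. f (- k) = - f k"
  shows "infsum f UNIV = 0"
proof -
  have "infsum f UNIV = (\<Sum>\<^sub>\<infinity>k. f (- k))"
    using infsum_reindex_bij_betw[of uminus UNIV UNIV f] by (simp add: bij_uminus)
  also have "\<dots> = - infsum f UNIV"
    unfolding assms by (rule infsum_uminus)
  finally show ?thesis by simp
qed

lemma fourier_series_even:
  assumes "(\<lambda>k. \<bar>a k\<bar>) summable_on UNIV" "\<And>k. a (- k) = a k"
  shows "fourier_series (\<lambda>k. of_real (a k)) x = of_real (cos_series a x)"
proof -
  have "sin_series a x = 0" unfolding sin_series_def by (rule infsum_odd) (simp add: assms)
  then show ?thesis using fourier_series_of_real[OF assms(1)] by (simp add: complex_of_real_def)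
qed

lemma fourier_series_odd:
  assumes "(\<lambda>k. \<bar>a k\<bar>) summable_on UNIV" "\<And>k. a (- k) = - a k"
  shows "fourier_series (\<lambda>k. of_real (a k)) x = \<i> * of_real (sin_series a x)"
proof -
  have "cos_series a x = 0" unfolding cos_series_def by (rule infsum_odd) (simp add: assms)
  then show ?thesis using fourier_series_of_real[OF assms(1)] by (simp add: complex_eq_iff)
qed

lemma fourier_series_continuous:
  assumes "(\<lambda>k. norm (a k)) summable_on UNIV"
  shows "continuous_on S (fourier_series a)"
  unfolding fourier_series_def[abs_def]
  by (rule continuous_on_infsum[OF _ assms]) (auto simp: norm_mult intro!: continuous_intros)

lemma has_integral_cis:
  "((\<lambda>x. cis (real_of_int n * x)) has_integral (if n = 0 then 2 * pi else 0)) {0..2 * pi}"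
proof (cases "n = 0")
  case True
  then show ?thesis
    using has_integral_const_real[of "1::complex" 0 "2 * pi"] by (simp add: scaleR_conv_of_real)
next
  case False
  have "((\<lambda>x. exp (\<i> * of_int n * of_real x)) has_integral
      exp (\<i> * of_int n * of_real (2 * pi)) / (\<i> * of_int n) - exp (\<i> * of_int n * of_real 0) / (\<i> * of_int n)) {0..2 * pi}"
  proof (rule fundamental_theorem_of_calculus)
    fix x :: real
    have "((\<lambda>z. exp (\<i> * of_int n * z) / (\<i> * of_int n)) has_field_derivative exp (\<i> * of_int n * of_real x)) (at (of_real x))"
      using False by (auto intro!: derivative_eq_intros)
    from has_vector_derivative_real_field[OF this]
    show "((\<lambda>x. exp (\<i> * of_int n * of_real x) / (\<i> * of_int n)) has_vector_derivative exp (\<i> * of_int n * of_real x)) (at x within {0..2 * pi})"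
      by (simp add: o_def)
  qed simp
  moreover have "exp (\<i> * of_int n * of_real (2 * pi)) = 1"
    using exp_integer_2pi[of "of_int n"] by (simp add: mult_ac)
  moreover have "exp (\<i> * of_int n * of_real x) = cis (real_of_int n * x)" for x
    by (simp add: cis_conv_exp mult_ac)
  ultimately show ?thesis using False by simp
qed

lemma integral_fourier_series_cis:
  fixes a :: "int \<Rightarrow> complex"
  assumes "(\<lambda>k. norm (a k)) summable_on UNIV"
  shows "integral {0..2 * pi} (\<lambda>x. fourier_series a x * cis (- (real_of_int n * x))) = 2 * pi * a n"
proof -
  have "integral {0..2 * pi} (\<lambda>x. fourier_series a x * cis (- (real_of_int n * x)))
      = integral {0..2 * pi} (\<lambda>x. \<Sum>\<^sub>\<infinity>k. a k * cis (real_of_int (k - n) * x))"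
  proof (rule integral_cong)
    fix x
    have "a k * cis (real_of_int k * x) * cis (- (real_of_int n * x)) = a k * cis (real_of_int (k - n) * x)" for k
      by (simp add: mult.assoc cis_mult algebra_simps)
    then show "fourier_series a x * cis (- (real_of_int n * x)) = (\<Sum>\<^sub>\<infinity>k. a k * cis (real_of_int (k - n) * x))"
      unfolding fourier_series_def infsum_cmult_left'[symmetric] by (simp only:)
  qed
  also have "\<dots> = (\<Sum>\<^sub>\<infinity>k. integral {0..2 * pi} (\<lambda>x. a k * cis (real_of_int (k - n) * x)))"
    by (rule integral_infsum[OF _ assms]) (auto simp: norm_mult intro!: continuous_intros)
  also have "\<dots> = (\<Sum>\<^sub>\<infinity>k. if k = n then 2 * pi * a n else 0)"
    by (rule infsum_cong) (simp only: integral_mult_right integral_unique[OF has_integral_cis], simp)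
  also have "\<dots> = (\<Sum>\<^sub>\<infinity>k\<in>{n}. 2 * pi * a n)"
    by (rule infsum_cong_neutral) auto
  finally show ?thesis by simp
qed

text \<open>Splitting the integers at 0 leaves two geometric series, in z = r e^(ix) and in its
  conjugate. The second starts at exponent 1, so the index 0 is counted once.\<close>

lemma poisson_kernel:
  fixes r :: real
  assumes r: "0 \<le> r" "r < 1"
  shows "(\<lambda>k. norm (complex_of_real (r ^ nat \<bar>k\<bar>))) summable_on UNIV"
    and "fourier_series (\<lambda>k. of_real (r ^ nat \<bar>k\<bar>)) x = of_real ((1 - r\<^sup>2) / (cmod (1 - of_real r * cis x))\<^sup>2)"
proof -
  define z where "z = of_real r * cis x"
  have z: "cmod z = r" using r by (simp add: z_def norm_mult)
  have U: "(UNIV :: int set) = range int \<union> range (\<lambda>n. - int (Suc n))"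
  proof -
    have "k \<in> range int \<union> range (\<lambda>n. - int (Suc n))" for k
      by (cases k) auto
    then show ?thesis by auto
  qed
  have disj: "range int \<inter> range (\<lambda>n. - int (Suc n)) = {}" by auto
  have inj: "inj int" "inj (\<lambda>n. - int (Suc n))" by (auto simp: inj_def)
  have s: "((\<lambda>n. w ^ n) has_sum 1 / (1 - w)) UNIV" if "norm w < 1" for w :: "'a::{real_normed_field,banach}"
    by (rule norm_summable_imp_has_sum) (use that geometric_sums[of w] in \<open>auto simp: norm_power\<close>)
  have s1: "((\<lambda>k. r ^ nat \<bar>k\<bar>) has_sum 1 / (1 - r)) (range int)"
    using s[of r] r by (subst has_sum_reindex[OF inj(1)]) (simp add: o_def)
  have s2: "((\<lambda>k. r ^ nat \<bar>k\<bar>) has_sum r * (1 / (1 - r))) (range (\<lambda>n. - int (Suc n)))"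
    using has_sum_cmult_right[OF s[of r], of r] r
    by (subst has_sum_reindex[OF inj(2)]) (simp add: o_def nat_add_distrib)
  show "(\<lambda>k. norm (complex_of_real (r ^ nat \<bar>k\<bar>))) summable_on UNIV"
    using has_sum_Un_disjoint[OF s1 s2 disj] r unfolding U[symmetric]
    by (auto simp: summable_on_def norm_power)
  have e1: "((\<lambda>k. of_real (r ^ nat \<bar>k\<bar>) * cis (real_of_int k * x)) has_sum 1 / (1 - z)) (range int)"
  proof -
    have "of_real (r ^ nat \<bar>int n\<bar>) * cis (real_of_int (int n) * x) = z ^ n" for n
      unfolding z_def power_mult_distrib Complex.DeMoivre by simp
    then show ?thesis
      using s[of z] r z by (subst has_sum_reindex[OF inj(1)]) (simp add: o_def)
  qed
  have e2: "((\<lambda>k. of_real (r ^ nat \<bar>k\<bar>) * cis (real_of_int k * x)) has_sum cnj z * (1 / (1 - cnj z)))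
      (range (\<lambda>n. - int (Suc n)))"
  proof -
    have "of_real (r ^ nat \<bar>- int (Suc n)\<bar>) * cis (real_of_int (- int (Suc n)) * x) = cnj z * cnj z ^ n" for n
    proof -
      have "cnj z * cnj z ^ n = cnj (z ^ Suc n)" by simp
      also have "z ^ Suc n = of_real (r ^ Suc n) * cis (real (Suc n) * x)"
        unfolding z_def power_mult_distrib Complex.DeMoivre by simp
      finally show ?thesis by (simp add: nat_add_distrib cis_cnj algebra_simps)
    qed
    then show ?thesis
      using has_sum_cmult_right[OF s[of "cnj z"], of "cnj z"] r z
      by (subst has_sum_reindex[OF inj(2)]) (simp add: o_def)
  qed
  have "fourier_series (\<lambda>k. of_real (r ^ nat \<bar>k\<bar>)) x = 1 / (1 - z) + cnj z * (1 / (1 - cnj z))"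
    unfolding fourier_series_def using has_sum_Un_disjoint[OF e1 e2 disj] unfolding U[symmetric] by (rule infsumI)
  also have "\<dots> = (1 - z * cnj z) / ((1 - z) * cnj (1 - z))"
  proof -
    have "1 - z \<noteq> 0" "1 - cnj z \<noteq> 0" using z r by auto
    then show ?thesis by (simp add: field_simps)
  qed
  also have "\<dots> = of_real ((1 - r\<^sup>2) / (cmod (1 - z))\<^sup>2)"
    unfolding complex_norm_square[symmetric] z by simp
  finally show "fourier_series (\<lambda>k. of_real (r ^ nat \<bar>k\<bar>)) x = of_real ((1 - r\<^sup>2) / (cmod (1 - of_real r * cis x))\<^sup>2)"
    unfolding z_def .
qed

text \<open>The bound is the value at x = pi. Its factor 1 - r cancels when the difference w - P_r w
  is divided by 1 - r in \<open>Lambda_ge_at_maximum\<close>.\<close>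

lemma poisson_kernel_ge:
  fixes r :: real
  assumes r: "0 \<le> r" "r < 1"
  shows "(1 - r) / (1 + r) \<le> (1 - r\<^sup>2) / (cmod (1 - of_real r * cis x))\<^sup>2"
proof -
  have "cmod (1 - of_real r * cis x) \<le> 1 + r"
    using norm_triangle_ineq4[of 1 "of_real r * cis x"] r by (simp add: norm_mult)
  then have le: "(cmod (1 - of_real r * cis x))\<^sup>2 \<le> (1 + r)\<^sup>2" by (intro power_mono) auto
  have "of_real r * cis x \<noteq> 1"
  proof
    assume "of_real r * cis x = 1"
    then have "cmod (of_real r * cis x) = 1" by simp
    with r show False by (simp add: norm_mult)
  qed
  then have pos: "0 < (cmod (1 - of_real r * cis x))\<^sup>2" by simp
  have "(1 - r) / (1 + r) = ((1 - r) * (1 + r)) / ((1 + r) * (1 + r))" using r by simp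
  also have "\<dots> = (1 - r\<^sup>2) / (1 + r)\<^sup>2" by (simp add: power2_eq_square algebra_simps)
  also have "\<dots> \<le> (1 - r\<^sup>2) / (cmod (1 - of_real r * cis x))\<^sup>2"
    using r le pos by (intro divide_left_mono) (auto simp: abs_square_le_1 power_le_one)
  finally show ?thesis .
qed

lemma Re_of_real_mult: "Re (of_real a * z) = a * Re z"
  by simp

lemma integral_fourier_series:
  fixes a :: "int \<Rightarrow> complex"
  assumes "(\<lambda>k. norm (a k)) summable_on UNIV"
  shows "integral {0..2 * pi} (fourier_series a) = 2 * pi * a 0"
  using integral_fourier_series_cis[OF assms, of 0] by simp

text \<open>Since (1 - r^|k|) / (1 - r) tends to |k|, the value L is the limit of (w - P_r w)(x) /
  (1 - r), with P_r the Poisson average. At a maximum w(x) - w(x + theta) >= 0, so the kernel may be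
  replaced by its minimum; what remains is the plain average of w(x) - w(x + theta), which equals
  w(x) because w has mean zero.\<close>

lemma Lambda_ge_at_maximum:
  fixes c :: "int \<Rightarrow> complex" and w :: "real \<Rightarrow> real" and L :: real
  assumes c: "(\<lambda>k. \<bar>real_of_int k\<bar> * cmod (c k)) summable_on UNIV" and c0: "c 0 = 0"
    and w: "\<And>y. fourier_series c y = of_real (w y)"
    and L: "fourier_series (\<lambda>k. of_real \<bar>real_of_int k\<bar> * c k) x = of_real L"
    and max: "\<And>y. w y \<le> w x"
  shows "w x / 2 \<le> L"
proof -
  have cs: "(\<lambda>k. cmod (c k)) summable_on UNIV"
  proof (rule summable_on_comparison_test[OF c])
    fix k :: int
    show "cmod (c k) \<le> \<bar>real_of_int k\<bar> * cmod (c k)"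
    proof (cases "k = 0")
      case False
      then have "1 \<le> \<bar>real_of_int k\<bar>" by linarith
      from mult_right_mono[OF this, of "cmod (c k)"] show ?thesis by simp
    qed (simp add: c0)
  qed auto
  have wc: "continuous_on UNIV w"
  proof -
    have "continuous_on UNIV (\<lambda>y. Re (fourier_series c y))" by (intro continuous_intros fourier_series_continuous cs)
    then show ?thesis by (simp add: w)
  qed
  \<comment> \<open>The quotient (w - P_r w)(x) / (1 - r) with 1 - r^|k| divided by 1 - r mode by
    mode. In this form it makes sense and is continuous up to r = 1.\<close>
  define G where "G r = (\<Sum>\<^sub>\<infinity>k. (\<Sum>i<nat \<bar>k\<bar>. r ^ i) * Re (c k * cis (real_of_int k * x)))" for r :: real
  have G_cont: "continuous_on {0..1} G"
    unfolding G_def[abs_def]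
  proof (rule continuous_on_infsum[OF _ c])
    fix k and r :: real assume r: "r \<in> {0..1}"
    have "(\<Sum>i<nat \<bar>k\<bar>. r ^ i) \<le> (\<Sum>i<nat \<bar>k\<bar>. 1)"
      using r by (intro sum_mono power_le_one) auto
    moreover have "0 \<le> (\<Sum>i<nat \<bar>k\<bar>. r ^ i)" using r by (intro sum_nonneg) auto
    ultimately have "\<bar>\<Sum>i<nat \<bar>k\<bar>. r ^ i\<bar> \<le> \<bar>real_of_int k\<bar>" by simp
    moreover have "\<bar>Re (c k * cis (real_of_int k * x))\<bar> \<le> cmod (c k)"
      using abs_Re_le_cmod[of "c k * cis (real_of_int k * x)"] by (simp add: norm_mult)
    ultimately show "norm ((\<Sum>i<nat \<bar>k\<bar>. r ^ i) * Re (c k * cis (real_of_int k * x))) \<le> \<bar>real_of_int k\<bar> * cmod (c k)"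
      unfolding real_norm_def abs_mult by (intro mult_mono) auto
  qed (intro continuous_intros)
  have G1: "G 1 = L"
  proof -
    have "(\<lambda>k. norm (complex_of_real \<bar>real_of_int k\<bar> * c k)) summable_on UNIV"
      using c by (simp add: norm_mult)
    from fourier_series_summable(2)[OF this, of x]
    have "(\<Sum>\<^sub>\<infinity>k. Re (complex_of_real \<bar>real_of_int k\<bar> * c k * cis (real_of_int k * x))) = Re (of_real L)"
      unfolding L[symmetric] fourier_series_def by (rule infsum_Re)
    moreover have "Re (complex_of_real \<bar>real_of_int k\<bar> * c k * cis (real_of_int k * x))
        = (\<Sum>i<nat \<bar>k\<bar>. 1 ^ i) * Re (c k * cis (real_of_int k * x))" for k
      by (simp add: algebra_simps)
    ultimately show ?thesis unfolding G_def by simp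
  qed
  have ge: "w x / (1 + r) \<le> G r" if r: "0 \<le> r" "r < 1" for r
  proof -
    define p where "p k = complex_of_real (r ^ nat \<bar>k\<bar>)" for k
    \<comment> \<open>The coefficients in theta of w(x) - w(x + theta).\<close>
    define q where "q k = (if k = 0 then of_real (w x) else 0) - c k * cis (real_of_int k * x)" for k
    define P where "P \<theta> = (1 - r\<^sup>2) / (cmod (1 - of_real r * cis \<theta>))\<^sup>2" for \<theta>
    have ps: "(\<lambda>k. norm (p k)) summable_on UNIV" and pP: "\<And>\<theta>. fourier_series p \<theta> = of_real (P \<theta>)"
      unfolding p_def[abs_def] P_def using poisson_kernel[OF r] by auto
    have d: "((\<lambda>k. (if k = (0::int) then complex_of_real (w x) else 0) * cis (real_of_int k * \<theta>)) has_sum of_real (w x)) UNIV" for \<theta>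
      by (rule has_sum_finite_neutralI[where B = "{0}"]) auto
    have dn: "(\<lambda>k. norm (if k = (0::int) then complex_of_real (w x) else 0)) summable_on UNIV"
      by (rule finite_nonzero_values_imp_summable_on) (auto intro: finite_subset[of _ "{0}"])
    have qs: "(\<lambda>k. norm (q k)) summable_on UNIV"
    proof (rule summable_on_comparison_test[OF summable_on_add[OF dn cs]])
      show "norm (q k) \<le> norm (if k = 0 then complex_of_real (w x) else 0) + cmod (c k)" for k
        unfolding q_def using norm_triangle_ineq4[of "if k = 0 then complex_of_real (w x) else 0" "c k * cis (real_of_int k * x)"]
        by (simp add: norm_mult)
    qed auto
    have qw: "fourier_series q \<theta> = of_real (w x - w (x + \<theta>))" for \<theta>
    proof -
      have "fourier_series q \<theta> = (\<Sum>\<^sub>\<infinity>k. (if k = (0::int) then complex_of_real (w x) else 0) * cis (real_of_int k * \<theta>)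
          - c k * cis (real_of_int k * (x + \<theta>)))"
        unfolding fourier_series_def q_def by (intro infsum_cong) (simp add: left_diff_distrib mult.assoc cis_mult distrib_left)
      also have "\<dots> = of_real (w x) - fourier_series c (x + \<theta>)"
        unfolding fourier_series_def using infsum_diff[OF has_sum_imp_summable[OF d] fourier_series_summable(2)[OF cs]] infsumI[OF d]
        by simp
      finally show ?thesis by (simp add: w)
    qed
    have rs: "(\<lambda>k. norm (of_real (r ^ nat \<bar>k\<bar>) * c k)) summable_on UNIV"
    proof (rule summable_on_comparison_test[OF cs])
      show "norm (of_real (r ^ nat \<bar>k\<bar>) * c k) \<le> cmod (c k)" for k
        using r mult_right_mono[OF power_le_one[of r "nat \<bar>k\<bar>"], of "cmod (c k)"] by (simp add: norm_mult norm_power)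
    qed auto
    \<comment> \<open>The coefficient at 0 of a product is its mean, so this computes the mean of
      (w(x) - w(x + theta)) P(theta) as w(x) minus the Poisson average.\<close>
    have conv0: "(\<Sum>\<^sub>\<infinity>j. q j * p (0 - j)) = of_real (w x) - fourier_series (\<lambda>k. of_real (r ^ nat \<bar>k\<bar>) * c k) x"
    proof -
      have "(\<Sum>\<^sub>\<infinity>j. q j * p (0 - j)) = (\<Sum>\<^sub>\<infinity>k. (if k = (0::int) then complex_of_real (w x) else 0) * cis (real_of_int k * x)
          - of_real (r ^ nat \<bar>k\<bar>) * c k * cis (real_of_int k * x))"
        unfolding q_def p_def by (intro infsum_cong) (simp add: algebra_simps)
      also have "\<dots> = of_real (w x) - fourier_series (\<lambda>k. of_real (r ^ nat \<bar>k\<bar>) * c k) x"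
        unfolding fourier_series_def using infsum_diff[OF has_sum_imp_summable[OF d] fourier_series_summable(2)[OF rs]] infsumI[OF d]
        by simp
      finally show ?thesis .
    qed
    have of_real_int: "integral {0..2 * pi} (\<lambda>\<theta>. complex_of_real (h \<theta>)) = of_real (integral {0..2 * pi} h)"
      if "continuous_on {0..2 * pi} h" for h
      using integral_linear[OF integrable_continuous_interval[OF that] bounded_linear_of_real] by (simp add: o_def)
    have wc': "continuous_on {0..2 * pi} (\<lambda>\<theta>. w x - w (x + \<theta>))"
      by (intro continuous_intros continuous_on_compose2[OF wc]) auto
    have "continuous_on {0..2 * pi} (\<lambda>\<theta>. Re (fourier_series p \<theta>))" by (intro continuous_intros fourier_series_continuous ps)
    then have Pc: "continuous_on {0..2 * pi} P" by (simp add: pP)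
    have "of_real (integral {0..2 * pi} (\<lambda>\<theta>. (w x - w (x + \<theta>)) * P \<theta>))
        = integral {0..2 * pi} (fourier_series (\<lambda>k. \<Sum>\<^sub>\<infinity>j. q j * p (k - j)))"
    proof -
      have "fourier_series (\<lambda>k. \<Sum>\<^sub>\<infinity>j. q j * p (k - j)) = (\<lambda>\<theta>. of_real ((w x - w (x + \<theta>)) * P \<theta>))"
        by (rule ext) (simp only: fourier_series_mult[OF qs ps] qw pP of_real_mult)
      then show ?thesis
        by (simp only: of_real_int[OF continuous_on_mult[OF wc' Pc]])
    qed
    also have "\<dots> = 2 * pi * (of_real (w x) - fourier_series (\<lambda>k. of_real (r ^ nat \<bar>k\<bar>) * c k) x)"
      unfolding integral_fourier_series[OF l1_conv_abs[OF qs ps]] conv0 ..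
    finally have I1: "integral {0..2 * pi} (\<lambda>\<theta>. (w x - w (x + \<theta>)) * P \<theta>)
        = 2 * pi * (w x - Re (fourier_series (\<lambda>k. of_real (r ^ nat \<bar>k\<bar>) * c k) x))"
      by (simp add: complex_eq_iff)
    \<comment> \<open>The hypothesis \<open>c 0 = 0\<close>, mean zero of w, enters the integral
      here.\<close>
    have "of_real (integral {0..2 * pi} (\<lambda>\<theta>. w x - w (x + \<theta>))) = integral {0..2 * pi} (fourier_series q)"
      unfolding of_real_int[OF wc', symmetric] qw[symmetric] ..
    also have "\<dots> = 2 * pi * of_real (w x)"
      unfolding integral_fourier_series[OF qs] by (simp add: q_def c0)
    finally have I2: "integral {0..2 * pi} (\<lambda>\<theta>. w x - w (x + \<theta>)) = 2 * pi * w x"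
      by (simp add: complex_eq_iff)
    have "(1 - r) / (1 + r) * (2 * pi * w x) = integral {0..2 * pi} (\<lambda>\<theta>. (1 - r) / (1 + r) * (w x - w (x + \<theta>)))"
      unfolding integral_mult_right I2 ..
    also have "\<dots> \<le> integral {0..2 * pi} (\<lambda>\<theta>. (w x - w (x + \<theta>)) * P \<theta>)"
    proof (rule integral_le)
      show "(1 - r) / (1 + r) * (w x - w (x + \<theta>)) \<le> (w x - w (x + \<theta>)) * P \<theta>" for \<theta>
        using mult_right_mono[OF poisson_kernel_ge[OF r, of \<theta>], of "w x - w (x + \<theta>)"] max
        by (simp add: P_def mult.commute)
    qed (intro integrable_continuous_interval continuous_intros wc' Pc)+
    finally have "2 * pi * ((1 - r) / (1 + r) * w x) \<le> 2 * pi * (w x - Re (fourier_series (\<lambda>k. of_real (r ^ nat \<bar>k\<bar>) * c k) x))"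
      unfolding I1 by (simp add: mult_ac)
    then have "(1 - r) / (1 + r) * w x \<le> w x - Re (fourier_series (\<lambda>k. of_real (r ^ nat \<bar>k\<bar>) * c k) x)"
      by (rule mult_left_le_imp_le) simp
    also have "\<dots> = Re (fourier_series c x) - Re (fourier_series (\<lambda>k. of_real (r ^ nat \<bar>k\<bar>) * c k) x)" by (simp add: w)
    also have "\<dots> = (\<Sum>\<^sub>\<infinity>k. Re (c k * cis (real_of_int k * x)) - Re (of_real (r ^ nat \<bar>k\<bar>) * c k * cis (real_of_int k * x)))"
      unfolding fourier_series_def infsum_Re[OF fourier_series_summable(2)[OF cs], symmetric] infsum_Re[OF fourier_series_summable(2)[OF rs], symmetric]
      by (rule infsum_diff[symmetric]) (intro summable_on_Re fourier_series_summable(2) cs rs)+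
    also have "\<dots> = (\<Sum>\<^sub>\<infinity>k. (1 - r) * ((\<Sum>i<nat \<bar>k\<bar>. r ^ i) * Re (c k * cis (real_of_int k * x))))"
    proof (rule infsum_cong)
      fix k
      have "Re (c k * cis (real_of_int k * x)) - Re (of_real (r ^ nat \<bar>k\<bar>) * c k * cis (real_of_int k * x))
          = (1 - r ^ nat \<bar>k\<bar>) * Re (c k * cis (real_of_int k * x))"
        unfolding mult.assoc Re_of_real_mult by (simp add: left_diff_distrib)
      then show "Re (c k * cis (real_of_int k * x)) - Re (of_real (r ^ nat \<bar>k\<bar>) * c k * cis (real_of_int k * x))
          = (1 - r) * ((\<Sum>i<nat \<bar>k\<bar>. r ^ i) * Re (c k * cis (real_of_int k * x)))"
        by (simp only: one_diff_power_eq mult.assoc)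
    qed
    also have "\<dots> = (1 - r) * G r" unfolding G_def by (rule infsum_cmult_right')
    finally have "(1 - r) * (w x / (1 + r)) \<le> (1 - r) * G r" by (simp add: mult_ac)
    then show ?thesis by (rule mult_left_le_imp_le) (use r in simp)
  qed
  \<comment> \<open>Letting r tend to 1 in w(x) / (1 + r) <= G(r) produces the factor 1/2.\<close>
  have "continuous_on (closure {0..<1::real}) (\<lambda>r. G r - w x / (1 + r))"
    using G_cont by (auto intro!: continuous_intros)
  then have "0 \<le> G 1 - w x / (1 + 1)"
    by (rule continuous_ge_on_closure) (use ge in auto)
  then show ?thesis by (simp add: G1)
qed

section \<open>Products and regularity of sine and cosine series\<close>

lemma of_real_conv:
  assumes "wiener_le c u M" "wiener_le d v M'" "t \<ge> 0"
  shows "complex_of_real (conv u v k t) = (\<Sum>\<^sub>\<infinity>j. of_real (u j t) * of_real (v (k - j) t))"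
proof -
  have "((\<lambda>j. complex_of_real (u j t * v (k - j) t)) has_sum of_real (conv u v k t)) UNIV"
    unfolding conv_def by (intro has_sum_of_real has_sum_infsum conv_summable[OF assms])
  then show ?thesis by (simp add: infsumI)
qed

lemma fourier_series_conv:
  assumes u: "wiener_le c u M" and v: "wiener_le d v M'" and t: "t \<ge> 0"
  shows "fourier_series (\<lambda>k. of_real (conv u v k t)) x = fourier_series (\<lambda>k. of_real (u k t)) x * fourier_series (\<lambda>k. of_real (v k t)) x"
  unfolding of_real_conv[OF assms]
  by (rule fourier_series_mult) (use wiener_le_summable(1)[OF u t] wiener_le_summable(1)[OF v t] in auto)

lemma cos_series_conv_even:
  assumes u: "wiener_le c u M" and v: "wiener_le d v M'" and t: "t \<ge> 0"
    and "\<And>k. u (- k) t = u k t" "\<And>k. v (- k) t = v k t"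
  shows "cos_series (\<lambda>k. conv u v k t) x = cos_series (\<lambda>k. u k t) x * cos_series (\<lambda>k. v k t) x"
proof -
  have "conv u v (- k) t = conv u v k t" for k
    using conv_uminus[of u t 1 v 1] assms by simp
  then have "complex_of_real (cos_series (\<lambda>k. conv u v k t) x) = of_real (cos_series (\<lambda>k. u k t) x * cos_series (\<lambda>k. v k t) x)"
    using fourier_series_conv[OF u v t, of x] assms
    by (simp add: fourier_series_even wiener_le_summable(1)[OF u t] wiener_le_summable(1)[OF v t]
      wiener_le_summable(1)[OF wiener_le_conv[OF u v] t])
  then show ?thesis by (simp only: of_real_eq_iff)
qed

lemma cos_series_conv_odd:
  assumes u: "wiener_le c u M" and v: "wiener_le d v M'" and t: "t \<ge> 0"
    and "\<And>k. u (- k) t = - u k t" "\<And>k. v (- k) t = - v k t"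
  shows "cos_series (\<lambda>k. conv u v k t) x = - (sin_series (\<lambda>k. u k t) x * sin_series (\<lambda>k. v k t) x)"
proof -
  have "conv u v (- k) t = conv u v k t" for k
    using conv_uminus[of u t "-1" v "-1"] assms by simp
  then have "complex_of_real (cos_series (\<lambda>k. conv u v k t) x) = of_real (- (sin_series (\<lambda>k. u k t) x * sin_series (\<lambda>k. v k t) x))"
    using fourier_series_conv[OF u v t, of x] assms
    by (simp add: fourier_series_even fourier_series_odd wiener_le_summable(1)[OF u t] wiener_le_summable(1)[OF v t]
      wiener_le_summable(1)[OF wiener_le_conv[OF u v] t], simp add: complex_eq_iff)
  then show ?thesis by (simp only: of_real_eq_iff)
qed

lemma sin_series_conv:
  assumes u: "wiener_le c u M" and v: "wiener_le d v M'" and t: "t \<ge> 0"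
    and "\<And>k. u (- k) t = u k t" "\<And>k. v (- k) t = - v k t"
  shows "sin_series (\<lambda>k. conv u v k t) x = cos_series (\<lambda>k. u k t) x * sin_series (\<lambda>k. v k t) x"
proof -
  have "conv u v (- k) t = - conv u v k t" for k
    using conv_uminus[of u t 1 v "-1"] assms by simp
  then have "\<i> * complex_of_real (sin_series (\<lambda>k. conv u v k t) x) = \<i> * of_real (cos_series (\<lambda>k. u k t) x * sin_series (\<lambda>k. v k t) x)"
    using fourier_series_conv[OF u v t, of x] assms
    by (simp add: fourier_series_even fourier_series_odd wiener_le_summable(1)[OF u t] wiener_le_summable(1)[OF v t]
      wiener_le_summable(1)[OF wiener_le_conv[OF u v] t])
  then show ?thesis by (simp only: mult_cancel_left of_real_eq_iff) simp
qed

lemma trig_series_summable: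
  fixes a :: "int \<Rightarrow> real"
  assumes "(\<lambda>k. \<bar>a k\<bar>) summable_on UNIV"
  shows "(\<lambda>k. a k * cos (real_of_int k * x)) summable_on UNIV"
    "(\<lambda>k. a k * sin (real_of_int k * x)) summable_on UNIV"
  by (rule abs_summable_summable, rule abs_summable_of_bound[OF assms],
      simp add: abs_mult mult_left_le)+

lemma trig_series_bound:
  fixes a :: "int \<Rightarrow> real"
  assumes s: "(\<lambda>k. \<bar>a k\<bar>) summable_on UNIV"
  shows "\<bar>cos_series a x\<bar> \<le> (\<Sum>\<^sub>\<infinity>k. \<bar>a k\<bar>)" "\<bar>sin_series a x\<bar> \<le> (\<Sum>\<^sub>\<infinity>k. \<bar>a k\<bar>)"
  unfolding cos_series_def sin_series_def real_norm_def[symmetric]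
  by (rule norm_infsum_le[OF has_sum_infsum has_sum_infsum];
      simp add: trig_series_summable s abs_mult mult_left_le)+

lemma trig_series_lincomb:
  fixes a b :: "int \<Rightarrow> real"
  assumes a: "(\<lambda>k. \<bar>a k\<bar>) summable_on UNIV" and b: "(\<lambda>k. \<bar>b k\<bar>) summable_on UNIV"
  shows "cos_series (\<lambda>k. r * a k + s * b k) x = r * cos_series a x + s * cos_series b x"
    "sin_series (\<lambda>k. r * a k + s * b k) x = r * sin_series a x + s * sin_series b x"
  unfolding cos_series_def sin_series_def infsum_cmult_right'[symmetric]
  by (subst infsum_add[symmetric];
      (intro summable_on_cmult_right trig_series_summable a b infsum_cong)?; simp add: algebra_simps)+

lemma trig_series_joint_continuous:
  assumes u: "wiener_le c u M" and c: "c \<ge> 0"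
  shows "continuous_on ({0..} \<times> UNIV) (\<lambda>z. sin_series (\<lambda>k. u k (fst z)) (snd z))"
    "continuous_on ({0..} \<times> UNIV) (\<lambda>z. cos_series (\<lambda>k. u k (fst z)) (snd z))"
proof -
  obtain a where a: "a summable_on UNIV" "\<And>k. a k \<ge> 0"
    "\<And>k t. t \<ge> 0 \<Longrightarrow> \<bar>u k t\<bar> \<le> a k * exp (- (c * t))"
    by (rule wiener_leE[OF u]) blast
  have b: "\<bar>u k t\<bar> \<le> a k" if "t \<ge> 0" for k t
  proof -
    have "a k * exp (- (c * t)) \<le> a k * 1" using a(2) c that by (intro mult_left_mono) auto
    with a(3)[OF that, of k] show ?thesis by simp
  qed
  have bt: "\<bar>u k t * y\<bar> \<le> a k" if "t \<ge> 0" "\<bar>y\<bar> \<le> 1" for k t y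
    using mult_mono[OF b[OF that(1), of k] that(2)] a(2)[of k] by (simp add: abs_mult)
  have uc: "continuous_on ({0..} \<times> UNIV) (\<lambda>z. u k (fst z))" for k
    by (rule continuous_on_compose2[OF wiener_le_continuous[OF u]]) (auto intro!: continuous_intros)
  show "continuous_on ({0..} \<times> UNIV) (\<lambda>z. sin_series (\<lambda>k. u k (fst z)) (snd z))"
    unfolding sin_series_def
    by (rule continuous_on_infsum[OF _ a(1)]) (auto intro!: bt continuous_intros uc)
  show "continuous_on ({0..} \<times> UNIV) (\<lambda>z. cos_series (\<lambda>k. u k (fst z)) (snd z))"
    unfolding cos_series_def
    by (rule continuous_on_infsum[OF _ a(1)]) (auto intro!: bt continuous_intros uc)
qed

lemma trig_series_periodic: "sin_series a (x + 2 * pi) = sin_series a x" "cos_series a (x + 2 * pi) = cos_series a x"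
proof -
  have "sin (real_of_int k * (x + 2 * pi)) = sin (real_of_int k * x)"
    "cos (real_of_int k * (x + 2 * pi)) = cos (real_of_int k * x)" for k
    using sin_int_2pin[of k] cos_int_2pin[of k]
    by (simp_all add: distrib_left sin_add cos_add mult_ac)
  then show "sin_series a (x + 2 * pi) = sin_series a x" "cos_series a (x + 2 * pi) = cos_series a x"
    unfolding sin_series_def cos_series_def by simp_all
qed

lemma sin_series_minus: "sin_series a (- x) = - sin_series a x"
  unfolding sin_series_def by (simp add: infsum_uminus)

lemma sin_series_has_derivative:
  fixes a :: "int \<Rightarrow> real"
  assumes a: "(\<lambda>k. \<bar>a k\<bar>) summable_on UNIV" and b: "(\<lambda>k. \<bar>real_of_int k * a k\<bar>) summable_on UNIV"
  shows "(sin_series a has_real_derivative cos_series (\<lambda>k. real_of_int k * a k) x) (at x)"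
proof -
  have "((\<lambda>x. \<Sum>\<^sub>\<infinity>k. a k * sin (real_of_int k * x)) has_real_derivative
      (\<Sum>\<^sub>\<infinity>k. real_of_int k * a k * cos (real_of_int k * x))) (at x within UNIV)"
    by (rule has_real_derivative_infsum[OF _ _ _ b])
      (auto intro!: derivative_eq_intros trig_series_summable a simp: abs_mult mult_left_le)
  then show ?thesis unfolding sin_series_def[abs_def] cos_series_def by simp
qed

section \<open>Maximum principle\<close>

lemma periodic_reduce:
  fixes g :: "real \<Rightarrow> 'a"
  assumes "\<And>x. g (x + 2 * pi) = g x"
  obtains y' where "y' \<in> {0..2 * pi}" "g y = g y'"
proof -
  have nat: "g (x + real n * (2 * pi)) = g x" for x n
  proof (induction n)
    case (Suc n)
    then show ?case using assms[of "x + real n * (2 * pi)"] by (simp add: algebra_simps)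
  qed simp
  have int: "g (x + real_of_int n * (2 * pi)) = g x" for x n
  proof (cases "n \<ge> 0")
    case True
    then show ?thesis using nat[of x "nat n"] by simp
  next
    case False
    then show ?thesis using nat[of "x + real_of_int n * (2 * pi)" "nat (- n)"] by simp
  qed
  define n where "n = \<lfloor>y / (2 * pi)\<rfloor>"
  have "real_of_int n \<le> y / (2 * pi)" "y / (2 * pi) < real_of_int n + 1" unfolding n_def by linarith+
  then have "real_of_int n * (2 * pi) \<le> y" "y \<le> (real_of_int n + 1) * (2 * pi)"
    by (simp_all add: field_simps)
  then have "y - real_of_int n * (2 * pi) \<in> {0..2 * pi}" by (simp add: algebra_simps)
  moreover have "g y = g (y - real_of_int n * (2 * pi))"
    using int[of "y - real_of_int n * (2 * pi)" n] by simp
  ultimately show ?thesis by (rule that)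
qed

text \<open>The maximum is taken over space and time at once, which avoids differentiating the
  spatial maximum in t. If it exceeded M it would be positive and attained at a time s > 0, so the
  time derivative there would be negative; slightly earlier values would then be larger, a
  contradiction. Periodicity turns the maximum over one period into one over the line, as
  \<open>neg\<close> demands.\<close>

lemma maximum_principle:
  fixes w w' :: "real \<Rightarrow> real \<Rightarrow> real"
  assumes cont: "continuous_on ({0..} \<times> UNIV) (\<lambda>z. w (fst z) (snd z))"
    and per: "\<And>t x. t \<ge> 0 \<Longrightarrow> w t (x + 2 * pi) = w t x"
    and der: "\<And>t x. t \<ge> 0 \<Longrightarrow> ((\<lambda>s. w s x) has_real_derivative w' t x) (at t within {0..})"
    and neg: "\<And>t x. t \<ge> 0 \<Longrightarrow> (\<And>y. w t y \<le> w t x) \<Longrightarrow> w t x > 0 \<Longrightarrow> w' t x < 0"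
    and init: "\<And>x. w 0 x \<le> M" "M \<ge> 0" and t: "t \<ge> 0"
  shows "w t x \<le> M"
proof (rule ccontr)
  assume "\<not> w t x \<le> M"
  obtain x1 where x1: "x1 \<in> {0..2 * pi}" "w t x = w t x1"
    by (rule periodic_reduce[of "w t" x]) (use per t in auto)
  let ?K = "{0..t} \<times> {0..2 * pi}"
  have "continuous_on ?K (\<lambda>z. w (fst z) (snd z))"
    by (rule continuous_on_subset[OF cont]) auto
  moreover have "compact ?K" by (intro compact_Times compact_Icc)
  moreover have "(t, x1) \<in> ?K" using x1 t by simp
  ultimately obtain z where z: "z \<in> ?K" "\<And>y. y \<in> ?K \<Longrightarrow> w (fst y) (snd y) \<le> w (fst z) (snd z)"
    using continuous_attains_sup[of ?K "\<lambda>z. w (fst z) (snd z)"] by blast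
  obtain s y where sy: "z = (s, y)" by force
  have s: "0 \<le> s" "s \<le> t" using z(1) sy by auto
  have big: "w s y > M" using z(2)[OF \<open>(t, x1) \<in> ?K\<close>] \<open>\<not> w t x \<le> M\<close> x1 sy by simp
  have "w s v \<le> w s y" for v
  proof -
    obtain v' where "v' \<in> {0..2 * pi}" "w s v = w s v'"
      by (rule periodic_reduce[of "w s" v]) (use per s in auto)
    then show ?thesis using z(2)[of "(s, v')"] s sy by simp
  qed
  then have "w' s y < 0" using neg[OF s(1), of y] big init(2) by simp
  from has_real_derivative_neg_dec_left[OF der[OF s(1), of y] this]
  obtain d where d: "d > 0" "\<And>h. h > 0 \<Longrightarrow> s - h \<in> {0..} \<Longrightarrow> h < d \<Longrightarrow> w s y < w (s - h) y" by blast
  have "s > 0" using big init(1)[of y] s by (cases "s = 0") auto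
  define h where "h = min s (d / 2)"
  have h: "h > 0" "h \<le> s" "h < d" using \<open>s > 0\<close> d(1) unfolding h_def by auto
  then have "w s y < w (s - h) y" by (intro d(2)) auto
  moreover have "w (s - h) y \<le> w s y" using z(2)[of "(s - h, y)"] h s z(1) sy by auto
  ultimately show False by simp
qed

section \<open>The solution\<close>

text \<open>Collects the output of \<open>wiener_fixed_point\<close>. The radius R is tied to C
  alone; its relation to l enters only in the final H^1 bound.\<close>

locale wiener_solution =
  fixes l C m R :: real and \<phi> :: "int \<Rightarrow> real" and u p q :: "int \<Rightarrow> real \<Rightarrow> real"
  assumes l: "l > 0" and C_eq: "C = l\<^sup>2 / (1 + l\<^sup>2)" and m_eq: "m = 1 + l\<^sup>2" and R: "R \<le> C / 16"
    and u: "wiener_le C u R" and p: "wiener_le C p R" and q: "wiener_le C q R"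
    and u_eq: "\<And>k t. t \<ge> 0 \<Longrightarrow> u k t = mapU C \<phi> u p q k t"
    and p_eq: "\<And>k t. t \<ge> 0 \<Longrightarrow> p k t = mapP u p k t"
    and q_eq: "\<And>k t. t \<ge> 0 \<Longrightarrow> q k t = mapQ m u q k t"
    and u_odd: "\<And>k t. t \<ge> 0 \<Longrightarrow> u (- k) t = - u k t"
    and p_even: "\<And>k t. t \<ge> 0 \<Longrightarrow> p (- k) t = p k t"
    and q_even: "\<And>k t. t \<ge> 0 \<Longrightarrow> q (- k) t = q k t"
    and \<phi>_odd: "\<And>k. \<phi> (- k) = - \<phi> k"
begin

section \<open>From coefficient arrays to functions of x and t\<close>

definition "f t = sin_series (\<lambda>k. inv_Lambda u k t)"
definition "fx t = cos_series (\<lambda>k. hilbert u k t)"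
definition "Lf t = sin_series (\<lambda>k. u k t)"
definition "P t = cos_series (\<lambda>k. p k t)"
definition "Q t = cos_series (\<lambda>k. q k t)"

lemma m_ge: "m \<ge> 1" and C_pos: "C > 0" and C_less: "C < 1" and C_m: "C = 1 - 1 / m"
proof -
  have "1 + l\<^sup>2 > 0" by (smt (verit) zero_le_power2)
  then show "m \<ge> 1" "C > 0" "C < 1" "C = 1 - 1 / m"
    using l by (auto simp: C_eq m_eq field_simps)
qed

lemma R_bounds: "R \<ge> 0" "R \<le> 1 / 16"
  using wiener_le_nonneg[OF u] R C_less by auto

lemma u_0: "t \<ge> 0 \<Longrightarrow> u 0 t = 0"
  using u_odd[of t 0] by simp

lemma inv_Lambda_odd: "t \<ge> 0 \<Longrightarrow> inv_Lambda u (- k) t = - inv_Lambda u k t"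
  by (simp add: inv_Lambda_def u_odd)

lemma hilbert_even: "t \<ge> 0 \<Longrightarrow> hilbert u (- k) t = hilbert u k t"
  by (simp add: hilbert_def u_odd sgn_minus)

lemma Lambda_inv_Lambda: "t \<ge> 0 \<Longrightarrow> \<bar>real_of_int k\<bar> * inv_Lambda u k t = u k t"
  by (cases "k = 0") (auto simp: inv_Lambda_def u_0)

lemmas hilbert_le = wiener_le_hilbert[OF u] and inv_Lambda_le = wiener_le_inv_Lambda[OF u]

lemma wiener_series_bound:
  assumes w: "wiener_le C w R" and t: "t \<ge> 0"
  shows "\<bar>cos_series (\<lambda>k. w k t) x\<bar> \<le> R" "\<bar>sin_series (\<lambda>k. w k t) x\<bar> \<le> R"
proof -
  have "R * exp (- (C * t)) \<le> R * 1" using R_bounds C_pos t by (intro mult_left_mono) auto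
  then show "\<bar>cos_series (\<lambda>k. w k t) x\<bar> \<le> R" "\<bar>sin_series (\<lambda>k. w k t) x\<bar> \<le> R"
    using trig_series_bound[OF wiener_le_summable(1)[OF w t], of x] wiener_le_summable(2)[OF w t] by auto
qed

lemma pointwise_bounds:
  assumes "t \<ge> 0"
  shows "\<bar>f t x\<bar> \<le> R" "\<bar>Lf t x\<bar> \<le> R" "\<bar>P t x\<bar> \<le> R" "\<bar>Q t x\<bar> \<le> R"
  unfolding f_def Lf_def P_def Q_def using assms by (auto intro: wiener_series_bound inv_Lambda_le u p q)

lemma P_eq: assumes t: "t \<ge> 0" shows "P t x = (fx t x)\<^sup>2 * (1 - P t x)"
proof -
  note hh = wiener_le_conv[OF hilbert_le hilbert_le] and hhp = wiener_le_conv[OF wiener_le_conv[OF hilbert_le hilbert_le] p]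
  have hh_even: "conv (hilbert u) (hilbert u) (- k) t = conv (hilbert u) (hilbert u) k t" for k
    using conv_uminus[of "hilbert u" t 1 "hilbert u" 1] hilbert_even[OF t] by simp
  have "P t x = cos_series (\<lambda>k. 1 * conv (hilbert u) (hilbert u) k t + (-1) * conv (conv (hilbert u) (hilbert u)) p k t) x"
    unfolding P_def by (simp add: p_eq[OF t] mapP_def)
  also have "\<dots> = 1 * cos_series (\<lambda>k. conv (hilbert u) (hilbert u) k t) x + (-1) * cos_series (\<lambda>k. conv (conv (hilbert u) (hilbert u)) p k t) x"
    by (intro trig_series_lincomb wiener_le_summable(1)[OF hh t] wiener_le_summable(1)[OF hhp t])
  also have "cos_series (\<lambda>k. conv (conv (hilbert u) (hilbert u)) p k t) x = cos_series (\<lambda>k. conv (hilbert u) (hilbert u) k t) x * P t x"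
    unfolding P_def by (rule cos_series_conv_even[OF hh p t hh_even p_even[OF t]])
  also have "cos_series (\<lambda>k. conv (hilbert u) (hilbert u) k t) x = fx t x * fx t x"
    unfolding fx_def by (rule cos_series_conv_even[OF hilbert_le hilbert_le t hilbert_even[OF t] hilbert_even[OF t]])
  finally show ?thesis by (rule trans) (simp add: power2_eq_square algebra_simps)
qed

lemma Q_eq: assumes t: "t \<ge> 0" shows "Q t x = (f t x)\<^sup>2 / m\<^sup>2 + (f t x)\<^sup>2 * Q t x / m"
proof -
  note jj = wiener_le_conv[OF inv_Lambda_le inv_Lambda_le] and jjq = wiener_le_conv[OF wiener_le_conv[OF inv_Lambda_le inv_Lambda_le] q]
  have jj_even: "conv (inv_Lambda u) (inv_Lambda u) (- k) t = conv (inv_Lambda u) (inv_Lambda u) k t" for k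
    using conv_uminus[of "inv_Lambda u" t "-1" "inv_Lambda u" "-1"] inv_Lambda_odd[OF t] by simp
  have "Q t x = cos_series (\<lambda>k. - (1 / m\<^sup>2) * conv (inv_Lambda u) (inv_Lambda u) k t + - (1 / m) * conv (conv (inv_Lambda u) (inv_Lambda u)) q k t) x"
    unfolding Q_def by (subst q_eq[OF t]) (simp add: mapQ_def)
  also have "\<dots> = - (1 / m\<^sup>2) * cos_series (\<lambda>k. conv (inv_Lambda u) (inv_Lambda u) k t) x + - (1 / m) * cos_series (\<lambda>k. conv (conv (inv_Lambda u) (inv_Lambda u)) q k t) x"
    by (intro trig_series_lincomb wiener_le_summable(1)[OF jj t] wiener_le_summable(1)[OF jjq t])
  also have "cos_series (\<lambda>k. conv (conv (inv_Lambda u) (inv_Lambda u)) q k t) x = cos_series (\<lambda>k. conv (inv_Lambda u) (inv_Lambda u) k t) x * Q t x"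
    unfolding Q_def by (rule cos_series_conv_even[OF jj q t jj_even q_even[OF t]])
  also have "cos_series (\<lambda>k. conv (inv_Lambda u) (inv_Lambda u) k t) x = - (f t x * f t x)"
    unfolding f_def by (rule cos_series_conv_odd[OF inv_Lambda_le inv_Lambda_le t inv_Lambda_odd[OF t] inv_Lambda_odd[OF t]])
  finally show ?thesis by (rule trans) (simp add: power2_eq_square algebra_simps)
qed

lemma f_has_derivative:
  assumes t: "t \<ge> 0"
  shows "(f t has_real_derivative fx t x) (at x)"
proof -
  have eq: "real_of_int k * inv_Lambda u k t = hilbert u k t" for k
    by (cases "k = 0") (auto simp: inv_Lambda_def hilbert_def u_0[OF t] sgn_if field_simps)
  have "(sin_series (\<lambda>k. inv_Lambda u k t) has_real_derivative cos_series (\<lambda>k. real_of_int k * inv_Lambda u k t) x) (at x)"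
    by (rule sin_series_has_derivative)
      (use wiener_le_summable(1)[OF inv_Lambda_le t] wiener_le_summable(1)[OF hilbert_le t] in \<open>auto simp: eq\<close>)
  then show ?thesis unfolding f_def fx_def eq .
qed

lemma deriv_f: "t \<ge> 0 \<Longrightarrow> deriv (f t) x = fx t x"
  by (intro DERIV_imp_deriv f_has_derivative)

lemma denominator_ge: assumes "t \<ge> 0" shows "m - (f t x)\<^sup>2 \<ge> 1 / 2"
proof -
  have "\<bar>f t x\<bar> \<le> 1 / 16" using pointwise_bounds(1)[OF assms, of x] R_bounds by linarith
  then have "(f t x)\<^sup>2 \<le> (1 / 16)\<^sup>2" using abs_le_square_iff[of "f t x" "1 / 16"] by simp
  then show ?thesis using m_ge by (simp add: power2_eq_square)
qed

text \<open>The relations \<open>P_eq\<close> and \<open>Q_eq\<close> are linear in P and Q, with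
  the nonzero factors 1 + fx^2 and m - f^2. They therefore force the auxiliary unknowns to be the
  intended rational functions of fx and f, and 1 - 1/m = C supplies the constant.\<close>

lemma coef_eq: assumes t: "t \<ge> 0" shows "coef l (f t) x = P t x + Q t x - C"
proof -
  have a: "1 + (fx t x)\<^sup>2 > 0" by (smt (verit) zero_le_power2)
  have P: "P t x = 1 - 1 / (1 + (fx t x)\<^sup>2)" using P_eq[OF t, of x] a by (simp add: field_simps)
  define F where "F = (f t x)\<^sup>2"
  define D where "D = m - F"
  have D: "D > 0" "F = m - D" using denominator_ge[OF t, of x] unfolding F_def D_def by auto
  have m: "m > 0" using m_ge by simp
  have "Q t x * m\<^sup>2 = F + F * Q t x * m"
    using Q_eq[OF t, of x] m unfolding F_def[symmetric] by (simp add: field_simps power2_eq_square)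
  then have "(Q t x * m * D) = F" unfolding D(2) power2_eq_square
    by (simp add: algebra_simps)
  then have "Q t x = F / (m * D)" using m D(1) by (simp add: field_simps)
  also have "\<dots> = 1 / D - 1 / m" using m D(1) unfolding D(2) by (simp add: field_simps)
  finally have Q: "Q t x = 1 / (m - (f t x)\<^sup>2) - 1 / m" unfolding D_def F_def .
  show ?thesis
    unfolding coef_def deriv_f[OF t] P Q C_m m_eq[symmetric] by simp
qed

text \<open>|P| + |Q| <= 2R <= C/8 cannot change the sign of -C. This is the parabolicity behind
  both maximum principles.\<close>

lemma coef_le: assumes t: "t \<ge> 0" shows "coef l (f t) x \<le> - (C / 2)"
  using pointwise_bounds(3,4)[OF t, of x] R C_pos unfolding coef_eq[OF t] by linarith

section \<open>Classical differentiability in time\<close>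

definition "ft t x = coef l (f t) x * Lf t x"

abbreviation "N \<equiv> conv (\<lambda>k t. p k t + q k t) u"

lemma N_le: "wiener_le C N ((R + R) * R)"
  by (rule wiener_le_mono[OF wiener_le_conv[OF wiener_le_add[OF p q] u]]) (use C_pos in auto)

lemma N_odd: "t \<ge> 0 \<Longrightarrow> N (- k) t = - N k t"
  using conv_uminus[of "\<lambda>k t. p k t + q k t" t 1 u "-1"] by (simp add: p_even q_even u_odd)

lemma ft_eq: assumes t: "t \<ge> 0" shows "ft t x = sin_series (\<lambda>k. - C * u k t + 1 * N k t) x"
proof -
  have "cos_series (\<lambda>k. p k t + q k t) x = P t x + Q t x"
    using trig_series_lincomb(1)[OF wiener_le_summable(1)[OF p t] wiener_le_summable(1)[OF q t], of 1 1]
    by (simp add: P_def Q_def)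
  then have "sin_series (\<lambda>k. N k t) x = (P t x + Q t x) * Lf t x"
    using sin_series_conv[OF wiener_le_add[OF p q] u t, of x] p_even[OF t] q_even[OF t] u_odd[OF t]
    by (simp add: Lf_def)
  then show ?thesis
    unfolding trig_series_lincomb(2)[OF wiener_le_summable(1)[OF u t] wiener_le_summable(1)[OF N_le t]]
    by (simp add: ft_def coef_eq[OF t] Lf_def algebra_simps)
qed

text \<open>Variation of constants: after division by |k| the fixed-point equation is exp(-C|k|t)
  times the initial coefficient plus an integral. The mode k = 0 is separate because
  \<open>inv_Lambda\<close> sets it to 0; there the right-hand side vanishes by oddness.\<close>

lemma coefficient_has_derivative:
  assumes t: "t \<ge> 0"
  shows "((\<lambda>s. inv_Lambda u k s) has_real_derivative (- C * u k t + N k t)) (at t within {0..})"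
proof (cases "k = 0")
  case True
  have "N 0 t = 0" using N_odd[OF t, of 0] by simp
  then show ?thesis using True u_0[OF t] by (simp add: inv_Lambda_def)
next
  case False
  define n where "n = real_of_int \<bar>k\<bar>"
  have n: "n > 0" using False unfolding n_def by simp
  define I where "I t = integral {0..t} (\<lambda>s. exp (C * n * s) * N k s)" for t
  have eq: "inv_Lambda u k s = exp (- (C * n * s)) * (\<phi> k + I s)" if "s \<ge> 0" for s
    unfolding inv_Lambda_def u_eq[OF that] mapU_def lin_part_def duhamel_def n_def[symmetric] I_def[symmetric]
    using n by (simp add: field_simps)
  have I: "(I has_real_derivative exp (C * n * t) * N k t) (at t within {0..})"
    unfolding I_def[abs_def]
    by (rule integral_has_real_derivative_atLeast[OF _ t])
      (intro continuous_intros wiener_le_continuous[OF N_le])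
  have "((\<lambda>s. exp (- (C * n * s)) * (\<phi> k + I s)) has_real_derivative
      (- (C * n) * exp (- (C * n * t)) * (\<phi> k + I t) + exp (- (C * n * t)) * (exp (C * n * t) * N k t))) (at t within {0..})"
    by (auto intro!: derivative_eq_intros I)
  moreover have "- (C * n) * exp (- (C * n * t)) * (\<phi> k + I t) = - C * u k t"
  proof -
    have "u k t = n * inv_Lambda u k t" using n unfolding inv_Lambda_def n_def by simp
    then show ?thesis unfolding eq[OF t] by simp
  qed
  moreover have "exp (- (C * n * t)) * (exp (C * n * t) * N k t) = N k t"
    by (simp add: exp_minus)
  ultimately have "((\<lambda>s. exp (- (C * n * s)) * (\<phi> k + I s)) has_real_derivative (- C * u k t + N k t)) (at t within {0..})"
    by (simp only:)
  then show ?thesis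
    by (rule has_field_derivative_transform_within[OF _ zero_less_one]) (use eq t in auto)
qed

lemma ft_wiener: "\<exists>M. wiener_le C (\<lambda>k t. - C * u k t + 1 * N k t) M"
  using wiener_le_lincomb[OF u N_le] by blast

lemma f_time_derivative:
  assumes t: "t \<ge> 0"
  shows "((\<lambda>s. f s x) has_real_derivative ft t x) (at t within {0..})"
proof -
  obtain M where M: "wiener_le C (\<lambda>k t. - C * u k t + 1 * N k t) M" using ft_wiener by blast
  obtain a where a: "a summable_on UNIV" "\<And>k. a k \<ge> 0"
    "\<And>k t. t \<ge> 0 \<Longrightarrow> \<bar>- C * u k t + 1 * N k t\<bar> \<le> a k * exp (- (C * t))"
    by (rule wiener_leE[OF M]) blast
  have b: "\<bar>(- C * u k t + N k t) * sin (real_of_int k * x)\<bar> \<le> a k" if "t \<ge> 0" for k t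
  proof -
    have "\<bar>- C * u k t + N k t\<bar> * \<bar>sin (real_of_int k * x)\<bar> \<le> (a k * exp (- (C * t))) * 1"
      using a(3)[OF that, of k] a(2)[of k] by (intro mult_mono) auto
    also have "\<dots> \<le> a k * 1 * 1" using a(2)[of k] C_pos that by (intro mult_right_mono mult_left_mono) auto
    finally show ?thesis by (simp add: abs_mult)
  qed
  have "((\<lambda>s. \<Sum>\<^sub>\<infinity>k. inv_Lambda u k s * sin (real_of_int k * x)) has_real_derivative
      (\<Sum>\<^sub>\<infinity>k. (- C * u k t + N k t) * sin (real_of_int k * x))) (at t within {0..})"
  proof (rule has_real_derivative_infsum[OF _ _ _ a(1)])
    show "((\<lambda>s. inv_Lambda u k s * sin (real_of_int k * x)) has_real_derivative
      (- C * u k t + N k t) * sin (real_of_int k * x)) (at t within {0..})" if "t \<in> {0..}" for k t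
      using that by (intro DERIV_cmult_right coefficient_has_derivative) auto
    show "(\<lambda>k. inv_Lambda u k t * sin (real_of_int k * x)) summable_on UNIV" if "t \<in> {0..}" for t
      using that by (intro trig_series_summable wiener_le_summable(1)[OF inv_Lambda_le]) auto
  qed (use t b in auto)
  then show ?thesis unfolding ft_eq[OF t] by (simp add: f_def[abs_def] sin_series_def)
qed

lemma f_0: "f 0 = sin_series \<phi>"
proof -
  \<comment> \<open>Needed because \<open>inv_Lambda\<close> would erase a mode at k = 0.\<close>
  have "\<phi> 0 = 0" using \<phi>_odd[of 0] by simp
  then have "inv_Lambda u k 0 = \<phi> k" for k
    by (cases "k = 0") (auto simp: inv_Lambda_def u_eq mapU_def lin_part_def duhamel_def)
  then show ?thesis unfolding f_def by simp
qed

lemma f_cont: "continuous_on ({0..} \<times> UNIV) (\<lambda>z. f (fst z) (snd z))"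
  unfolding f_def by (rule trig_series_joint_continuous[OF inv_Lambda_le]) (use C_pos in simp)

lemma ft_cont: "continuous_on ({0..} \<times> UNIV) (\<lambda>z. ft (fst z) (snd z))"
proof -
  obtain M where M: "wiener_le C (\<lambda>k t. - C * u k t + 1 * N k t) M" using ft_wiener by blast
  have "continuous_on ({0..} \<times> UNIV) (\<lambda>z. sin_series (\<lambda>k. - C * u k (fst z) + 1 * N k (fst z)) (snd z))"
    by (rule trig_series_joint_continuous[OF M]) (use C_pos in simp)
  then show ?thesis by (rule continuous_on_eq) (auto simp: ft_eq)
qed

lemma f_periodic: "f t (x + 2 * pi) = f t x"
  unfolding f_def by (rule trig_series_periodic)

section \<open>Maximum principles for f and for its differences\<close>

lemma difference_Lambda:
  assumes t: "t \<ge> 0" and max: "\<And>y. f t (y + h) - f t y \<le> f t (x + h) - f t x"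
  shows "(f t (x + h) - f t x) / 2 \<le> Lf t (x + h) - Lf t x"
proof -
  define c where "c k = - \<i> * of_real (inv_Lambda u k t) * (cis (real_of_int k * h) - 1)" for k
  have fourier_series_shift: "fourier_series (\<lambda>k. - \<i> * of_real (a k) * (cis (real_of_int k * h) - 1)) y
      = of_real (sin_series a (y + h) - sin_series a y)"
    if s: "(\<lambda>k. \<bar>a k\<bar>) summable_on UNIV" and odd: "\<And>k. a (- k) = - a k" for a :: "int \<Rightarrow> real" and y
  proof -
    have s': "(\<lambda>k. norm (complex_of_real (a k))) summable_on UNIV" using s by simp
    have "fourier_series (\<lambda>k. - \<i> * of_real (a k) * (cis (real_of_int k * h) - 1)) y
        = (\<Sum>\<^sub>\<infinity>k. - \<i> * (of_real (a k) * cis (real_of_int k * (y + h)) - of_real (a k) * cis (real_of_int k * y)))"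
      unfolding fourier_series_def by (intro infsum_cong) (simp add: algebra_simps cis_mult[symmetric])
    also have "\<dots> = - \<i> * (fourier_series (\<lambda>k. of_real (a k)) (y + h) - fourier_series (\<lambda>k. of_real (a k)) y)"
      unfolding infsum_cmult_right' fourier_series_def by (simp only: infsum_diff[OF fourier_series_summable(2)[OF s'] fourier_series_summable(2)[OF s']])
    also have "\<dots> = of_real (sin_series a (y + h) - sin_series a y)"
      unfolding fourier_series_odd[OF s odd] by (simp add: complex_eq_iff)
    finally show ?thesis .
  qed
  show ?thesis
  proof (rule Lambda_ge_at_maximum[where c = c and w = "\<lambda>y. f t (y + h) - f t y"])
    show "c 0 = 0" by (simp add: c_def)
    show "fourier_series c y = of_real (f t (y + h) - f t y)" for y
      unfolding c_def[abs_def] f_def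
      by (rule fourier_series_shift[OF wiener_le_summable(1)[OF inv_Lambda_le t] inv_Lambda_odd[OF t]])
    have "of_real \<bar>real_of_int k\<bar> * c k = - \<i> * of_real (u k t) * (cis (real_of_int k * h) - 1)" for k
      unfolding c_def Lambda_inv_Lambda[OF t, symmetric] by (simp add: mult_ac)
    then show "fourier_series (\<lambda>k. of_real \<bar>real_of_int k\<bar> * c k) x = of_real (Lf t (x + h) - Lf t x)"
      unfolding Lf_def using fourier_series_shift[OF wiener_le_summable(1)[OF u t] u_odd[OF t], of x] by (simp only:)
    show "(\<lambda>k. \<bar>real_of_int k\<bar> * cmod (c k)) summable_on UNIV"
    proof (rule summable_on_comparison_test[OF summable_on_cmult_right[OF wiener_le_summable(1)[OF u t], of 2]])
      fix k
      have "cmod (cis (real_of_int k * h) - 1) \<le> 2"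
        using norm_triangle_ineq4[of "cis (real_of_int k * h)" 1] by simp
      then have "\<bar>u k t\<bar> * cmod (cis (real_of_int k * h) - 1) \<le> \<bar>u k t\<bar> * 2" by (intro mult_left_mono) auto
      moreover have "\<bar>real_of_int k\<bar> * cmod (c k) = \<bar>u k t\<bar> * cmod (cis (real_of_int k * h) - 1)"
        unfolding c_def Lambda_inv_Lambda[OF t, symmetric] by (simp add: norm_mult abs_mult)
      ultimately show "\<bar>real_of_int k\<bar> * cmod (c k) \<le> 2 * \<bar>u k t\<bar>" by simp
    qed auto
    show "f t (y + h) - f t y \<le> f t (x + h) - f t x" for y by (rule max)
  qed
qed

lemma f_Lambda:
  assumes t: "t \<ge> 0" and max: "\<And>y. f t y \<le> f t x"
  shows "f t x / 2 \<le> Lf t x"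
proof (rule Lambda_ge_at_maximum[where c = "\<lambda>k. - \<i> * of_real (inv_Lambda u k t)" and w = "f t"])
  have s: "fourier_series (\<lambda>k. - \<i> * of_real (a k)) y = of_real (sin_series a y)"
    if s: "(\<lambda>k. \<bar>a k\<bar>) summable_on UNIV" and odd: "\<And>k. a (- k) = - a k" for a :: "int \<Rightarrow> real" and y
  proof -
    have "fourier_series (\<lambda>k. - \<i> * of_real (a k)) y = - \<i> * fourier_series (\<lambda>k. of_real (a k)) y"
      unfolding fourier_series_def mult.assoc infsum_cmult_right' ..
    then show ?thesis unfolding fourier_series_odd[OF s odd] by (simp add: complex_eq_iff)
  qed
  show "- \<i> * complex_of_real (inv_Lambda u 0 t) = 0" by (simp add: inv_Lambda_def)
  show "fourier_series (\<lambda>k. - \<i> * of_real (inv_Lambda u k t)) y = of_real (f t y)" for y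
    unfolding f_def by (rule s[OF wiener_le_summable(1)[OF inv_Lambda_le t] inv_Lambda_odd[OF t]])
  have "of_real \<bar>real_of_int k\<bar> * (- \<i> * of_real (inv_Lambda u k t)) = - \<i> * of_real (u k t)" for k
    unfolding Lambda_inv_Lambda[OF t, symmetric] by (simp add: mult_ac)
  then show "fourier_series (\<lambda>k. of_real \<bar>real_of_int k\<bar> * (- \<i> * of_real (inv_Lambda u k t))) x = of_real (Lf t x)"
    unfolding Lf_def using s[OF wiener_le_summable(1)[OF u t] u_odd[OF t], of x] by (simp only:)
  have "\<bar>real_of_int k\<bar> * cmod (- \<i> * complex_of_real (inv_Lambda u k t)) = \<bar>u k t\<bar>" for k
    unfolding Lambda_inv_Lambda[OF t, symmetric] by (simp add: norm_mult abs_mult)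
  then show "(\<lambda>k. \<bar>real_of_int k\<bar> * cmod (- \<i> * complex_of_real (inv_Lambda u k t))) summable_on UNIV"
    using wiener_le_summable(1)[OF u t] by simp
qed (rule max)

lemma f_max_principle:
  assumes "\<And>x. f 0 x \<le> M" "M \<ge> 0" "t \<ge> 0"
  shows "f t x \<le> M"
proof (rule maximum_principle[where w = f and w' = ft, OF f_cont f_periodic f_time_derivative _ assms])
  fix t x assume t: "t \<ge> 0" and max: "\<And>y. f t y \<le> f t x" and pos: "f t x > 0"
  have "Lf t x > 0" using f_Lambda[OF t max] pos by linarith
  moreover have "coef l (f t) x < 0" using coef_le[OF t, of x] C_pos by linarith
  ultimately show "ft t x < 0" unfolding ft_def by (rule mult_neg_pos[rotated])
qed

lemma difference_max_principle:
  assumes init: "\<And>x. f 0 (x + h) - f 0 x \<le> M" "M \<ge> 0" and t: "t \<ge> 0"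
  shows "f t (x + h) - f t x \<le> M"
proof (rule maximum_principle[where w = "\<lambda>t x. f t (x + h) - f t x" and w' = "\<lambda>t x. ft t (x + h) - ft t x",
      OF _ _ _ _ init t])
  have "continuous_on ({0..} \<times> UNIV) (\<lambda>z. f (fst (fst z, snd z + h)) (snd (fst z, snd z + h)))"
    by (rule continuous_on_compose2[OF f_cont]) (auto intro!: continuous_intros)
  then show "continuous_on ({0..} \<times> UNIV) (\<lambda>z. f (fst z) (snd z + h) - f (fst z) (snd z))"
    by (intro continuous_on_diff f_cont) simp
  show "f t (x + 2 * pi + h) - f t (x + 2 * pi) = f t (x + h) - f t x" for t x
    using f_periodic[of t x] f_periodic[of t "x + h"] by (simp add: add_ac)
  show "((\<lambda>s. f s (x + h) - f s x) has_real_derivative ft t (x + h) - ft t x) (at t within {0..})" if "t \<ge> 0" for t x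
    by (intro derivative_intros f_time_derivative that)
  fix t x assume t: "t \<ge> 0" and max: "\<And>y. f t (y + h) - f t y \<le> f t (x + h) - f t x" and pos: "f t (x + h) - f t x > 0"
  define W where "W = f t (x + h) - f t x"
  have "((\<lambda>y. f t (y + h) - f t y) has_real_derivative fx t (x + h) - fx t x) (at x)"
    using f_has_derivative[OF t, of "x + h"]
    by (intro derivative_intros f_has_derivative[OF t]) (simp add: DERIV_shift)
  then have fx: "fx t (x + h) = fx t x"
    using DERIV_local_max[of "\<lambda>y. f t (y + h) - f t y" _ x 1] max by fastforce
  define D where "D y = m - (f t y)\<^sup>2" for y
  have D: "D y \<ge> 1 / 2" for y using denominator_ge[OF t] unfolding D_def .
  have "coef l (f t) (x + h) - coef l (f t) x = 1 / D (x + h) - 1 / D x"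
    unfolding coef_def deriv_f[OF t] fx D_def m_eq by simp
  also have "\<dots> = (D x - D (x + h)) / (D (x + h) * D x)"
    using D[of x] D[of "x + h"] by (subst diff_frac_eq) auto
  also have "D x - D (x + h) = W * (f t (x + h) + f t x)"
    unfolding D_def W_def by (simp add: power2_eq_square algebra_simps)
  finally have cd: "coef l (f t) (x + h) - coef l (f t) x = W * ((f t (x + h) + f t x) / (D (x + h) * D x))" by simp
  \<comment> \<open>The first product is the damping of the difference. The second carries only the
    change of the coefficient, which is proportional to W itself and multiplied by the small factor
    Lambda f.\<close>
  have "ft t (x + h) - ft t x = coef l (f t) (x + h) * (Lf t (x + h) - Lf t x) + (coef l (f t) (x + h) - coef l (f t) x) * Lf t x"
    unfolding ft_def by (simp add: algebra_simps)
  also have "\<dots> \<le> - (C / 2) * (W / 2) + W * (8 * R * R)"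
  proof (rule add_mono)
    have "W / 2 \<le> Lf t (x + h) - Lf t x" unfolding W_def by (rule difference_Lambda[OF t max])
    moreover have "coef l (f t) (x + h) \<le> - (C / 2)" by (rule coef_le[OF t])
    ultimately have "(C / 2) * (W / 2) \<le> (- coef l (f t) (x + h)) * (Lf t (x + h) - Lf t x)"
      using C_pos pos unfolding W_def[symmetric] by (intro mult_mono) auto
    then show "coef l (f t) (x + h) * (Lf t (x + h) - Lf t x) \<le> - (C / 2) * (W / 2)" by simp
    \<comment> \<open>The constant 8 in 8R^2: the sum of the two values of f is at most 2R, dividing
      by a product of denominators of size at least 1/4 gives 8R, and |Lf| <= R.\<close>
    have DD: "D (x + h) * D x \<ge> 1 / 4"
      using mult_mono[OF D[of "x + h"] D[of x]] D[of "x + h"] by simp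
    have "\<bar>(f t (x + h) + f t x) / (D (x + h) * D x)\<bar> \<le> (2 * R) / (1 / 4)"
      unfolding abs_divide using DD pointwise_bounds(1)[OF t, of x] pointwise_bounds(1)[OF t, of "x + h"] by (intro frac_le) auto
    then have "\<bar>(f t (x + h) + f t x) / (D (x + h) * D x)\<bar> * \<bar>Lf t x\<bar> \<le> (8 * R) * R"
      using pointwise_bounds(2)[OF t, of x] R_bounds by (intro mult_mono) auto
    then have "(f t (x + h) + f t x) / (D (x + h) * D x) * Lf t x \<le> 8 * R * R"
      unfolding abs_mult[symmetric] by linarith
    then have "W * ((f t (x + h) + f t x) / (D (x + h) * D x) * Lf t x) \<le> W * (8 * R * R)"
      using pos unfolding W_def[symmetric] by (intro mult_left_mono) auto
    then show "(coef l (f t) (x + h) - coef l (f t) x) * Lf t x \<le> W * (8 * R * R)"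
      unfolding cd by (simp add: mult.assoc)
  qed
  also have "\<dots> = W * (8 * R * R - C / 4)" by (simp add: algebra_simps)
  also have "\<dots> < 0"
  proof (rule mult_pos_neg)
    \<comment> \<open>One factor R is bounded by C/16 and the other by 1/16, so the error is at most
      C/32 and the damping C/4 wins.\<close>
    have "8 * R * R \<le> 8 * (C / 16) * (1 / 16)" using R R_bounds by (intro mult_mono) auto
    then show "8 * R * R - C / 4 < 0" using C_pos by simp
  qed (use pos W_def in simp)
  finally show "ft t (x + h) - ft t x < 0" .
qed

end

section \<open>Function spaces, norm bounds and the weak formulation\<close>

lemma fcoeff_sin_series:
  assumes s: "(\<lambda>k. \<bar>a k\<bar>) summable_on UNIV" and odd: "\<And>k. a (- k) = - a k"
  shows "fcoeff (sin_series a) k = - \<i> * of_real (a k)"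
proof -
  have s': "(\<lambda>k. norm (complex_of_real (a k))) summable_on UNIV" using s by simp
  have "complex_of_real (sin_series a x) * cis (- (real_of_int k * x))
      = - \<i> * (fourier_series (\<lambda>k. of_real (a k)) x * cis (- (real_of_int k * x)))" for x
    unfolding fourier_series_odd[OF assms] by (simp add: mult.assoc[symmetric])
  then have "fcoeff (sin_series a) k = - \<i> * (of_real (2 * pi) * of_real (a k)) / of_real (2 * pi)"
    unfolding fcoeff_def by (simp only: integral_mult_right integral_fourier_series_cis[OF s'])
  then show ?thesis by simp
qed

lemma in_L2_continuous:
  assumes "continuous_on UNIV g"
  shows "in_L2 g"
  unfolding in_L2_def
proof
  have c: "continuous_on {0..2 * pi} g" by (rule continuous_on_subset[OF assms]) simp
  show "g measurable_on {0..2 * pi}"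
    by (subst measurable_on_iff_borel_measurable)
      (auto intro: continuous_imp_measurable_on_sets_lebesgue[OF c])
  show "(\<lambda>x. (g x)\<^sup>2) integrable_on {0..2 * pi}"
    by (intro integrable_continuous_interval continuous_intros c)
qed

text \<open>Vanishing after T reduces the unbounded strip to a compact box. The iterated integral
  has time inside, ready for the fundamental theorem of calculus in t at fixed x.\<close>

lemma has_integral_space_time:
  fixes F :: "real \<times> real \<Rightarrow> real"
  assumes c: "continuous_on ({0..} \<times> UNIV) F" and T: "T \<ge> 0" and z: "\<And>t x. t \<ge> T \<Longrightarrow> F (t, x) = 0"
  shows "(F has_integral (integral {0..2 * pi} (\<lambda>x. integral {0..T} (\<lambda>t. F (t, x))))) ({0..} \<times> {0..2 * pi})"
proof -
  define B where "B = cbox (0::real, 0::real) (T, 2 * pi)"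
  have B: "B = {0..T} \<times> {0..2 * pi}" unfolding B_def by auto
  have cB: "continuous_on B F" by (rule continuous_on_subset[OF c]) (auto simp: B)
  have "integral B F = integral (cbox 0 T) (\<lambda>t. integral (cbox 0 (2 * pi)) (\<lambda>x. F (t, x)))"
    unfolding B_def by (rule integral_prod_continuous) (use cB in \<open>simp add: B_def\<close>)
  also have "\<dots> = integral (cbox 0 (2 * pi)) (\<lambda>x. integral (cbox 0 T) (\<lambda>t. F (t, x)))"
    by (rule integral_swap_continuous) (use cB in \<open>simp add: B_def\<close>)
  finally have I: "integral B F = integral {0..2 * pi} (\<lambda>x. integral {0..T} (\<lambda>t. F (t, x)))" by simp
  have "(F has_integral integral B F) B"
    unfolding B_def by (rule integrable_integral, rule integrable_continuous) (use cB in \<open>simp add: B_def\<close>)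
  then have "((\<lambda>z. if z \<in> B then F z else 0) has_integral integral B F) B"
    by (rule has_integral_eq[rotated]) simp
  then have "((\<lambda>z. if z \<in> B then F z else 0) has_integral integral B F) ({0..} \<times> {0..2 * pi})"
    by (rule has_integral_on_superset) (auto simp: B)
  then have "(F has_integral integral B F) ({0..} \<times> {0..2 * pi})"
  proof (rule has_integral_eq[rotated])
    fix y assume "y \<in> {0::real..} \<times> {0..2 * pi}"
    then show "(if y \<in> B then F y else 0) = F y"
      using z[of "fst y" "snd y"] by (cases "fst y \<le> T") (auto simp: B)
  qed
  then show ?thesis unfolding I .
qed

text \<open>The bound K guarantees that the supremum defining \<open>sup_norm\<close> is a genuine
  one.\<close>

lemma sup_norm_bound:
  assumes "\<And>x. \<bar>g x\<bar> \<le> K"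
  shows "\<bar>g x\<bar> \<le> sup_norm g"
  unfolding sup_norm_def by (rule cSUP_upper) (auto intro!: bdd_aboveI2[where M = K] assms)

context wiener_solution
begin

lemma fcoeff_f: "t \<ge> 0 \<Longrightarrow> fcoeff (f t) k = - \<i> * of_real (inv_Lambda u k t)"
  unfolding f_def by (rule fcoeff_sin_series[OF wiener_le_summable(1)[OF inv_Lambda_le] inv_Lambda_odd])

lemma wiener_series_continuous:
  assumes w: "wiener_le C w M" and t: "t \<ge> 0"
  shows "continuous_on UNIV (sin_series (\<lambda>k. w k t))" "continuous_on UNIV (cos_series (\<lambda>k. w k t))"
proof -
  have "continuous_on UNIV (\<lambda>x. sin_series (\<lambda>k. w k (fst (t, x))) (snd (t, x)))"
    by (rule continuous_on_compose2[OF trig_series_joint_continuous(1)[OF w]])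
      (use t C_pos in \<open>auto intro!: continuous_intros\<close>)
  then show "continuous_on UNIV (sin_series (\<lambda>k. w k t))" by simp
  have "continuous_on UNIV (\<lambda>x. cos_series (\<lambda>k. w k (fst (t, x))) (snd (t, x)))"
    by (rule continuous_on_compose2[OF trig_series_joint_continuous(2)[OF w]])
      (use t C_pos in \<open>auto intro!: continuous_intros\<close>)
  then show "continuous_on UNIV (cos_series (\<lambda>k. w k t))" by simp
qed

lemma periodic_C1_f: assumes t: "t \<ge> 0" shows "periodic_C1 (f t)"
proof -
  have "deriv (f t) = fx t" using deriv_f[OF t] by auto
  then show ?thesis
    unfolding periodic_C1_def periodic2pi_def using f_periodic wiener_series_continuous(2)[OF hilbert_le t] f_has_derivative[OF t]
    by (auto simp: fx_def real_differentiable_def)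
qed

lemma is_Lambda_Lf: assumes t: "t \<ge> 0" shows "is_Lambda (f t) (Lf t)"
  unfolding is_Lambda_def
proof (intro conjI allI)
  show "periodic2pi (Lf t)" unfolding periodic2pi_def Lf_def using trig_series_periodic by blast
  show "in_L2 (Lf t)" unfolding Lf_def by (intro in_L2_continuous wiener_series_continuous[OF u t])
  show "fcoeff (Lf t) k = complex_of_real \<bar>real_of_int k\<bar> * fcoeff (f t) k" for k
  proof -
    have "fcoeff (Lf t) k = - \<i> * of_real (u k t)"
      unfolding Lf_def by (rule fcoeff_sin_series[OF wiener_le_summable(1)[OF u t] u_odd[OF t]])
    also have "\<dots> = - \<i> * of_real (\<bar>real_of_int k\<bar> * inv_Lambda u k t)" by (simp only: Lambda_inv_Lambda[OF t])
    also have "\<dots> = complex_of_real \<bar>real_of_int k\<bar> * fcoeff (f t) k"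
      unfolding fcoeff_f[OF t] by (simp add: mult_ac)
    finally show ?thesis .
  qed
qed

text \<open>The sum of squares of u is at most its largest entry times its l1 norm, hence at most
  M^2. For k nonzero 1 + k^2 <= 2 k^2 gives a factor 2, and 2 pi < 8 turns this into 16 M^2, the
  source of the constant 4.\<close>

lemma H1_f:
  assumes t: "t \<ge> 0"
  shows "in_Hs 1 (f t)" "Hs_norm 1 (f t) \<le> 4 * R * exp (- (C * t))"
proof -
  define M where "M = R * exp (- (C * t))"
  have M: "M \<ge> 0" using R_bounds by (simp add: M_def)
  let ?g = "\<lambda>k::int. (1 + \<bar>real_of_int k\<bar> ^ (2 * 1)) * (cmod (fcoeff (f t) k))\<^sup>2"
  have le: "?g k \<le> 2 * M * \<bar>u k t\<bar>" for k
  proof -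
    have "?g k = (1 + \<bar>real_of_int k\<bar>\<^sup>2) * (inv_Lambda u k t)\<^sup>2"
      unfolding fcoeff_f[OF t] by (simp add: norm_mult)
    also have "\<dots> \<le> (2 * \<bar>real_of_int k\<bar>\<^sup>2) * (inv_Lambda u k t)\<^sup>2"
    proof (cases "k = 0")
      case False
      then have "1 \<le> \<bar>real_of_int k\<bar>" by linarith
      then have "1 \<le> \<bar>real_of_int k\<bar>\<^sup>2" by (rule one_le_power)
      then show ?thesis by (intro mult_right_mono) auto
    qed (simp add: inv_Lambda_def)
    also have "\<dots> = 2 * (\<bar>real_of_int k\<bar> * inv_Lambda u k t)\<^sup>2" by (simp add: power_mult_distrib)
    also have "\<dots> = 2 * (\<bar>u k t\<bar> * \<bar>u k t\<bar>)" unfolding Lambda_inv_Lambda[OF t] by (simp add: power2_eq_square)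
    also have "\<dots> \<le> 2 * (M * \<bar>u k t\<bar>)"
      using wiener_le_bound[OF u t, of k] by (intro mult_left_mono mult_right_mono) (auto simp: M_def)
    finally show ?thesis by simp
  qed
  have s: "(\<lambda>k. 2 * M * \<bar>u k t\<bar>) summable_on UNIV"
    by (intro summable_on_cmult_right wiener_le_summable(1)[OF u t])
  have sg: "?g summable_on UNIV"
    by (rule summable_on_comparison_test[OF s le]) auto
  have fc: "continuous_on UNIV (f t)" unfolding f_def by (rule wiener_series_continuous[OF inv_Lambda_le t])
  show "in_Hs 1 (f t)"
    unfolding in_Hs_def using sg f_periodic in_L2_continuous[OF fc] by (simp add: periodic2pi_def)
  have "infsum ?g UNIV \<le> (\<Sum>\<^sub>\<infinity>k. 2 * M * \<bar>u k t\<bar>)"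
    by (rule infsum_mono[OF sg s le])
  also have "\<dots> = 2 * M * (\<Sum>\<^sub>\<infinity>k. \<bar>u k t\<bar>)" by (rule infsum_cmult_right')
  also have "\<dots> \<le> 2 * M * M"
    using wiener_le_summable(2)[OF u t] M by (intro mult_left_mono) (auto simp: M_def)
  finally have "2 * pi * infsum ?g UNIV \<le> 2 * 4 * (2 * M * M)"
    using pi_less_4 M by (intro mult_mono infsum_nonneg) auto
  also have "\<dots> = (4 * M)\<^sup>2" by (simp add: power2_eq_square)
  finally have "Hs_norm 1 (f t) \<le> sqrt ((4 * M)\<^sup>2)"
    unfolding Hs_norm_def by (rule real_sqrt_le_mono)
  also have "\<dots> = 4 * M" unfolding real_sqrt_abs using M by simp
  finally show "Hs_norm 1 (f t) \<le> 4 * R * exp (- (C * t))" by (simp add: M_def)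
qed

text \<open>The two summands of the norm are controlled separately. For the derivative, the
  Lipschitz bound |h| K on initial differences comes from the mean value inequality, is preserved in
  time by \<open>difference_max_principle\<close>, and returns to fx as h tends to 0.\<close>

lemma C1_norm_f:
  assumes t: "t \<ge> 0"
  shows "C1_norm (f t) \<le> C1_norm (f 0)"
proof -
  define K where "K = sup_norm (deriv (f 0))"
  have f0: "\<bar>f 0 x\<bar> \<le> sup_norm (f 0)" for x by (rule sup_norm_bound[OF pointwise_bounds(1)]) simp
  have fx_bd: "\<bar>deriv (f 0) x\<bar> \<le> R" for x
    using wiener_series_bound(1)[OF hilbert_le, of 0 x] by (simp add: deriv_f fx_def)
  have K: "\<bar>fx 0 x\<bar> \<le> K" for x
    using sup_norm_bound[of "deriv (f 0)", OF fx_bd, of x] by (simp add: K_def deriv_f)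
  have K0: "K \<ge> 0" using K[of 0] by simp
  have s0: "sup_norm (f 0) \<ge> 0" using f0[of 0] by simp
  have up: "f t x \<le> sup_norm (f 0)" for x
    by (rule f_max_principle[OF _ s0 t]) (use f0 abs_le_iff in blast)
  \<comment> \<open>Oddness turns the upper bound at -x into the lower bound at x.\<close>
  have "\<bar>f t x\<bar> \<le> sup_norm (f 0)" for x
    using up[of x] up[of "- x"] sin_series_minus[of "\<lambda>k. inv_Lambda u k t" x] by (simp add: f_def)
  then have 1: "sup_norm (f t) \<le> sup_norm (f 0)"
    unfolding sup_norm_def[of "f t"] by (intro cSUP_least) auto
  have "f 0 (x + h) - f 0 x \<le> \<bar>h\<bar> * K" for x h
  proof -
    have "norm (f 0 (x + h) - f 0 x) \<le> K * norm (x + h - x)"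
      by (rule field_differentiable_bound[of UNIV "f 0" "fx 0"]) (use f_has_derivative K in auto)
    then show ?thesis by (simp add: mult.commute)
  qed
  then have d: "f t (x + h) - f t x \<le> \<bar>h\<bar> * K" for x h
    by (rule difference_max_principle[OF _ _ t]) (use K0 in auto)
  \<comment> \<open>The lower bound is the upper bound for the increment -h taken from the point x +
    h.\<close>
  have "\<bar>f t (x + h) - f t x\<bar> \<le> \<bar>h\<bar> * K" for x h
    using d[of x h] d[of "x + h" "- h"] by simp
  then have q: "\<bar>(f t (x + h) - f t x) / h\<bar> \<le> K" if "h \<noteq> 0" for x h
    using that by (simp add: abs_divide pos_divide_le_eq mult.commute)
  have "\<bar>fx t x\<bar> \<le> K" for x
  proof (rule tendsto_upperbound)
    show "((\<lambda>h. \<bar>(f t (x + h) - f t x) / h\<bar>) \<longlongrightarrow> \<bar>fx t x\<bar>) (at 0)"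
      using f_has_derivative[OF t, of x] unfolding DERIV_def by (rule tendsto_rabs)
    show "\<forall>\<^sub>F h in at 0. \<bar>(f t (x + h) - f t x) / h\<bar> \<le> K"
      using q by (auto simp: eventually_at_filter)
  qed simp
  then have "sup_norm (deriv (f t)) \<le> K"
    unfolding sup_norm_def by (intro cSUP_least) (auto simp: deriv_f[OF t])
  with 1 show ?thesis unfolding C1_norm_def K_def by simp
qed

lemma weak_solution: "global_solution l (f 0) f"
  unfolding global_solution_def
proof (intro conjI allI impI exI[of _ Lf])
  show "f 0 = f 0" ..
  show "periodic_C1 (f t)" "in_Hs 1 (f t)" "is_Lambda (f t) (Lf t)" if "0 \<le> t" for t
    using periodic_C1_f[OF that] H1_f[OF that] is_Lambda_Lf[OF that] by auto
  fix \<psi> \<psi>t assume test: "test_fun \<psi> \<psi>t"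
  from test obtain T0 where T0: "\<And>t x. t \<ge> T0 \<Longrightarrow> \<psi> t x = 0" unfolding test_fun_def by blast
  have der: "((\<lambda>s. \<psi> s x) has_real_derivative \<psi>t t x) (at t)" for t x using test unfolding test_fun_def by blast
  have c\<psi>: "continuous_on S (\<lambda>p. \<psi> (fst p) (snd p))" "continuous_on S (\<lambda>p. \<psi>t (fst p) (snd p))" for S
    using test continuous_on_subset[of UNIV] unfolding test_fun_def by blast+
  \<comment> \<open>With T > T0 the test function vanishes on a neighbourhood of each t >= T, so its
    time derivative vanishes there too.\<close>
  define T where "T = max T0 0 + 1"
  have T: "T \<ge> 0" "T > T0" unfolding T_def by auto
  have z: "\<psi> t x = 0" "\<psi>t t x = 0" if "t \<ge> T" for t x
  proof -
    show "\<psi> t x = 0" using T0 T that by simp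
    have "((\<lambda>s. \<psi> s x) has_real_derivative 0) (at t)"
      by (rule has_field_derivative_transform_within_open[of "\<lambda>s. 0" 0 t "{T0<..}"]) (use T0 T that in auto)
    then show "\<psi>t t x = 0" using der DERIV_unique by blast
  qed
  define F1 where "F1 p = f (fst p) (snd p) * \<psi>t (fst p) (snd p)" for p
  define F2 where "F2 p = ft (fst p) (snd p) * \<psi> (fst p) (snd p)" for p
  have F2: "(\<lambda>p. coef l (f (fst p)) (snd p) * Lf (fst p) (snd p) * \<psi> (fst p) (snd p)) = F2"
    by (simp add: F2_def ft_def fun_eq_iff)
  have F1: "(\<lambda>p. f (fst p) (snd p) * \<psi>t (fst p) (snd p)) = F1" by (simp add: F1_def fun_eq_iff)
  have c1: "continuous_on ({0..} \<times> UNIV) F1" and c2: "continuous_on ({0..} \<times> UNIV) F2"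
    unfolding F1_def F2_def by (intro continuous_intros f_cont ft_cont c\<psi>)+
  note i1 = has_integral_space_time[OF c1 T(1)] and i2 = has_integral_space_time[OF c2 T(1)]
    and i12 = has_integral_space_time[OF continuous_on_add[OF c1 c2] T(1)]
  have i1: "F1 integrable_on {0..} \<times> {0..2 * pi}" and i2: "F2 integrable_on {0..} \<times> {0..2 * pi}"
    using i1 i2 z by (auto simp: integrable_on_def F1_def F2_def)
  show "(\<lambda>p. f (fst p) (snd p) * \<psi>t (fst p) (snd p)) integrable_on {0..} \<times> {0..2 * pi}"
    unfolding F1 by (rule i1)
  show "(\<lambda>p. coef l (f (fst p)) (snd p) * Lf (fst p) (snd p) * \<psi> (fst p) (snd p)) integrable_on {0..} \<times> {0..2 * pi}"
    unfolding F2 by (rule i2)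
  \<comment> \<open>F1 + F2 is the time derivative of the product of f and the test function; the
    boundary term at T vanishes and the one at 0 is the initial term of the weak
    formulation.\<close>
  have inner: "integral {0..T} (\<lambda>t. F1 (t, x) + F2 (t, x)) = - (f 0 x * \<psi> 0 x)" for x
  proof -
    have "((\<lambda>t. F1 (t, x) + F2 (t, x)) has_integral (f T x * \<psi> T x - f 0 x * \<psi> 0 x)) {0..T}"
    proof (rule fundamental_theorem_of_calculus[where f = "\<lambda>t. f t x * \<psi> t x"])
      fix t assume t: "t \<in> {0..T}"
      have "((\<lambda>s. f s x) has_real_derivative ft t x) (at t within {0..T})"
        by (rule DERIV_subset[OF f_time_derivative]) (use t in auto)
      moreover have "((\<lambda>s. \<psi> s x) has_real_derivative \<psi>t t x) (at t within {0..T})"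
        by (rule DERIV_subset[OF der]) auto
      ultimately have "((\<lambda>t. f t x * \<psi> t x) has_real_derivative F1 (t, x) + F2 (t, x)) (at t within {0..T})"
        by (auto intro!: derivative_eq_intros simp: F1_def F2_def)
      then show "((\<lambda>t. f t x * \<psi> t x) has_vector_derivative F1 (t, x) + F2 (t, x)) (at t within {0..T})"
        by (simp add: has_real_derivative_iff_has_vector_derivative)
    qed (rule T)
    then show ?thesis by (simp add: integral_unique z)
  qed
  have "integral ({0..} \<times> {0..2 * pi}) F1 + integral ({0..} \<times> {0..2 * pi}) F2
      = integral ({0..} \<times> {0..2 * pi}) (\<lambda>z. F1 z + F2 z)"
    by (rule integral_add[symmetric]) (rule i1, rule i2)
  also have "\<dots> = integral {0..2 * pi} (\<lambda>x. integral {0..T} (\<lambda>t. F1 (t, x) + F2 (t, x)))"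
    by (rule integral_unique[OF i12]) (simp add: F1_def F2_def z)
  also have "\<dots> = - integral {0..2 * pi} (\<lambda>x. f 0 x * \<psi> 0 x)"
    unfolding inner by simp
  finally show "integral ({0..} \<times> {0..2 * pi}) (\<lambda>p. f (fst p) (snd p) * \<psi>t (fst p) (snd p))
      + integral {0..2 * pi} (\<lambda>x. f 0 x * \<psi> 0 x)
      + integral ({0..} \<times> {0..2 * pi}) (\<lambda>p. coef l (f (fst p)) (snd p) * Lf (fst p) (snd p) * \<psi> (fst p) (snd p)) = 0"
    unfolding F1 F2 by simp
qed

end

section \<open>Initial data\<close>

text \<open>The product formula writes sin(kx) cos x as half the sum of the sines of (k+1)x and
  (k-1)x, hence an induction on j for all k at once. With k = 1 it makes D orthogonal to sin x times
  every polynomial in cos x.\<close>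

lemma integral_sin_power_cos:
  fixes D :: "real \<Rightarrow> real"
  assumes D: "continuous_on {0..2 * pi} D"
    and z: "\<And>k. integral {0..2 * pi} (\<lambda>x. D x * sin (real_of_int k * x)) = 0"
  shows "integral {0..2 * pi} (\<lambda>x. D x * sin (real_of_int k * x) * cos x ^ j) = 0"
proof (induction j arbitrary: k)
  case 0
  then show ?case using z by simp
next
  case (Suc j)
  have c: "continuous_on {0..2 * pi} (\<lambda>x. D x * sin (real_of_int k * x) * cos x ^ j)" for k
    by (intro continuous_intros D)
  have "D x * sin (real_of_int k * x) * cos x ^ Suc j = 1 / 2 * (D x * sin (real_of_int (k + 1) * x) * cos x ^ j
      + D x * sin (real_of_int (k - 1) * x) * cos x ^ j)" for x
  proof -
    have "sin (real_of_int k * x) * cos x = 1 / 2 * (sin (real_of_int (k + 1) * x) + sin (real_of_int (k - 1) * x))"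
      by (simp add: sin_add sin_diff algebra_simps)
    then have "D x * (sin (real_of_int k * x) * cos x) * cos x ^ j
        = D x * (1 / 2 * (sin (real_of_int (k + 1) * x) + sin (real_of_int (k - 1) * x))) * cos x ^ j" by simp
    then show ?thesis by (simp add: algebra_simps)
  qed
  then show ?case
    by (simp only: integral_mult_right integral_add[OF integrable_continuous_interval[OF c] integrable_continuous_interval[OF c]] Suc)
      simp
qed

text \<open>
  An odd periodic function is a function of \<open>cos x\<close> on \<open>[0, \<pi>]\<close>, so Weierstrass approximation by polynomials in
  \<open>cos x\<close> applies, and \<open>\<integral> D(x) sin x D(arccos (cos x)) dx = \<integral> D\<^sup>2 |sin x| dx\<close> must vanish.
\<close>

lemma odd_periodic_eq_0:
  fixes D :: "real \<Rightarrow> real"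
  assumes cont: "continuous_on UNIV D" and odd: "\<And>x. D (- x) = - D x" and per: "\<And>x. D (x + 2 * pi) = D x"
    and z: "\<And>k. integral {0..2 * pi} (\<lambda>x. D x * sin (real_of_int k * x)) = 0"
  shows "D x = 0"
proof -
  have cD: "continuous_on S D" for S by (rule continuous_on_subset[OF cont]) simp
  define g where "g y = D (arccos y)" for y
  have g: "continuous_on {-1..1} g"
    unfolding g_def by (rule continuous_on_compose2[OF cont continuous_on_arccos']) auto
  have gc: "continuous_on {0..2 * pi} (\<lambda>x. g (cos x))"
    by (rule continuous_on_compose2[OF g]) (auto intro!: continuous_intros)
  have eq: "D x * sin x * g (cos x) = (D x)\<^sup>2 * \<bar>sin x\<bar>" if x: "x \<in> {0..2 * pi}" for x
  proof (cases "x \<le> pi")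
    case True
    then have "g (cos x) = D x" "sin x \<ge> 0" using x by (auto simp: g_def arccos_cos intro: sin_ge_zero)
    then show ?thesis by (simp add: power2_eq_square)
  next
    case False
    have "cos (2 * pi - x) = cos x" by (simp add: cos_diff)
    then have "g (cos x) = D (2 * pi - x)" unfolding g_def using arccos_cos[of "2 * pi - x"] False x by simp
    also have "\<dots> = - D x" using per[of "- x"] odd[of x] by simp
    finally have "g (cos x) = - D x" .
    moreover have "sin x \<le> 0" using sin_le_zero[of x] False x by (cases "x = 2 * pi") auto
    ultimately show ?thesis by (simp add: power2_eq_square)
  qed
  define S where "S = integral {0..2 * pi} (\<lambda>x. D x * sin x * g (cos x))"
  have "bounded (D ` {0..2 * pi})"
    by (rule compact_imp_bounded[OF compact_continuous_image[OF cD compact_Icc]])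
  then obtain B where B: "\<And>x. x \<in> {0..2 * pi} \<Longrightarrow> \<bar>D x\<bar> \<le> B"
    unfolding bounded_iff real_norm_def by blast
  have B0: "B \<ge> 0" using B[of 0] by force
  \<comment> \<open>Replacing g by a polynomial P with error e makes the integral 0 by
    \<open>integral_sin_power_cos\<close>; the remainder has integrand at most e B.\<close>
  have S_le: "\<bar>S\<bar> \<le> e * (B * (2 * pi))" if e: "e > 0" for e
  proof -
    obtain P where P: "real_polynomial_function P" "\<And>y. y \<in> {-1..1} \<Longrightarrow> \<bar>g y - P y\<bar> < e"
      using Stone_Weierstrass_real_polynomial_function[OF compact_Icc g e] by blast
    obtain a n where an: "P = (\<lambda>y. \<Sum>i\<le>n. a i * y ^ i)"
      using P(1) unfolding real_polynomial_function_iff_sum by blast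
    have Pc: "continuous_on {0..2 * pi} (\<lambda>x. D x * sin x * P (cos x))"
      unfolding an by (intro continuous_intros cD)
    have "integral {0..2 * pi} (\<lambda>x. D x * sin x * P (cos x))
        = integral {0..2 * pi} (\<lambda>x. \<Sum>i\<le>n. a i * (D x * sin (real_of_int 1 * x) * cos x ^ i))"
      unfolding an by (simp add: sum_distrib_left mult_ac)
    also have "\<dots> = (\<Sum>i\<le>n. integral {0..2 * pi} (\<lambda>x. a i * (D x * sin (real_of_int 1 * x) * cos x ^ i)))"
      by (intro integral_sum integrable_continuous_interval continuous_intros cD) auto
    also have "\<dots> = 0"
      unfolding integral_mult_right integral_sin_power_cos[OF cD z] by simp
    finally have "S = integral {0..2 * pi} (\<lambda>x. D x * sin x * g (cos x) - D x * sin x * P (cos x))"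
      unfolding S_def by (subst integral_diff) (auto intro!: integrable_continuous_interval continuous_intros cD gc Pc)
    also have "norm \<dots> \<le> integral {0..2 * pi} (\<lambda>x. e * B)"
    proof (rule integral_norm_bound_integral)
      show "(\<lambda>x. D x * sin x * g (cos x) - D x * sin x * P (cos x)) integrable_on {0..2 * pi}"
        by (intro integrable_continuous_interval continuous_intros cD gc Pc)
      fix x assume x: "x \<in> {0..2 * pi}"
      have "norm (D x * sin x * g (cos x) - D x * sin x * P (cos x)) = \<bar>D x\<bar> * \<bar>sin x\<bar> * \<bar>g (cos x) - P (cos x)\<bar>"
        by (simp add: abs_mult right_diff_distrib[symmetric])
      also have "\<dots> \<le> B * 1 * e"
        using B[OF x] B0 P(2)[of "cos x"] by (intro mult_mono) auto
      finally show "norm (D x * sin x * g (cos x) - D x * sin x * P (cos x)) \<le> e * B" by (simp add: mult_ac)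
    qed (rule integrable_const_ivl)
    finally show ?thesis by (simp add: mult_ac)
  qed
  have S0: "\<bar>S\<bar> \<le> 0"
  proof (rule field_le_epsilon)
    fix e :: real assume e: "e > 0"
    have d: "B * (2 * pi) + 1 > 0" using B0 pi_gt_zero by (intro add_nonneg_pos mult_nonneg_nonneg) auto
    have "\<bar>S\<bar> \<le> e / (B * (2 * pi) + 1) * (B * (2 * pi))"
      using e d by (intro S_le divide_pos_pos)
    also have "\<dots> \<le> e" using e d by (simp add: field_simps)
    finally show "\<bar>S\<bar> \<le> 0 + e" by simp
  qed
  have "S = integral {0..2 * pi} (\<lambda>x. (D x)\<^sup>2 * \<bar>sin x\<bar>)"
    unfolding S_def by (rule integral_cong) (rule eq)
  then have "integral {0..2 * pi} (\<lambda>x. (D x)\<^sup>2 * \<bar>sin x\<bar>) = 0" using S0 by simp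
  then have zero: "(D x)\<^sup>2 * \<bar>sin x\<bar> = 0" if "x \<in> {0..2 * pi}" for x
    using that by (subst (asm) integral_eq_0_iff) (auto intro!: continuous_intros cD)
  obtain y where y: "y \<in> {0..2 * pi}" "D x = D y" by (rule periodic_reduce[of D x, OF per])
  have "D y = 0"
  proof (cases "sin y = 0")
    case False
    then show ?thesis using zero[OF y(1)] by simp
  next
    \<comment> \<open>The weight |sin| says nothing at its zeros 0, pi and 2 pi, but oddness and
      periodicity force D to vanish there.\<close>
    case True
    have D0: "D 0 = 0" using odd[of 0] by simp
    have Dpi: "D pi = 0" using odd[of pi] per[of "- pi"] by simp
    have D2: "D (2 * pi) = 0" using per[of 0] D0 by simp
    consider "y = 0" | "y = 2 * pi" | "0 < y" "y < 2 * pi" using y(1) by force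
    then show ?thesis
    proof cases
      case 3
      then have "y - pi = 0" using sin_eq_0_pi[of "y - pi"] True by (simp add: sin_diff)
      then show ?thesis using Dpi by simp
    qed (use D0 D2 in auto)
  qed
  with y show ?thesis by simp
qed

lemma Im_fcoeff:
  assumes "continuous_on UNIV g"
  shows "Im (fcoeff g k) = - (integral {0..2 * pi} (\<lambda>x. g x * sin (real_of_int k * x)) / (2 * pi))"
proof -
  have c: "continuous_on {0..2 * pi} g" by (rule continuous_on_subset[OF assms]) simp
  have "(\<lambda>x. complex_of_real (g x) * cis (- (real_of_int k * x))) integrable_on {0..2 * pi}"
    by (intro integrable_continuous_interval continuous_intros c)
  from integral_linear[OF this bounded_linear_Im]
  have "Im (integral {0..2 * pi} (\<lambda>x. complex_of_real (g x) * cis (- (real_of_int k * x))))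
      = integral {0..2 * pi} (\<lambda>x. - (g x * sin (real_of_int k * x)))"
    by (simp add: o_def)
  moreover have "Im (z / (2 * pi)) = Im z / (2 * pi)" for z
    using Im_divide_of_real[of z "2 * pi"] by simp
  ultimately show ?thesis unfolding fcoeff_def by simp
qed

text \<open>The term at k = 0 is 1 / 0 = 0, so the sum runs over the nonzero modes in
  effect.\<close>

lemma summable_inverse_square_int: "(\<lambda>k::int. 1 / (real_of_int k)\<^sup>2) summable_on UNIV"
proof -
  have n: "(\<lambda>n::nat. 1 / (real n)\<^sup>2) summable_on UNIV"
    by (rule summable_nonneg_imp_summable_on) (use inverse_power_summable[of 2, where 'a = real] in \<open>auto simp: inverse_eq_divide\<close>)
  have "(\<lambda>k::int. 1 / (real_of_int k)\<^sup>2) summable_on range int"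
    by (subst summable_on_reindex) (use n in \<open>auto simp: o_def inj_def\<close>)
  moreover have "(\<lambda>k::int. 1 / (real_of_int k)\<^sup>2) summable_on range (\<lambda>n. - int n)"
    by (subst summable_on_reindex) (use n in \<open>auto simp: o_def inj_def\<close>)
  moreover have "(UNIV :: int set) = range int \<union> range (\<lambda>n. - int n)"
  proof -
    have "k \<in> range int \<union> range (\<lambda>n. - int n)" for k
      by (cases k rule: int_cases2) auto
    then show ?thesis by auto
  qed
  ultimately show ?thesis using summable_on_union[of _ "range int" "range (\<lambda>n. - int n)"] by simp
qed

text \<open>The inequality 2ab <= a^2 + b^2 with a = sqrt d / |k| and b = k^2 |y| / sqrt d. Summed
  over k it replaces Cauchy-Schwarz; the weight d balances the two parts.\<close>

lemma abs_mult_le_of_weights: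
  fixes k y d :: real
  assumes "d > 0" "k \<noteq> 0"
  shows "\<bar>k\<bar> * \<bar>y\<bar> \<le> (d * (1 / k\<^sup>2) + k ^ 4 * y\<^sup>2 / d) / 2"
proof -
  define a b where "a = sqrt d / \<bar>k\<bar>" and "b = k\<^sup>2 * \<bar>y\<bar> / sqrt d"
  have "k\<^sup>2 = \<bar>k\<bar> * \<bar>k\<bar>" by (simp add: power2_eq_square)
  then have "a * b = sqrt d / \<bar>k\<bar> * (\<bar>k\<bar> * \<bar>k\<bar> * \<bar>y\<bar> / sqrt d)" unfolding a_def b_def by (simp only:)
  also have "\<dots> = \<bar>k\<bar> * \<bar>y\<bar>" using assms by (simp del: abs_mult_self_eq)
  finally have "a * b = \<bar>k\<bar> * \<bar>y\<bar>" .
  moreover have "a\<^sup>2 = d * (1 / k\<^sup>2)" using assms by (simp add: a_def power_divide)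
  moreover have "b\<^sup>2 = k ^ 4 * y\<^sup>2 / d" using assms by (simp add: b_def power_divide power_mult_distrib flip: power_mult)
  moreover have "2 * (a * b) \<le> a\<^sup>2 + b\<^sup>2" using sum_squares_bound[of a b] by simp
  ultimately show ?thesis by simp
qed

text \<open>Taking the weight equal to delta, the part with 1/k^2 contributes delta times its sum,
  and the H^2 part at most delta^2 / delta. The bound is thus linear in delta. For the decay,
  exp(-C|k|t) <= exp(-Ct) on all modes k other than 0.\<close>

lemma lin_part_small:
  assumes C: "C > 0" and d: "\<delta> > 0" and H: "in_Hs 2 g" "Hs_norm 2 g \<le> \<delta>" and \<phi>0: "\<phi> 0 = 0"
    and \<phi>: "\<And>k. \<bar>\<phi> k\<bar> \<le> cmod (fcoeff g k)"
  shows "wiener_le C (lin_part C \<phi>) (\<delta> * ((\<Sum>\<^sub>\<infinity>k::int. 1 / (real_of_int k)\<^sup>2) + 1) / 2)"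
    and "(\<lambda>k. \<bar>\<phi> k\<bar>) summable_on UNIV"
proof -
  define h where "h k = (1 + \<bar>real_of_int k\<bar> ^ (2 * 2)) * (cmod (fcoeff g k))\<^sup>2" for k
  have hs: "h summable_on UNIV" using H(1) unfolding in_Hs_def h_def by blast
  have h0: "h k \<ge> 0" for k by (simp add: h_def)
  have hle: "infsum h UNIV \<le> \<delta>\<^sup>2"
  proof -
    have "sqrt (2 * pi * infsum h UNIV) \<le> \<delta>" using H(2) unfolding Hs_norm_def h_def .
    then have "2 * pi * infsum h UNIV \<le> \<delta>\<^sup>2" using sqrt_le_D by blast
    moreover have "1 * infsum h UNIV \<le> 2 * pi * infsum h UNIV"
      using pi_gt3 by (intro mult_right_mono infsum_nonneg h0) auto
    ultimately show ?thesis by simp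
  qed
  define a where "a k = 1 / 2 * (\<delta> * (1 / (real_of_int k)\<^sup>2) + 1 / \<delta> * h k)" for k
  have s: "(\<lambda>k::int. \<delta> * (1 / (real_of_int k)\<^sup>2)) summable_on UNIV" "(\<lambda>k. 1 / \<delta> * h k) summable_on UNIV"
    by (intro summable_on_cmult_right summable_inverse_square_int hs)+
  have as: "a summable_on UNIV" unfolding a_def by (intro summable_on_cmult_right summable_on_add s)
  have "infsum a UNIV = 1 / 2 * (\<delta> * (\<Sum>\<^sub>\<infinity>k::int. 1 / (real_of_int k)\<^sup>2) + 1 / \<delta> * infsum h UNIV)"
    unfolding a_def infsum_cmult_right' infsum_add[OF s] ..
  also have "\<dots> \<le> 1 / 2 * (\<delta> * (\<Sum>\<^sub>\<infinity>k::int. 1 / (real_of_int k)\<^sup>2) + 1 / \<delta> * \<delta>\<^sup>2)"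
    using d hle by (intro mult_left_mono add_left_mono) auto
  also have "\<dots> = \<delta> * ((\<Sum>\<^sub>\<infinity>k::int. 1 / (real_of_int k)\<^sup>2) + 1) / 2"
    using d by (simp add: power2_eq_square distrib_left)
  finally have ai: "infsum a UNIV \<le> \<delta> * ((\<Sum>\<^sub>\<infinity>k::int. 1 / (real_of_int k)\<^sup>2) + 1) / 2" .
  have a0: "a k \<ge> 0" for k using d h0 by (simp add: a_def)
  have le: "\<bar>real_of_int k\<bar> * \<bar>\<phi> k\<bar> \<le> a k" for k
  proof (cases "k = 0")
    case False
    have "(\<phi> k)\<^sup>2 \<le> (cmod (fcoeff g k))\<^sup>2"
      using power_mono[OF \<phi>[of k], of 2] by simp
    then have "real_of_int k ^ 4 * (\<phi> k)\<^sup>2 \<le> h k"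
      unfolding h_def by (intro mult_mono) auto
    then have "real_of_int k ^ 4 * (\<phi> k)\<^sup>2 / \<delta> \<le> h k / \<delta>" using d by (intro divide_right_mono) auto
    then show ?thesis
      using abs_mult_le_of_weights[OF d, of "real_of_int k" "\<phi> k"] False unfolding a_def by simp
  qed (use a0 in simp)
  have k1: "1 \<le> \<bar>real_of_int k\<bar>" if "k \<noteq> 0" for k using that by linarith
  show "(\<lambda>k. \<bar>\<phi> k\<bar>) summable_on UNIV"
  proof (rule summable_on_comparison_test[OF as])
    fix k
    show "\<bar>\<phi> k\<bar> \<le> a k"
    proof (cases "k = 0")
      case False
      from mult_right_mono[OF k1[OF this], of "\<bar>\<phi> k\<bar>"] le[of k] show ?thesis by simp
    qed (use a0 \<phi>0 in simp)
  qed auto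
  show "wiener_le C (lin_part C \<phi>) (\<delta> * ((\<Sum>\<^sub>\<infinity>k::int. 1 / (real_of_int k)\<^sup>2) + 1) / 2)"
  proof (rule wiener_leI[OF _ as ai])
    show "continuous_on {0..} (lin_part C \<phi> k)" for k
      unfolding lin_part_def[abs_def] by (intro continuous_intros)
    fix k and t :: real assume t: "t \<ge> 0"
    show "\<bar>lin_part C \<phi> k t\<bar> \<le> a k * exp (- (C * t))"
    proof (cases "k = 0")
      case False
      have "C * t * 1 \<le> C * t * \<bar>real_of_int k\<bar>" using C t k1[OF False] by (intro mult_left_mono) auto
      then have "exp (- (C * \<bar>real_of_int k\<bar> * t)) \<le> exp (- (C * t))" by (simp add: mult_ac)
      then have "\<bar>real_of_int k\<bar> * \<bar>\<phi> k\<bar> * exp (- (C * \<bar>real_of_int k\<bar> * t)) \<le> a k * exp (- (C * t))"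
        using le[of k] a0[of k] by (intro mult_mono) auto
      then show ?thesis by (simp add: lin_part_def abs_mult mult_ac)
    qed (use a0 in \<open>simp add: lin_part_def\<close>)
  qed
qed

theorem theorem5:
  fixes l :: real
  assumes "l > 0"
  shows "\<exists>\<delta>>0. \<forall>f0 :: real \<Rightarrow> real.
     (periodic_C1 f0 \<and> in_Hs 2 f0 \<and> (\<forall>x. f0 (- x) = - f0 x) \<and> sup_norm f0 < l \<and>
      (\<forall>x. 1 / (1 + (deriv f0 x)^2) > 1 / (1 + l^2 - (f0 x)^2)) \<and>
      Hs_norm 2 f0 \<le> \<delta>)
     \<longrightarrow> (\<exists>f. global_solution l f0 f \<and>
           (\<forall>t\<ge>0. Hs_norm 1 (f t) \<le> l / 4 * exp (- (l^2 / (1 + l^2)) * t) \<and>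
                   C1_norm (f t) \<le> C1_norm f0))"
proof -
  \<comment> \<open>C/16 is the contraction threshold of \<open>map_lipschitz\<close>; l/16 turns
    the bound 4R of \<open>H1_f\<close> into l/4.\<close>
  define C m R K where "C = l\<^sup>2 / (1 + l\<^sup>2)" and "m = 1 + l\<^sup>2" and "R = min (C / 16) (l / 16)"
    and "K = (\<Sum>\<^sub>\<infinity>k::int. 1 / (real_of_int k)\<^sup>2)"
  have m: "m > 1" using assms by (simp add: m_def)
  have C: "C > 0" "C \<le> 1"
  proof -
    have "0 < l\<^sup>2" "0 < 1 + l\<^sup>2" using assms by (simp_all add: add_pos_pos)
    then show "C > 0" "C \<le> 1" unfolding C_def by simp_all
  qed
  have R: "R > 0" "R \<le> C / 16" and R_le: "R \<le> l / 16" using C assms by (auto simp: R_def)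
  have K: "K \<ge> 0" unfolding K_def by (intro infsum_nonneg) auto
  \<comment> \<open>Chosen so that the bound of \<open>lin_part_small\<close> becomes the R/2
    demanded by \<open>wiener_fixed_point\<close>.\<close>
  define \<delta> where "\<delta> = R / (K + 1)"
  have d: "\<delta> > 0" "\<delta> * (K + 1) / 2 = R / 2" using R K by (auto simp: \<delta>_def)
  have "\<exists>f. global_solution l f0 f \<and>
      (\<forall>t\<ge>0. Hs_norm 1 (f t) \<le> l / 4 * exp (- (l^2 / (1 + l^2)) * t) \<and> C1_norm (f t) \<le> C1_norm f0)"
    if f0: "periodic_C1 f0" "in_Hs 2 f0" "\<And>x. f0 (- x) = - f0 x" "Hs_norm 2 f0 \<le> \<delta>" for f0
  proof -
    \<comment> \<open>An odd real function has coefficients -i phi_k. Taking the imaginary part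
      makes phi real and bounded by the coefficients at once; oddness in k is read off the sine
      integral.\<close>
    define \<phi> where "\<phi> k = - Im (fcoeff f0 k)" for k
    have c0: "continuous_on UNIV f0"
      using f0(1) unfolding periodic_C1_def
      by (auto intro!: differentiable_imp_continuous_on simp: differentiable_on_def intro: differentiable_at_withinI)
    have \<phi>_odd: "\<phi> (- k) = - \<phi> k" for k unfolding \<phi>_def Im_fcoeff[OF c0] by simp
    have \<phi>0: "\<phi> 0 = 0" using \<phi>_odd[of 0] by simp
    have \<phi>_le: "\<bar>\<phi> k\<bar> \<le> cmod (fcoeff f0 k)" for k unfolding \<phi>_def using abs_Im_le_cmod[of "fcoeff f0 k"] by simp
    note small = lin_part_small[OF C(1) d(1) f0(2,4) \<phi>0 \<phi>_le, folded K_def, unfolded d(2)]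
    obtain u p q where upq: "wiener_le C u R" "wiener_le C p R" "wiener_le C q R"
      "\<And>k t. t \<ge> 0 \<Longrightarrow> u k t = mapU C \<phi> u p q k t" "\<And>k t. t \<ge> 0 \<Longrightarrow> p k t = mapP u p k t"
      "\<And>k t. t \<ge> 0 \<Longrightarrow> q k t = mapQ m u q k t" "\<And>k t. t \<ge> 0 \<Longrightarrow> u (- k) t = - u k t"
      "\<And>k t. t \<ge> 0 \<Longrightarrow> p (- k) t = p k t" "\<And>k t. t \<ge> 0 \<Longrightarrow> q (- k) t = q k t"
      using wiener_fixed_point[OF C less_imp_le[OF m] R(2) small(1) \<phi>_odd] by blast
    interpret wiener_solution l C m R \<phi> u p q
      by unfold_locales (fact assms C_def m_def R(2) upq \<phi>_odd)+
    have sc: "continuous_on UNIV (sin_series \<phi>)"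
      using periodic_C1_f[of 0] f_0 unfolding periodic_C1_def
      by (auto intro!: differentiable_imp_continuous_on simp: differentiable_on_def intro: differentiable_at_withinI)
    \<comment> \<open>The constructed solution starts at the sine series of phi. That this series
      represents f0 at every point follows from uniqueness: both are continuous, odd and periodic,
      with the same sine coefficients.\<close>
    have "f0 x - sin_series \<phi> x = 0" for x
    proof (rule odd_periodic_eq_0[of "\<lambda>x. f0 x - sin_series \<phi> x"])
      show "continuous_on UNIV (\<lambda>x. f0 x - sin_series \<phi> x)" by (intro continuous_intros c0 sc)
      show "f0 (- x) - sin_series \<phi> (- x) = - (f0 x - sin_series \<phi> x)" for x by (simp add: f0(3) sin_series_minus)
      show "f0 (x + 2 * pi) - sin_series \<phi> (x + 2 * pi) = f0 x - sin_series \<phi> x" for x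
        using f0(1) by (simp add: trig_series_periodic periodic_C1_def periodic2pi_def)
      fix k
      have "continuous_on {0..2 * pi} f0" "continuous_on {0..2 * pi} (sin_series \<phi>)"
        using c0 sc continuous_on_subset by blast+
      then have "integral {0..2 * pi} (\<lambda>x. (f0 x - sin_series \<phi> x) * sin (real_of_int k * x))
          = integral {0..2 * pi} (\<lambda>x. f0 x * sin (real_of_int k * x)) - integral {0..2 * pi} (\<lambda>x. sin_series \<phi> x * sin (real_of_int k * x))"
        unfolding left_diff_distrib by (intro integral_diff integrable_continuous_interval continuous_intros)
      also have "\<dots> = - (2 * pi) * Im (fcoeff f0 k) + 2 * pi * Im (fcoeff (sin_series \<phi>) k)"
        unfolding Im_fcoeff[OF c0] Im_fcoeff[OF sc] by simp
      also have "\<dots> = 0" unfolding fcoeff_sin_series[OF small(2) \<phi>_odd] by (simp add: \<phi>_def)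
      finally show "integral {0..2 * pi} (\<lambda>x. (f0 x - sin_series \<phi> x) * sin (real_of_int k * x)) = 0" .
    qed
    then have f_init: "f 0 = f0" unfolding f_0 by auto
    have "Hs_norm 1 (f t) \<le> l / 4 * exp (- (l\<^sup>2 / (1 + l\<^sup>2)) * t)" if t: "t \<ge> 0" for t
    proof -
      have "4 * R * exp (- (C * t)) \<le> l / 4 * exp (- (C * t))" using R_le by (intro mult_right_mono) auto
      from order_trans[OF H1_f(2)[OF t] this] show ?thesis unfolding C_def minus_mult_left .
    qed
    then show ?thesis using weak_solution C1_norm_f unfolding f_init by blast
  qed
  with d(1) show ?thesis by blast
qed

end
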